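(* Let $d=1$ and $T>0$, and let $m,N$ be integers with $3\le m\le N+1$. Let $w=w(t)$ be the solution of the one-dimensional $w$ equation with initial value $w_0=w(0)$, and let $w_N$ be the solution of the truncated equation $\mathrm{i}\partial_tw_N=\hat\Pi_N\hat H(t)w_N$, $w_N(0)=\hat\Pi_Nw_0$ (see context). Suppose that $\hat\Pi_Nw(t)-w(t)\in\mathbb{H}^3(\mathbb{R})$ up to time $T$, that $\mathcal{A}^mw(t)\in\mathbb{L}^2(\mathbb{R})$, that $V^{(3)}\in\mathbb{L}^\infty(\mathbb{R})$, and that the stability condition $$\|\mathcal{A}^mw(t)\|_{\mathbb{L}^2_\eta}\le B(m,T)\,\|\mathcal{A}^mw(0)\|_{\mathbb{L}^2_\eta}\qquad\text{for }t\in[0,T]$$ holds. Then there exist constants $B_1(m,T),B_2(m,T)$ independent of $w_0$ such that, for $t\in[0,T]$, $$\|w(t)-w_N(t)\|_{\mathbb{L}^2_\eta}\le B_1(m,T)\sqrt{\frac{(N-m+1)!}{(N+1)!}}\,\|\mathcal{A}^mw(0)\|_{\mathbb{L}^2_\eta}+B_2(m,T)\,T\,\frac{\varepsilon^{1/2}}{\tilde\alpha_I^{3/2}}\sqrt{\frac{(N-m+1)!}{(N-2)!}}\,\|\mathcal{A}^mw(0)\|_{\mathbb{L}^2_\eta},$$ where $\tilde\alpha_I=\min_{0\le t\le T}\alpha_I(t)$.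
   Context: $V:\mathbb{R}\to\mathbb{R}$ is a fixed sufficiently smooth potential, $V^{(3)}$ its third derivative, and $0<\varepsilon\ll1$. Parameters (all functions of $t$): $\dot q=p$, $\dot p=-V'(q)$, $\dot\alpha=-2\alpha^2-\frac12V''(q)$ with $\alpha=\alpha_R+\mathrm{i}\alpha_I$ complex, $\alpha_I(0)>0$, and $\dot B=-2B\alpha_R$, $B(0)=\sqrt{\alpha_I(0)}$; then $\alpha_I=B^2>0$ for all $t$. The one-dimensional $w$ equation is $\mathrm{i}\partial_tw=\hat H(t)w$ with $$\hat H(t)w=-\tfrac12\alpha_I\,\partial_\eta^2w+2\alpha_I\eta^2w+\sqrt\varepsilon\,U(\eta;q)w,$$ $$U(\eta;q)=\varepsilon^{-3/2}\big[V(q+\sqrt\varepsilon B^{-1}\eta)-V(q)-\sqrt\varepsilon\,V'(q)B^{-1}\eta-\tfrac{\varepsilon}{2}V''(q)B^{-2}\eta^2\big].$$ Let $Q_h(t)=\frac1{\sqrt2}\exp\big(2\mathrm{i}\int_0^t\alpha_I(s)\,ds\big)$ and $P_h(t)=\sqrt2\,\mathrm{i}\exp\big(2\mathrm{i}\int_0^t\alpha_I(s)\,ds\big)$. The (time-dependent) lowering and raising operators are $\mathcal{A}=\frac1{\sqrt2}\big[\mathrm{i}Q_h(-\mathrm{i}\partial_\eta)-\mathrm{i}P_h\eta\big]$ and $\mathcal{A}^\dagger=\frac1{\sqrt2}\big[-\mathrm{i}\overline{Q_h}(-\mathrm{i}\partial_\eta)+\mathrm{i}\overline{P_h}\eta\big]$;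 $\mathcal{A}^mw(t)$ means the operator at time $t$ applied $m$ times to $w(t)$. Hagedorn's wave-packets are $\varphi_0=\pi^{-1/4}Q_h^{-1/2}\exp\big(\frac{\mathrm{i}}{2}P_hQ_h^{-1}\eta^2\big)$ (with $Q_h^{-1/2}$ a continuous branch in $t$) and $\varphi_{k+1}=\frac1{\sqrt{k+1}}\mathcal{A}^\dagger\varphi_k$; for each $t$ they form an orthonormal basis of $\mathbb{L}^2(\mathbb{R})$. $\hat\Pi_N=\hat\Pi_N(t)$ is the $\mathbb{L}^2$-orthogonal projection onto $\operatorname{span}\{\varphi_0,\dots,\varphi_N\}$. The solution $w_N(t)$ takes values in this span. Notation: $B(m,T),B_1(m,T),B_2(m,T)$ are constants depending on $m,T$ (the potential $V$ being fixed); they are unrelated to the parameter $B(t)$. *)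

theory Defs
  imports "HOL-Analysis.Analysis"
begin

section \<open>The space of square-integrable functions, weak derivatives, Sobolev spaces\<close>

text \<open>
  Elements of the complex Lebesgue space on the line are represented by Borel functions;
  identities between such elements are always stated almost everywhere, through the norm, or
  through inner products.
\<close>

definition square_integrable :: "(real \<Rightarrow> complex) \<Rightarrow> bool" where
  "square_integrable f \<longleftrightarrow>
     f \<in> borel_measurable lborel \<and> integrable lborel (\<lambda>x. (norm (f x))\<^sup>2)"

definition l2_norm :: "(real \<Rightarrow> complex) \<Rightarrow> real" where
  "l2_norm f = sqrt (\<integral>x. (norm (f x))\<^sup>2 \<partial>lborel)"

definition l2_inner :: "(real \<Rightarrow> complex) \<Rightarrow> (real \<Rightarrow> complex) \<Rightarrow> complex" where
  "l2_inner f g = (\<integral>x. cnj (f x) * g x \<partial>lborel)"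

definition locally_integrable :: "(real \<Rightarrow> complex) \<Rightarrow> bool" where
  "locally_integrable f \<longleftrightarrow>
     f \<in> borel_measurable lborel \<and> (\<forall>a b. set_integrable lborel {a..b} f)"

definition test_function :: "(real \<Rightarrow> real) \<Rightarrow> bool" where
  "test_function \<psi> \<longleftrightarrow>
     (\<forall>k x. (deriv ^^ k) \<psi> differentiable (at x)) \<and> (\<exists>R. \<forall>x. \<bar>x\<bar> > R \<longrightarrow> \<psi> x = 0)"

text \<open>Real test functions suffice, because the defining identity is complex linear in \<open>\<psi>\<close>.\<close>

definition weak_deriv :: "nat \<Rightarrow> (real \<Rightarrow> complex) \<Rightarrow> (real \<Rightarrow> complex) \<Rightarrow> bool" where
  "weak_deriv k f g \<longleftrightarrow>
     locally_integrable f \<and> locally_integrable g \<and>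
     (\<forall>\<psi>. test_function \<psi> \<longrightarrow>
        (\<integral>x. (deriv ^^ k) \<psi> x *\<^sub>R f x \<partial>lborel) = (-1) ^ k * (\<integral>x. \<psi> x *\<^sub>R g x \<partial>lborel))"

definition sobolev :: "nat \<Rightarrow> (real \<Rightarrow> complex) \<Rightarrow> bool" where
  "sobolev k f \<longleftrightarrow>
     square_integrable f \<and> (\<forall>j\<in>{1..k}. \<exists>g. weak_deriv j f g \<and> square_integrable g)"

text \<open>Differentiability in time of a curve \<open>w\<close>, with respect to the norm \<open>l2_norm\<close>.\<close>

definition has_l2_derivative ::
    "(real \<Rightarrow> real \<Rightarrow> complex) \<Rightarrow> (real \<Rightarrow> complex) \<Rightarrow> real \<Rightarrow> real set \<Rightarrow> bool" where
  "has_l2_derivative w d t S \<longleftrightarrow>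
     ((\<lambda>s. l2_norm (\<lambda>\<eta>. (w s \<eta> - w t \<eta>) /\<^sub>R (s - t) - d \<eta>)) \<longlongrightarrow> 0) (at t within S)"

text \<open>
  The orthogonal projection onto a finite-dimensional space \<open>S\<close> of continuous square-integrable
  functions; for such \<open>S\<close> the function described here exists and is unique.
\<close>

definition orth_proj :: "(real \<Rightarrow> complex) set \<Rightarrow> (real \<Rightarrow> complex) \<Rightarrow> real \<Rightarrow> complex" where
  "orth_proj S f = (THE g. g \<in> S \<and> (\<forall>h\<in>S. l2_inner h (\<lambda>\<eta>. f \<eta> - g \<eta>) = 0))"


section \<open>Potential and parameters\<close>

definition C3_potential :: "(real \<Rightarrow> real) \<Rightarrow> bool" where
  "C3_potential V \<longleftrightarrow>
     (\<forall>k<3. \<forall>x. (deriv ^^ k) V differentiable (at x)) \<and> continuous_on UNIV ((deriv ^^ 3) V)"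

definition essentially_bounded :: "(real \<Rightarrow> real) \<Rightarrow> bool" where
  "essentially_bounded f \<longleftrightarrow>
     f \<in> borel_measurable lborel \<and> (\<exists>C. AE x in lborel. \<bar>f x\<bar> \<le> C)"

definition parameter_flow ::
    "(real \<Rightarrow> real) \<Rightarrow> real \<Rightarrow> (real \<Rightarrow> real) \<Rightarrow> (real \<Rightarrow> real) \<Rightarrow> (real \<Rightarrow> complex) \<Rightarrow> (real \<Rightarrow> real) \<Rightarrow> bool" where
  "parameter_flow V T q p \<alpha> B \<longleftrightarrow>
     (\<forall>t\<in>{0..T}.
        (q has_vector_derivative p t) (at t within {0..T}) \<and>
        (p has_vector_derivative - deriv V (q t)) (at t within {0..T}) \<and>
        (\<alpha> has_vector_derivative
           - 2 * (\<alpha> t)\<^sup>2 - of_real (1/2 * (deriv ^^ 2) V (q t))) (at t within {0..T}) \<and>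
        (B has_vector_derivative - 2 * B t * Re (\<alpha> t)) (at t within {0..T})) \<and>
     Im (\<alpha> 0) > 0 \<and> B 0 = sqrt (Im (\<alpha> 0))"


section \<open>The equation for \<open>w\<close>\<close>

text \<open>\<open>U_pot \<epsilon> V q b \<eta>\<close> is \<open>U(\<eta>;q)\<close>, where \<open>b\<close> is the current value of the parameter \<open>B\<close>.\<close>

definition U_pot :: "real \<Rightarrow> (real \<Rightarrow> real) \<Rightarrow> real \<Rightarrow> real \<Rightarrow> real \<Rightarrow> real" where
  "U_pot \<epsilon> V q b \<eta> = \<epsilon> powr (-3/2) *
     (V (q + sqrt \<epsilon> * inverse b * \<eta>) - V q - sqrt \<epsilon> * deriv V q * inverse b * \<eta>
        - \<epsilon> / 2 * (deriv ^^ 2) V q * (inverse b)\<^sup>2 * \<eta>\<^sup>2)"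

text \<open>
  \<open>hamiltonian \<epsilon> V a q b f g\<close> means \<open>H f = g\<close>, where \<open>H\<close> is formed with the current values \<open>a\<close>, \<open>q\<close>,
  \<open>b\<close> of the parameters \<open>Im \<alpha>\<close>, \<open>q\<close>, \<open>B\<close>. It is a relation because weak derivatives need not exist
  and are determined only up to null sets.
\<close>

definition hamiltonian ::
    "real \<Rightarrow> (real \<Rightarrow> real) \<Rightarrow> real \<Rightarrow> real \<Rightarrow> real \<Rightarrow> (real \<Rightarrow> complex) \<Rightarrow> (real \<Rightarrow> complex) \<Rightarrow> bool" where
  "hamiltonian \<epsilon> V a q b f g \<longleftrightarrow>
     (\<exists>f2. weak_deriv 2 f f2 \<and>
        (AE \<eta> in lborel. g \<eta> = - of_real (1/2 * a) * f2 \<eta> + of_real (2 * a * \<eta>\<^sup>2) * f \<eta>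
                              + of_real (sqrt \<epsilon> * U_pot \<epsilon> V q b \<eta>) * f \<eta>))"

text \<open>Strong solutions of \<open>\<i> \<partial>\<^sub>t w = H(t) w\<close> on \<open>[0,T]\<close>.\<close>

definition w_solution ::
    "real \<Rightarrow> (real \<Rightarrow> real) \<Rightarrow> real \<Rightarrow> (real \<Rightarrow> real) \<Rightarrow> (real \<Rightarrow> complex) \<Rightarrow> (real \<Rightarrow> real)
      \<Rightarrow> (real \<Rightarrow> real \<Rightarrow> complex) \<Rightarrow> bool" where
  "w_solution \<epsilon> V T q \<alpha> B w \<longleftrightarrow>
     (\<forall>t\<in>{0..T}. square_integrable (w t) \<and>
        (\<exists>g. hamiltonian \<epsilon> V (Im (\<alpha> t)) (q t) (B t) (w t) g \<and> square_integrable g \<and>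
             has_l2_derivative w (\<lambda>\<eta>. - \<i> * g \<eta>) t {0..T}))"


section \<open>Hagedorn's wave packets\<close>

definition Qh :: "(real \<Rightarrow> complex) \<Rightarrow> real \<Rightarrow> complex" where
  "Qh \<alpha> t = of_real (1 / sqrt 2) * exp (2 * \<i> * of_real (integral {0..t} (\<lambda>s. Im (\<alpha> s))))"

definition Ph :: "(real \<Rightarrow> complex) \<Rightarrow> real \<Rightarrow> complex" where
  "Ph \<alpha> t = of_real (sqrt 2) * \<i> * exp (2 * \<i> * of_real (integral {0..t} (\<lambda>s. Im (\<alpha> s))))"

text \<open>
  \<open>lowering Q P f g\<close> means \<open>\<A> f = g\<close>, with the derivative taken in the weak sense. Thus
  \<open>(lowering Q P ^^ m) f g\<close>, the \<open>m\<close>-th power of this relation, means \<open>\<A>\<^sup>m f = g\<close>.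
\<close>

definition lowering :: "complex \<Rightarrow> complex \<Rightarrow> (real \<Rightarrow> complex) \<Rightarrow> (real \<Rightarrow> complex) \<Rightarrow> bool" where
  "lowering Q P f g \<longleftrightarrow>
     (\<exists>f1. weak_deriv 1 f f1 \<and>
        (AE \<eta> in lborel. g \<eta> =
           of_real (1 / sqrt 2) * (\<i> * Q * (- \<i> * f1 \<eta>) - \<i> * P * of_real \<eta> * f \<eta>)))"

text \<open>The raising operator is only needed on smooth functions, where it acts classically.\<close>

definition raising :: "complex \<Rightarrow> complex \<Rightarrow> (real \<Rightarrow> complex) \<Rightarrow> real \<Rightarrow> complex" where
  "raising Q P f \<eta> =
     of_real (1 / sqrt 2) *
       (- \<i> * cnj Q * (- \<i> * vector_derivative f (at \<eta>)) + \<i> * cnj P * of_real \<eta> * f \<eta>)"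

text \<open>The argument \<open>r\<close> is the chosen value of \<open>Q\<close> to the power \<open>-1/2\<close>.\<close>

primrec hagedorn :: "complex \<Rightarrow> complex \<Rightarrow> complex \<Rightarrow> nat \<Rightarrow> real \<Rightarrow> complex" where
  "hagedorn Q P r 0 =
     (\<lambda>\<eta>. of_real (pi powr (-1/4)) * r * exp (\<i> / 2 * P * inverse Q * of_real (\<eta>\<^sup>2)))"
| "hagedorn Q P r (Suc k) =
     (\<lambda>\<eta>. of_real (1 / sqrt (real (k + 1))) * raising Q P (hagedorn Q P r k) \<eta>)"

definition inv_sqrt_branch :: "(real \<Rightarrow> complex) \<Rightarrow> real \<Rightarrow> (real \<Rightarrow> complex) \<Rightarrow> bool" where
  "inv_sqrt_branch Q T r \<longleftrightarrow>
     continuous_on {0..T} r \<and> (\<forall>t\<in>{0..T}. (r t)\<^sup>2 = inverse (Q t))"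

definition hagedorn_span ::
    "(real \<Rightarrow> complex) \<Rightarrow> (real \<Rightarrow> complex) \<Rightarrow> nat \<Rightarrow> real \<Rightarrow> (real \<Rightarrow> complex) set" where
  "hagedorn_span \<alpha> r N t =
     {(\<lambda>\<eta>. \<Sum>k\<le>N. c k * hagedorn (Qh \<alpha> t) (Ph \<alpha> t) (r t) k \<eta>) | c :: nat \<Rightarrow> complex. True}"

definition Proj ::
    "(real \<Rightarrow> complex) \<Rightarrow> (real \<Rightarrow> complex) \<Rightarrow> nat \<Rightarrow> real \<Rightarrow> (real \<Rightarrow> complex) \<Rightarrow> real \<Rightarrow> complex" where
  "Proj \<alpha> r N t f = orth_proj (hagedorn_span \<alpha> r N t) f"

text \<open>
  Strong solutions, with values in the span, of the truncated equation
  \<open>\<i> \<partial>\<^sub>t w\<^sub>N = \<Pi>\<^sub>N(t) H(t) w\<^sub>N\<close> with \<open>w\<^sub>N(0) = \<Pi>\<^sub>N(0) w0\<close>.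
\<close>

definition truncated_solution ::
    "real \<Rightarrow> (real \<Rightarrow> real) \<Rightarrow> real \<Rightarrow> (real \<Rightarrow> real) \<Rightarrow> (real \<Rightarrow> complex) \<Rightarrow> (real \<Rightarrow> real)
      \<Rightarrow> (real \<Rightarrow> complex) \<Rightarrow> nat \<Rightarrow> (real \<Rightarrow> complex) \<Rightarrow> (real \<Rightarrow> real \<Rightarrow> complex) \<Rightarrow> bool" where
  "truncated_solution \<epsilon> V T q \<alpha> B r N w0 wN \<longleftrightarrow>
     (AE \<eta> in lborel. wN 0 \<eta> = Proj \<alpha> r N 0 w0 \<eta>) \<and>
     (\<forall>t\<in>{0..T}. square_integrable (wN t) \<and>
        (\<exists>h \<in> hagedorn_span \<alpha> r N t. AE \<eta> in lborel. wN t \<eta> = h \<eta>) \<and>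
        (\<exists>g. hamiltonian \<epsilon> V (Im (\<alpha> t)) (q t) (B t) (wN t) g \<and> square_integrable g \<and>
             has_l2_derivative wN (\<lambda>\<eta>. - \<i> * Proj \<alpha> r N t g \<eta>) t {0..T}))"

end

theory Submission
  imports Defs "HOL-Probability.Levy" "HOL-Computational_Algebra.Polynomial"
begin

text \<open>
  Up to a unimodular factor depending on time, \<open>\<phi>\<^sub>k(t)\<close> is the Hermite function \<open>h\<^sub>k\<close> with weight
  \<open>exp (- \<eta>\<^sup>2)\<close>; hence the span and the projection \<open>\<Pi>\<^sub>N\<close> do not depend on time, and \<open>\<Pi>\<^sub>N\<close> commutes with the
  quadratic part of the Hamiltonian. With \<open>v = w - \<Pi>\<^sub>N w\<close>, the function \<open>e = w\<^sub>N - \<Pi>\<^sub>N w\<close> therefore satisfies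
  \<open>d/dt \<parallel>e\<parallel>\<^sup>2 = - 2 Im \<langle>\<surd>\<epsilon> U e, v\<rangle>\<close>, because \<open>\<langle>U e, e\<rangle>\<close> is real, and \<open>e(0) = 0\<close>. Since \<open>|U| \<le> C \<alpha>\<^sub>I\<^sup>-\<^sup>3\<^sup>/\<^sup>2 |\<eta>|\<^sup>3\<close> by
  Taylor's formula, it remains to bound \<open>v\<close> and \<open>\<eta>\<^sup>3 v\<close>. In terms of the Hermite coefficients \<open>c\<^sub>k\<close> of \<open>w\<close>, this
  follows from \<open>|\<langle>h\<^sub>k\<^sub>-\<^sub>m, \<A>\<^sup>m w\<rangle>|\<^sup>2 = k! / (k - m)! |c\<^sub>k|\<^sup>2\<close>, Bessel's inequality for \<open>\<A>\<^sup>m w\<close>, and the fact that \<open>\<eta>\<^sup>3\<close>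
  costs a weight of order \<open>k\<^sup>3\<close>.
\<close>

section \<open>Square-integrable functions\<close>

text \<open>The definition of a solution makes \<open>H w\<close> square integrable but says nothing
  about \<open>\<eta>\<^sup>2 w\<close> and \<open>U w\<close> separately. Each identity is
  therefore read off by pairing with one Hermite function, whose decay absorbs polynomial growth;
  the pairing is justified with compactly supported cutoffs, because weak derivatives only see test
  functions. The energy argument then concerns the \<open>N + 1\<close> coefficients of
  \<open>e\<close>, a finite system driven by \<open>v\<close>. Its diagonal part is real and merely
  rotates the coefficients, so the error grows linearly in time, whence the factor \<open>T\<close>.
  Expanding \<open>v\<close> needs completeness of the Hermite functions. It rests on the fact that
  a function with exponential moments is determined by its moments, proved through characteristic
  functions. Norm convergence of the expansion is established for absolutely summable coefficients,
  and the control of \<open>\<A>\<^sup>m w\<close> provides this summability. The constant of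
  Taylor's formula is \<open>1 / 6\<close>. The second constant, 20, compares
  \<open>(k + 1) (k + 2) (k + 3)\<close> with \<open>k (k - 1) (k - 2)\<close>, with equality at
  \<open>k = 3\<close>.\<close>

lemma square_integrableD:
  assumes "square_integrable f"
  shows "f \<in> borel_measurable borel" "f \<in> borel_measurable lborel"
    "integrable lborel (\<lambda>x. (norm (f x))\<^sup>2)"
  using assms by (auto simp: square_integrable_def)

lemma two_mult_le_weighted_squares:
  fixes a b s :: real
  assumes "s > 0"
  shows "2 * (a * b) \<le> s * a\<^sup>2 + b\<^sup>2 / s"
proof -
  have "0 \<le> (s * a - b)\<^sup>2 / s" using assms by simp
  also have "\<dots> = s * a\<^sup>2 + b\<^sup>2 / s - 2 * (a * b)"
    using assms by (simp add: power2_eq_square field_simps)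
  finally show ?thesis by simp
qed

lemma integrable_norm_mult:
  assumes "square_integrable f" "square_integrable g"
  shows "integrable lborel (\<lambda>x. norm (f x) * norm (g x))"
proof (rule Bochner_Integration.integrable_bound)
  show "integrable lborel (\<lambda>x. (norm (f x))\<^sup>2 + (norm (g x))\<^sup>2)"
    using assms by (simp add: square_integrable_def)
  have [measurable]: "f \<in> borel_measurable borel" "g \<in> borel_measurable borel"
    using assms by (auto simp: square_integrable_def)
  show "(\<lambda>x. norm (f x) * norm (g x)) \<in> borel_measurable lborel"
    by measurable
  show "AE x in lborel. norm (norm (f x) * norm (g x)) \<le> norm ((norm (f x))\<^sup>2 + (norm (g x))\<^sup>2)"
  proof (rule AE_I2)
    fix x
    have "2 * (norm (f x) * norm (g x)) \<le> (norm (f x))\<^sup>2 + (norm (g x))\<^sup>2"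
      using two_mult_le_weighted_squares[of 1 "norm (f x)" "norm (g x)"] by simp
    moreover have "0 \<le> norm (f x) * norm (g x)" by simp
    ultimately show "norm (norm (f x) * norm (g x)) \<le> norm ((norm (f x))\<^sup>2 + (norm (g x))\<^sup>2)"
      unfolding real_norm_def by linarith
  qed
qed

lemma integrable_cnj_mult:
  assumes "square_integrable f" "square_integrable g"
  shows "integrable lborel (\<lambda>x. cnj (f x) * g x)"
proof (rule Bochner_Integration.integrable_bound[OF integrable_norm_mult[OF assms]])
  have [measurable]: "f \<in> borel_measurable borel" "g \<in> borel_measurable borel" using assms by (auto simp: square_integrable_def)
  have [measurable]: "cnj \<in> borel_measurable borel"
    by (intro borel_measurable_continuous_onI continuous_intros)
  show "(\<lambda>x. cnj (f x) * g x) \<in> borel_measurable lborel" by measurable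
qed (auto simp: norm_mult)

lemma square_integrable_0 [simp]: "square_integrable (\<lambda>x. 0)"
  by (simp add: square_integrable_def)

lemma square_integrable_bound:
  assumes f: "square_integrable f" and [measurable]: "g \<in> borel_measurable lborel"
    and le: "\<And>x. norm (g x) \<le> C * norm (f x)"
  shows "square_integrable g"
proof -
  have "(norm (g x))\<^sup>2 \<le> C\<^sup>2 * (norm (f x))\<^sup>2" for x
    using power_mono[OF le[of x], of 2] by (simp add: power_mult_distrib)
  then have "AE x in lborel. norm ((norm (g x))\<^sup>2) \<le> norm (C\<^sup>2 * (norm (f x))\<^sup>2)"
    by simp
  moreover have "integrable lborel (\<lambda>x. C\<^sup>2 * (norm (f x))\<^sup>2)"
    using square_integrableD(3)[OF f] by simp
  moreover have "(\<lambda>x. (norm (g x))\<^sup>2) \<in> borel_measurable lborel" by measurable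
  ultimately have "integrable lborel (\<lambda>x. (norm (g x))\<^sup>2)"
    using Bochner_Integration.integrable_bound by blast
  then show ?thesis by (simp add: square_integrable_def)
qed

lemma square_integrable_mult:
  "square_integrable f \<Longrightarrow> square_integrable (\<lambda>x. c * f x)"
  by (rule square_integrable_bound[where f=f and C="norm c"]) (auto simp: norm_mult square_integrable_def)

lemma square_integrable_add:
  assumes f: "square_integrable f" and g: "square_integrable g"
  shows "square_integrable (\<lambda>x. f x + g x)"
proof -
  have [measurable]: "f \<in> borel_measurable borel" "g \<in> borel_measurable borel"
    using f g by (auto simp: square_integrable_def)
  have "(norm (f x + g x))\<^sup>2 \<le> 2 * (norm (f x))\<^sup>2 + 2 * (norm (g x))\<^sup>2" for x
  proof -
    have "(norm (f x + g x))\<^sup>2 \<le> (norm (f x) + norm (g x))\<^sup>2"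
      by (intro power_mono norm_triangle_ineq) simp
    then show ?thesis
      using two_mult_le_weighted_squares[of 1 "norm (f x)" "norm (g x)"]
      by (simp add: power2_sum)
  qed
  then have "AE x in lborel. norm ((norm (f x + g x))\<^sup>2) \<le> norm (2 * (norm (f x))\<^sup>2 + 2 * (norm (g x))\<^sup>2)"
    by simp
  moreover have "integrable lborel (\<lambda>x. 2 * (norm (f x))\<^sup>2 + 2 * (norm (g x))\<^sup>2)"
    using square_integrableD(3)[OF f] square_integrableD(3)[OF g] by simp
  moreover have "(\<lambda>x. (norm (f x + g x))\<^sup>2) \<in> borel_measurable lborel" by measurable
  ultimately have "integrable lborel (\<lambda>x. (norm (f x + g x))\<^sup>2)"
    using Bochner_Integration.integrable_bound by blast
  then show ?thesis by (simp add: square_integrable_def)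
qed

lemma square_integrable_diff:
  "square_integrable f \<Longrightarrow> square_integrable g \<Longrightarrow> square_integrable (\<lambda>x. f x - g x)"
  using square_integrable_add[of f "\<lambda>x. (-1) * g x"] square_integrable_mult[of g "-1"] by simp

lemma square_integrable_sum:
  "(\<And>i. i \<in> I \<Longrightarrow> square_integrable (f i)) \<Longrightarrow> square_integrable (\<lambda>x. \<Sum>i\<in>I. f i x)"
  by (induction I rule: infinite_finite_induct) (auto intro: square_integrable_add)

lemma l2_norm_nonneg [simp]: "0 \<le> l2_norm f"
  by (simp add: l2_norm_def)

lemma l2_norm_power2: "(l2_norm f)\<^sup>2 = (\<integral>x. (norm (f x))\<^sup>2 \<partial>lborel)"
  by (simp add: l2_norm_def)

lemma l2_norm_0 [simp]: "l2_norm (\<lambda>x. 0) = 0"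
  by (simp add: l2_norm_def)

lemma l2_norm_cong_AE:
  assumes "f \<in> borel_measurable lborel" "g \<in> borel_measurable lborel" "AE x in lborel. f x = g x"
  shows "l2_norm f = l2_norm g"
proof -
  have [measurable]: "f \<in> borel_measurable borel" "g \<in> borel_measurable borel"
    using assms by (auto simp: square_integrable_def)
  have "(\<integral>x. (norm (f x))\<^sup>2 \<partial>lborel) = (\<integral>x. (norm (g x))\<^sup>2 \<partial>lborel)"
    by (rule integral_cong_AE) (use assms in auto)
  then show ?thesis by (simp add: l2_norm_def)
qed

lemma l2_norm_mono:
  assumes "square_integrable g" "f \<in> borel_measurable lborel" "\<And>x. norm (f x) \<le> norm (g x)"
  shows "l2_norm f \<le> l2_norm g"
proof -
  have "square_integrable f" by (rule square_integrable_bound[where C=1]) (use assms in auto)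
  then show ?thesis unfolding l2_norm_def
    by (intro real_sqrt_le_mono integral_mono power_mono)
      (use assms in \<open>auto simp: square_integrable_def\<close>)
qed

lemma l2_norm_mult: "l2_norm (\<lambda>x. c * f x) = norm c * l2_norm f"
  by (simp add: l2_norm_def norm_mult power_mult_distrib real_sqrt_mult)

lemma l2_inner_self: "l2_inner f f = of_real ((l2_norm f)\<^sup>2)"
proof -
  have "cnj z * z = of_real ((norm z)\<^sup>2)" for z
    by (metis complex_norm_square mult.commute)
  then show ?thesis
    unfolding l2_norm_power2 l2_inner_def by (simp flip: of_real_power)
qed

lemma l2_inner_add_right:
  assumes "square_integrable f" "square_integrable g" "square_integrable h"
  shows "l2_inner f (\<lambda>x. g x + h x) = l2_inner f g + l2_inner f h"
  using assms unfolding l2_inner_def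
  by (simp add: distrib_left Bochner_Integration.integral_add integrable_cnj_mult)

lemma l2_inner_diff_right:
  assumes "square_integrable f" "square_integrable g" "square_integrable h"
  shows "l2_inner f (\<lambda>x. g x - h x) = l2_inner f g - l2_inner f h"
  using assms unfolding l2_inner_def
  by (simp add: right_diff_distrib Bochner_Integration.integral_diff integrable_cnj_mult)

lemma l2_inner_mult_right: "l2_inner f (\<lambda>x. c * g x) = c * l2_inner f g"
  unfolding l2_inner_def by (simp add: mult.left_commute)

lemma l2_inner_0_right [simp]: "l2_inner f (\<lambda>x. 0) = 0"
  unfolding l2_inner_def by simp

lemma cnj_l2_inner: "cnj (l2_inner f g) = l2_inner g f"
proof -
  have "cnj (l2_inner f g) = (\<integral>x. cnj (cnj (f x) * g x) \<partial>lborel)"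
    unfolding l2_inner_def by (simp only: Bochner_Integration.integral_cnj)
  then show ?thesis unfolding l2_inner_def by (simp add: mult.commute)
qed

lemma l2_inner_sum_right:
  assumes "square_integrable f" "\<And>i. i \<in> I \<Longrightarrow> square_integrable (g i)"
  shows "l2_inner f (\<lambda>x. \<Sum>i\<in>I. g i x) = (\<Sum>i\<in>I. l2_inner f (g i))"
  using assms(2)
proof (induction I rule: infinite_finite_induct)
  case (insert i I)
  then show ?case using assms(1)
    by (simp add: l2_inner_add_right square_integrable_sum)
qed auto

lemma l2_inner_sum_left:
  assumes f: "square_integrable f" and \<phi>: "\<And>k. k \<in> I \<Longrightarrow> square_integrable (\<phi> k)"
  shows "l2_inner (\<lambda>x. \<Sum>k\<in>I. c k * \<phi> k x) f = (\<Sum>k\<in>I. cnj (c k) * l2_inner (\<phi> k) f)"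
proof -
  have "l2_inner f (\<lambda>x. \<Sum>k\<in>I. c k * \<phi> k x) = (\<Sum>k\<in>I. c k * l2_inner f (\<phi> k))"
    using f \<phi> by (subst l2_inner_sum_right) (auto simp: l2_inner_mult_right square_integrable_mult)
  then have "cnj (l2_inner f (\<lambda>x. \<Sum>k\<in>I. c k * \<phi> k x)) = (\<Sum>k\<in>I. cnj (c k) * cnj (l2_inner f (\<phi> k)))"
    by simp
  then show ?thesis by (simp add: cnj_l2_inner)
qed

lemma l2_inner_cong_AE:
  assumes "f \<in> borel_measurable lborel" "g \<in> borel_measurable lborel" "h \<in> borel_measurable lborel"
    "AE x in lborel. g x = h x"
  shows "l2_inner f g = l2_inner f h"
proof -
  have [measurable]: "f \<in> borel_measurable borel" "g \<in> borel_measurable borel" "h \<in> borel_measurable borel"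
    using assms by (auto simp: square_integrable_def)
  have [measurable]: "cnj \<in> borel_measurable borel"
    by (intro borel_measurable_continuous_onI continuous_intros)
  show ?thesis unfolding l2_inner_def
  proof (rule integral_cong_AE)
    show "AE x in lborel. cnj (f x) * g x = cnj (f x) * h x"
      using assms(4) by eventually_elim simp
  qed measurable
qed

text \<open>Cauchy-Schwarz, obtained by integrating the weighted inequality between products and
  squares, the weight \<open>s\<close> being the ratio of the two norms. The added \<open>d\<close>
  keeps this ratio finite and positive when a norm vanishes, and tends to 0 at the end.\<close>

lemma integral_norm_mult_le:
  assumes f: "square_integrable f" and g: "square_integrable g"
  shows "(\<integral>x. norm (f x) * norm (g x) \<partial>lborel) \<le> l2_norm f * l2_norm g"
proof -
  let ?I = "\<integral>x. norm (f x) * norm (g x) \<partial>lborel" and ?A = "l2_norm f" and ?B = "l2_norm g"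
  have "?I \<le> (?A + d) * (?B + d)" if d: "d > 0" for d
  proof -
    define s where "s = (?B + d) / (?A + d)"
    have pos: "?A + d > 0" "?B + d > 0" using d by (simp_all add: add_nonneg_pos)
    have s: "s > 0" unfolding s_def using pos by simp
    have "2 * ?I = (\<integral>x. 2 * (norm (f x) * norm (g x)) \<partial>lborel)" by simp
    also have "\<dots> \<le> (\<integral>x. s * (norm (f x))\<^sup>2 + (norm (g x))\<^sup>2 / s \<partial>lborel)"
      using square_integrableD(3)[OF f] square_integrableD(3)[OF g] integrable_norm_mult[OF f g] s
      by (intro integral_mono two_mult_le_weighted_squares) simp_all
    also have "\<dots> = s * ?A\<^sup>2 + ?B\<^sup>2 / s"
      using square_integrableD(3)[OF f] square_integrableD(3)[OF g] by (simp add: l2_norm_power2)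
    also have "s * ?A\<^sup>2 \<le> s * (?A + d)\<^sup>2" using s d by (intro mult_left_mono power_mono) auto
    also have "\<dots> = (?A + d) * (?B + d)" unfolding s_def using pos by (simp add: power2_eq_square)
    also have "?B\<^sup>2 / s \<le> (?B + d)\<^sup>2 / s" using s d by (intro divide_right_mono power_mono) auto
    also have "\<dots> = (?A + d) * (?B + d)" unfolding s_def using pos by (simp add: power2_eq_square)
    finally show ?thesis by simp
  qed
  then have "eventually (\<lambda>d. ?I \<le> (?A + d) * (?B + d)) (at_right 0)"
    by (auto simp: eventually_at_filter)
  moreover have "((\<lambda>d. (?A + d) * (?B + d)) \<longlongrightarrow> (?A + 0) * (?B + 0)) (at_right 0)"
    by (intro tendsto_intros)
  ultimately show ?thesis
    using tendsto_lowerbound[of _ "(?A + 0) * (?B + 0)" "at_right (0::real)" ?I] by simp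
qed

lemma norm_l2_inner_le:
  assumes "square_integrable f" "square_integrable g"
  shows "norm (l2_inner f g) \<le> l2_norm f * l2_norm g"
proof -
  have "norm (l2_inner f g) \<le> (\<integral>x. norm (cnj (f x) * g x) \<partial>lborel)"
    unfolding l2_inner_def by (rule integral_norm_bound)
  then show ?thesis using integral_norm_mult_le[OF assms] by (simp add: norm_mult)
qed

lemma l2_norm_triangle:
  assumes f: "square_integrable f" and g: "square_integrable g"
  shows "l2_norm (\<lambda>x. f x + g x) \<le> l2_norm f + l2_norm g"
proof (rule power2_le_imp_le)
  have "(l2_norm (\<lambda>x. f x + g x))\<^sup>2
      \<le> (\<integral>x. (norm (f x))\<^sup>2 + (norm (g x))\<^sup>2 + 2 * (norm (f x) * norm (g x)) \<partial>lborel)"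
    unfolding l2_norm_power2
  proof (intro integral_mono)
    show "(norm (f x + g x))\<^sup>2 \<le> (norm (f x))\<^sup>2 + (norm (g x))\<^sup>2 + 2 * (norm (f x) * norm (g x))" for x
      using power_mono[OF norm_triangle_ineq[of "f x" "g x"], of 2] by (simp add: power2_sum)
  qed (use f g square_integrable_add[OF f g] integrable_norm_mult[OF f g] in
      \<open>simp_all add: square_integrable_def\<close>)
  also have "\<dots> = (l2_norm f)\<^sup>2 + (l2_norm g)\<^sup>2 + 2 * (\<integral>x. norm (f x) * norm (g x) \<partial>lborel)"
    unfolding l2_norm_power2
    using square_integrableD(3)[OF f] square_integrableD(3)[OF g] integrable_norm_mult[OF f g] by simp
  also have "\<dots> \<le> (l2_norm f + l2_norm g)\<^sup>2"
    using integral_norm_mult_le[OF f g] by (simp add: power2_sum)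
  finally show "(l2_norm (\<lambda>x. f x + g x))\<^sup>2 \<le> (l2_norm f + l2_norm g)\<^sup>2" .
qed simp

lemma l2_norm_triangle_sum:
  assumes "\<And>i. i \<in> I \<Longrightarrow> square_integrable (f i)"
  shows "l2_norm (\<lambda>x. \<Sum>i\<in>I. f i x) \<le> (\<Sum>i\<in>I. l2_norm (f i))"
  using assms
proof (induction I rule: infinite_finite_induct)
  case (insert i I)
  have "l2_norm (\<lambda>x. f i x + (\<Sum>i\<in>I. f i x)) \<le> l2_norm (f i) + l2_norm (\<lambda>x. \<Sum>i\<in>I. f i x)"
    by (intro l2_norm_triangle square_integrable_sum) (use insert in auto)
  with insert show ?case by fastforce
qed auto

section \<open>Hermite functions\<close>

text \<open>Polynomials times this Gaussian are stable under multiplication by the variable and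
  under differentiation, so the ladder calculus becomes algebra of polynomials. The weight
  \<open>exp (- x\<^sup>2)\<close> is the ground state of
  \<open>- (a / 2) \<partial>\<^sup>2 + 2 a \<eta>\<^sup>2\<close>.\<close>

definition gauss_poly :: "real poly \<Rightarrow> real \<Rightarrow> real" where
  "gauss_poly p x = poly p x * exp (- x\<^sup>2)"

text \<open>The action of the operator \<open>a \<eta> + b \<partial>\<^sub>\<eta>\<close> on \<open>gauss_poly p\<close>, expressed through \<open>p\<close>.\<close>

definition gauss_op :: "real \<Rightarrow> real \<Rightarrow> real poly \<Rightarrow> real poly" where
  "gauss_op a b p = [:0, a - 2 * b:] * p + smult b (pderiv p)"

abbreviation "up \<equiv> gauss_op 1 (- (1 / 2))"
abbreviation "down \<equiv> gauss_op 1 (1 / 2)"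

lemma gauss_poly_add: "gauss_poly (p + q) x = gauss_poly p x + gauss_poly q x"
  and gauss_poly_smult: "gauss_poly (smult c p) x = c * gauss_poly p x"
  and gauss_poly_0 [simp]: "gauss_poly 0 x = 0"
  by (simp_all add: gauss_poly_def distrib_right)

lemma has_real_derivative_gauss_poly:
  "(gauss_poly p has_real_derivative gauss_poly (gauss_op 0 1 p) x) (at x)"
  unfolding gauss_poly_def gauss_op_def
  by (auto intro!: derivative_eq_intros poly_DERIV simp: algebra_simps)

lemma gauss_poly_gauss_op:
  "gauss_poly (gauss_op a b p) x = a * x * gauss_poly p x + b * gauss_poly (gauss_op 0 1 p) x"
  by (simp add: gauss_poly_def gauss_op_def algebra_simps)

lemma gauss_op_smult: "gauss_op a b (smult c p) = smult c (gauss_op a b p)"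
  by (simp add: gauss_op_def pderiv_smult algebra_simps smult_add_right)

lemma gauss_op_0 [simp]: "gauss_op a b 0 = 0"
  by (simp add: gauss_op_def)

text \<open>The canonical commutation relation. On the polynomial factor, \<open>down\<close> is
  half the derivative.\<close>

lemma down_up: "down (up p) = up (down p) + p"
proof -
  have "poly (down (up p)) x = poly (up (down p) + p) x" for x
    by (simp add: gauss_op_def pderiv_add pderiv_diff pderiv_smult pderiv_mult pderiv_pCons field_simps)
  then show ?thesis by (simp add: poly_eq_poly_eq_iff[symmetric] fun_eq_iff)
qed

section \<open>Integrals of polynomials against the Gaussian weight\<close>

lemma gaussian_even: "exp (- 2 * x\<^sup>2) = sqrt (pi / 2) * normal_density 0 (1 / 2) x"
proof -
  have "sqrt (pi / 2) * (1 / sqrt (2 * pi * (1 / 2)\<^sup>2)) = 1"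
    by (simp add: power2_eq_square)
  then show ?thesis by (simp add: normal_density_def power2_eq_square field_simps)
qed

lemma integrable_poly_gaussian [simp]:
  fixes p :: "real poly"
  shows "integrable lborel (\<lambda>x. poly p x * exp (- 2 * x\<^sup>2))"
proof -
  have "(\<lambda>x. poly p x * exp (- 2 * x\<^sup>2)) =
      (\<lambda>x. \<Sum>i\<le>degree p. sqrt (pi / 2) * coeff p i * (normal_density 0 (1 / 2) x * (x - 0) ^ i))"
    unfolding poly_altdef gaussian_even sum_distrib_right by (simp add: mult_ac)
  moreover have "integrable lborel
      (\<lambda>x. \<Sum>i\<le>degree p. sqrt (pi / 2) * coeff p i * (normal_density 0 (1 / 2) x * (x - 0) ^ i))"
    by (intro Bochner_Integration.integrable_sum integrable_mult_right integrable_normal_moment) simp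
  ultimately show ?thesis by simp
qed

lemma integral_gaussian: "(\<integral>x. exp (- 2 * x\<^sup>2) \<partial>lborel) = sqrt (pi / 2)"
  unfolding gaussian_even by simp

lemma poly_gaussian_at_top:
  fixes p :: "real poly"
  shows "((\<lambda>x. poly p x * exp (- 2 * x\<^sup>2)) \<longlongrightarrow> 0) at_top"
proof -
  have "((\<lambda>x::real. x ^ k * exp (- 2 * x\<^sup>2)) \<longlongrightarrow> 0) at_top" for k
  proof (rule Lim_null_comparison)
    show "((\<lambda>x::real. x ^ k / exp x) \<longlongrightarrow> 0) at_top" by (rule tendsto_power_div_exp_0)
    show "\<forall>\<^sub>F x::real in at_top. norm (x ^ k * exp (- 2 * x\<^sup>2)) \<le> x ^ k / exp x"
      using eventually_ge_at_top[of 1]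
    proof eventually_elim
      case (elim x)
      have "x * 1 \<le> x * (2 * x)" using elim by (intro mult_left_mono) auto
      then have "exp (- 2 * x\<^sup>2) \<le> exp (- x)" by (simp add: power2_eq_square)
      then show ?case using elim by (simp add: exp_minus field_simps)
    qed
  qed
  then have "((\<lambda>x. \<Sum>i\<le>degree p. coeff p i * (x ^ i * exp (- 2 * x\<^sup>2))) \<longlongrightarrow> (\<Sum>i\<le>degree p. coeff p i * 0)) at_top"
    by (intro tendsto_sum tendsto_mult_left)
  then show ?thesis by (simp add: poly_altdef sum_distrib_left mult_ac)
qed

lemma poly_gaussian_at_bot:
  fixes p :: "real poly"
  shows "((\<lambda>x. poly p x * exp (- 2 * x\<^sup>2)) \<longlongrightarrow> 0) at_bot"
  unfolding at_bot_mirror filterlim_filtermap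
  using poly_gaussian_at_top[of "pcompose p [:0, -1:]"] by (simp add: poly_pcompose)

text \<open>The integrand is the derivative of \<open>p exp (- 2 x\<^sup>2)\<close>, which vanishes
  at both ends of the line.\<close>

lemma integral_deriv_poly_gaussian:
  fixes p :: "real poly"
  shows "(\<integral>x. poly (pderiv p - [:0, 4:] * p) x * exp (- 2 * x\<^sup>2) \<partial>lborel) = 0"
proof -
  let ?f = "\<lambda>x. poly (pderiv p - [:0, 4:] * p) x * exp (- 2 * x\<^sup>2)"
  have "(LBINT x=-\<infinity>..\<infinity>. ?f x) = 0 - 0"
  proof (rule interval_integral_FTC_integrable[where F="\<lambda>x. poly p x * exp (- 2 * x\<^sup>2)"])
    show "((\<lambda>x. poly p x * exp (- 2 * x\<^sup>2)) has_vector_derivative ?f x) (at x)" for x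
      unfolding has_real_derivative_iff_has_vector_derivative[symmetric]
      by (auto intro!: derivative_eq_intros poly_DERIV simp: algebra_simps)
    show "set_integrable lborel (einterval (-\<infinity>) \<infinity>) ?f"
      using integrable_poly_gaussian[of "pderiv p - [:0, 4:] * p"]
      by (simp only: set_integrable_def einterval_eq_UNIV indicator_UNIV scaleR_one)
  qed (auto simp: ereal_tendsto_simps poly_gaussian_at_top[simplified] poly_gaussian_at_bot[simplified])
  then show ?thesis
    by (simp add: interval_lebesgue_integral_def set_lebesgue_integral_def del: poly_diff poly_mult)
qed

definition gauss_inner :: "real poly \<Rightarrow> real poly \<Rightarrow> real" where
  "gauss_inner p q = (\<integral>x. gauss_poly p x * gauss_poly q x \<partial>lborel)"

lemma gauss_poly_mult: "gauss_poly p x * gauss_poly q x = poly (p * q) x * exp (- 2 * x\<^sup>2)"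
  by (simp add: gauss_poly_def mult_ac flip: exp_add)

lemma integrable_gauss_poly_mult: "integrable lborel (\<lambda>x. gauss_poly p x * gauss_poly q x)"
  unfolding gauss_poly_mult by (rule integrable_poly_gaussian)

lemma gauss_inner_commute: "gauss_inner p q = gauss_inner q p"
  by (simp add: gauss_inner_def mult.commute)

lemma gauss_inner_smult_left: "gauss_inner (smult c p) q = c * gauss_inner p q"
  by (simp add: gauss_inner_def gauss_poly_smult mult.assoc)

lemma gauss_inner_smult_right: "gauss_inner p (smult c q) = c * gauss_inner p q"
  by (simp add: gauss_inner_commute[of p] gauss_inner_smult_left)

lemma gauss_inner_0_right [simp]: "gauss_inner p 0 = 0"
  by (simp add: gauss_inner_def)

text \<open>Integration by parts: the polynomials \<open>up p * q\<close> and
  \<open>p * down q\<close> differ by \<open>- 1 / 2\<close> times the polynomial factor of the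
  derivative of \<open>p q exp (- 2 x\<^sup>2)\<close>.\<close>

lemma gauss_inner_up: "gauss_inner (up p) q = gauss_inner p (down q)"
proof -
  have "poly (up p * q) x = poly (p * down q + smult (- (1 / 2)) (pderiv (p * q) - [:0, 4:] * (p * q))) x" for x
    by (simp add: gauss_op_def pderiv_mult field_simps)
  then have eq: "up p * q = p * down q + smult (- (1 / 2)) (pderiv (p * q) - [:0, 4:] * (p * q))"
    by (simp add: poly_eq_poly_eq_iff[symmetric] fun_eq_iff)
  have "gauss_inner (up p) q = (\<integral>x. poly (p * down q) x * exp (- 2 * x\<^sup>2)
      + (- (1 / 2)) * (poly (pderiv (p * q) - [:0, 4:] * (p * q)) x * exp (- 2 * x\<^sup>2)) \<partial>lborel)"
    unfolding gauss_inner_def gauss_poly_mult eq by (simp only: poly_add poly_smult distrib_right mult.assoc)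
  also have "\<dots> = gauss_inner p (down q)"
    unfolding gauss_inner_def gauss_poly_mult
    by (subst Bochner_Integration.integral_add[OF integrable_poly_gaussian
          integrable_mult_right[OF integrable_poly_gaussian]])
      (simp only: integral_mult_right_zero integral_deriv_poly_gaussian mult_zero_right add_0_right)
  finally show ?thesis .
qed

text \<open>The initial constant is the fourth root of \<open>2 / pi\<close>, the reciprocal of the
  norm of \<open>exp (- x\<^sup>2)\<close>. Dividing by \<open>sqrt (k + 1)\<close> after each
  raising step keeps the norm equal to one.\<close>

primrec herm :: "nat \<Rightarrow> real poly" where
  "herm 0 = [:sqrt (sqrt (2 / pi)):]"
| "herm (Suc k) = smult (1 / sqrt (real (k + 1))) (up (herm k))"

lemma up_herm: "up (herm k) = smult (sqrt (real (k + 1))) (herm (Suc k))"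
  by (simp add: real_sqrt_mult[symmetric] del: of_nat_add of_nat_Suc)

text \<open>Induction with the commutation relation: \<open>down (up h) = up (down h) + h\<close>,
  and the induction hypothesis turns \<open>up (down h)\<close> into a multiple of \<open>h\<close>.
  At \<open>k = 0\<close> the truncated index \<open>k - 1\<close> is harmless, as its factor is
  \<open>sqrt 0\<close>.\<close>

lemma down_herm: "down (herm k) = smult (sqrt (real k)) (herm (k - 1))"
proof (induction k)
  case 0
  then show ?case by (simp add: gauss_op_def)
next
  case IH: (Suc k)
  have upd: "up (down (herm k)) = smult (real k) (herm k)"
  proof (cases k)
    case 0
    then show ?thesis by (simp add: gauss_op_def)
  next
    case (Suc j)
    have "up (down (herm k)) = smult (sqrt (real k)) (smult (sqrt (real (j + 1))) (herm (Suc j)))"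
      unfolding IH gauss_op_smult using up_herm[of j] Suc by (simp del: herm.simps)
    then show ?thesis using Suc by (simp del: herm.simps)
  qed
  have "down (herm (Suc k)) = smult (1 / sqrt (real (k + 1))) (smult (real (k + 1)) (herm k))"
    by (simp add: gauss_op_smult down_up upd smult_add_left[symmetric] del: smult_smult)
       (simp add: smult_add_left add.commute)
  also have "\<dots> = smult (sqrt (real (k + 1))) (herm k)"
    by (simp add: real_div_sqrt)
  finally show ?case by simp
qed

lemma up_down_herm: "up (down (herm k)) = smult (real k) (herm k)"
proof (cases k)
  case (Suc j)
  have "up (down (herm k)) = smult (sqrt (real k)) (smult (sqrt (real (j + 1))) (herm (Suc j)))"
    unfolding down_herm gauss_op_smult using up_herm[of j] Suc by (simp del: herm.simps)
  then show ?thesis using Suc by (simp del: herm.simps)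
qed (simp add: gauss_op_def)

text \<open>Moving one \<open>up\<close> to the other side as \<open>down\<close> lowers both
  indices together, until one factor is the ground state, which \<open>down\<close>
  annihilates.\<close>

lemma gauss_inner_herm: "gauss_inner (herm j) (herm k) = (if j = k then 1 else 0)"
proof (induction j arbitrary: k)
  case 0
  show ?case
  proof (cases k)
    case 0
    have "gauss_inner (herm 0) (herm 0) = sqrt (2 / pi) * sqrt (pi / 2)"
      using integral_gaussian by (simp add: gauss_inner_def gauss_poly_mult)
    also have "\<dots> = 1" by (simp flip: real_sqrt_mult)
    finally show ?thesis using 0 by simp
  next
    case (Suc j)
    have "gauss_inner (herm 0) (herm (Suc j)) = gauss_inner (smult (1 / sqrt (real (j + 1))) (up (herm j))) (herm 0)"
      unfolding gauss_inner_commute[of "herm 0"] by simp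
    also have "\<dots> = 0" unfolding gauss_inner_smult_left gauss_inner_up down_herm
      by (simp add: gauss_inner_smult_right)
    finally show ?thesis using Suc by simp
  qed
next
  case (Suc j)
  have "gauss_inner (herm (Suc j)) (herm k) = sqrt k / sqrt (real (j + 1)) * gauss_inner (herm j) (herm (k - 1))"
    by (simp add: gauss_inner_smult_left gauss_inner_smult_right gauss_inner_up down_herm)
  then show ?case unfolding Suc by (cases k) auto
qed

text \<open>The three-term recurrence, from the fact that \<open>up\<close> and \<open>down\<close>
  add up to multiplication by \<open>2 x\<close>.\<close>

lemma pCons_0_herm:
  "pCons 0 (herm k) = smult (sqrt (real (k + 1)) / 2) (herm (Suc k)) + smult (sqrt (real k) / 2) (herm (k - 1))"
proof -
  have "pCons 0 (herm k) = smult (1/2) (up (herm k)) + smult (1/2) (down (herm k))"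
    by (simp add: poly_eq_poly_eq_iff[symmetric] fun_eq_iff gauss_op_def field_simps)
  then show ?thesis by (simp add: up_herm down_herm del: herm.simps)
qed

section \<open>Hermite coefficients: finite Parseval identity and Bessel's inequality\<close>

definition herm_fun :: "nat \<Rightarrow> real \<Rightarrow> complex" where
  "herm_fun k x = complex_of_real (gauss_poly (herm k) x)"

definition herm_coeff :: "nat \<Rightarrow> (real \<Rightarrow> complex) \<Rightarrow> complex" where
  "herm_coeff k f = l2_inner (herm_fun k) f"

lemma borel_measurable_gauss_poly [measurable]: "gauss_poly p \<in> borel_measurable borel"
  unfolding gauss_poly_def by (intro borel_measurable_continuous_onI continuous_intros)

lemma square_integrable_gauss_poly: "square_integrable (\<lambda>x. complex_of_real (gauss_poly p x))"
  using integrable_gauss_poly_mult[of p p] by (simp add: square_integrable_def power2_eq_square)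

lemma square_integrable_herm_fun [simp]: "square_integrable (herm_fun k)"
  unfolding herm_fun_def by (rule square_integrable_gauss_poly)

lemma borel_measurable_herm_fun [measurable]: "herm_fun k \<in> borel_measurable borel"
  unfolding herm_fun_def by measurable

lemma square_integrable_herm_sum [simp]: "square_integrable (\<lambda>x. \<Sum>k\<in>I. c k * herm_fun k x)"
  by (intro square_integrable_sum square_integrable_mult) simp

lemma l2_inner_gauss_poly:
  "l2_inner (\<lambda>x. complex_of_real (gauss_poly p x)) f = (\<integral>x. gauss_poly p x *\<^sub>R f x \<partial>lborel)"
  by (simp add: l2_inner_def scaleR_conv_of_real)

lemma l2_inner_herm_fun: "l2_inner (herm_fun j) (herm_fun k) = (if j = k then 1 else 0)"
proof -
  have "l2_inner (herm_fun j) (herm_fun k) = complex_of_real (gauss_inner (herm j) (herm k))"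
    by (simp add: l2_inner_def herm_fun_def gauss_inner_def flip: of_real_mult)
  then show ?thesis by (simp add: gauss_inner_herm)
qed

lemma l2_norm_herm_fun [simp]: "l2_norm (herm_fun k) = 1"
proof -
  have "complex_of_real ((l2_norm (herm_fun k))\<^sup>2) = complex_of_real 1"
    using l2_inner_self[of "herm_fun k"] l2_inner_herm_fun[of k k] by simp
  then have "(l2_norm (herm_fun k))\<^sup>2 = 1\<^sup>2" unfolding of_real_eq_iff by simp
  then show ?thesis by (rule power2_eq_imp_eq) auto
qed

lemma herm_coeff_sum:
  assumes "finite I"
  shows "herm_coeff j (\<lambda>x. \<Sum>k\<in>I. c k * herm_fun k x) = (if j \<in> I then c j else 0)"
  unfolding herm_coeff_def using assms
  by (subst l2_inner_sum_right)
    (auto simp: l2_inner_mult_right l2_inner_herm_fun square_integrable_mult if_distrib cong: if_cong)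

lemma l2_inner_herm_sum_left:
  "square_integrable f \<Longrightarrow>
    l2_inner (\<lambda>x. \<Sum>k\<in>I. c k * herm_fun k x) f = (\<Sum>k\<in>I. cnj (c k) * herm_coeff k f)"
  unfolding herm_coeff_def by (rule l2_inner_sum_left) simp_all

lemma l2_norm_herm_sum:
  assumes "finite I"
  shows "(l2_norm (\<lambda>x. \<Sum>k\<in>I. c k * herm_fun k x))\<^sup>2 = (\<Sum>k\<in>I. (norm (c k))\<^sup>2)"
proof -
  have "complex_of_real ((l2_norm (\<lambda>x. \<Sum>k\<in>I. c k * herm_fun k x))\<^sup>2) = (\<Sum>k\<in>I. cnj (c k) * c k)"
    using assms by (simp only: flip: l2_inner_self)
      (simp add: l2_inner_herm_sum_left herm_coeff_sum)
  also have "\<dots> = complex_of_real (\<Sum>k\<in>I. (norm (c k))\<^sup>2)"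
    unfolding of_real_sum
    by (intro sum.cong refl) (metis complex_norm_square mult.commute)
  finally show ?thesis unfolding of_real_eq_iff .
qed

lemma l2_norm_pythagoras:
  assumes f: "square_integrable f" and g: "square_integrable g" and orth: "l2_inner f g = 0"
  shows "(l2_norm (\<lambda>x. f x + g x))\<^sup>2 = (l2_norm f)\<^sup>2 + (l2_norm g)\<^sup>2"
proof -
  let ?h = "\<lambda>x. f x + g x"
  have h: "square_integrable ?h" using f g by (rule square_integrable_add)
  have gf: "l2_inner g f = 0" using orth cnj_l2_inner[of f g] by simp
  have "l2_inner ?h f = cnj (l2_inner f ?h)" "l2_inner ?h g = cnj (l2_inner g ?h)"
    by (simp_all only: cnj_l2_inner)
  then have "l2_inner ?h f = cnj (l2_inner f f)" "l2_inner ?h g = cnj (l2_inner g g)"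
    using f g by (simp_all only: l2_inner_add_right orth gf add_0_left add_0_right)
  then have "l2_inner ?h ?h = cnj (l2_inner f f) + cnj (l2_inner g g)"
    using f g h by (simp only: l2_inner_add_right)
  then have "complex_of_real ((l2_norm ?h)\<^sup>2) = complex_of_real ((l2_norm f)\<^sup>2 + (l2_norm g)\<^sup>2)"
    by (simp add: l2_inner_self)
  then show ?thesis unfolding of_real_eq_iff .
qed

lemma herm_bessel:
  assumes f: "square_integrable f" and I: "finite I"
  shows "(\<Sum>k\<in>I. (norm (herm_coeff k f))\<^sup>2) \<le> (l2_norm f)\<^sup>2"
proof -
  let ?S = "\<lambda>x. \<Sum>k\<in>I. herm_coeff k f * herm_fun k x"
  have g: "square_integrable (\<lambda>x. f x - ?S x)" using f by (intro square_integrable_diff) auto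
  have "herm_coeff k (\<lambda>x. f x - ?S x) = 0" if "k \<in> I" for k
    using that herm_coeff_sum[OF I, of k "\<lambda>k. herm_coeff k f"] f
    by (simp add: herm_coeff_def l2_inner_diff_right)
  then have "l2_inner ?S (\<lambda>x. f x - ?S x) = 0" by (simp add: l2_inner_herm_sum_left[OF g])
  from l2_norm_pythagoras[OF _ g this] have "(l2_norm f)\<^sup>2 = (l2_norm ?S)\<^sup>2 + (l2_norm (\<lambda>x. f x - ?S x))\<^sup>2"
    by simp
  then show ?thesis by (simp add: l2_norm_herm_sum[OF I])
qed

lemma tendsto_l2_inner:
  assumes g: "square_integrable g" and f: "square_integrable f" "\<And>n. square_integrable (s n)"
    and lim: "((\<lambda>n. l2_norm (\<lambda>x. f x - s n x)) \<longlongrightarrow> 0) F"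
  shows "((\<lambda>n. l2_inner g (s n)) \<longlongrightarrow> l2_inner g f) F"
proof -
  have "((\<lambda>n. l2_inner g (s n) - l2_inner g f) \<longlongrightarrow> 0) F"
  proof (rule Lim_null_comparison)
    show "((\<lambda>n. l2_norm g * l2_norm (\<lambda>x. f x - s n x)) \<longlongrightarrow> 0) F"
      using tendsto_mult_left[OF lim, of "l2_norm g"] by simp
    have "norm (l2_inner g (s n) - l2_inner g f) \<le> l2_norm g * l2_norm (\<lambda>x. f x - s n x)" for n
      using norm_l2_inner_le[OF g square_integrable_diff[OF f(1) f(2)[of n]]]
      by (simp add: l2_inner_diff_right[OF g f(1) f(2)] norm_minus_commute)
    then show "\<forall>\<^sub>F n in F. norm (l2_inner g (s n) - l2_inner g f) \<le> l2_norm g * l2_norm (\<lambda>x. f x - s n x)"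
      by simp
  qed
  then show ?thesis using LIM_zero_iff by blast
qed

section \<open>Completeness of the Hermite functions\<close>

lemma integral_char_eq_0:
  fixes F :: "real \<Rightarrow> real"
  assumes [measurable]: "F \<in> borel_measurable borel"
    and int: "\<And>t. integrable lborel (\<lambda>x. exp (t * \<bar>x\<bar>) * \<bar>F x\<bar>)"
    and moments: "\<And>k. (\<integral>x. x ^ k * F x \<partial>lborel) = 0"
  shows "(\<integral>x. F x *\<^sub>R iexp (t * x) \<partial>lborel) = 0"
proof -
  \<comment> \<open>Partial sums of the exponential series under the integral. Each integrates to a
    combination of vanishing moments, and
    \<open>exp (\<bar>t\<bar> * \<bar>x\<bar>) * \<bar>F x\<bar>\<close> dominates them all.\<close>
  define s where "s n x = F x *\<^sub>R (\<Sum>k<n. (\<i> * complex_of_real (t * x)) ^ k /\<^sub>R fact k)" for n x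
  have [measurable]: "s n \<in> borel_measurable borel" for n unfolding s_def by measurable
  have le: "norm (s n x) \<le> exp (\<bar>t\<bar> * \<bar>x\<bar>) * \<bar>F x\<bar>" for n x
  proof -
    have "norm (\<Sum>k<n. (\<i> * complex_of_real (t * x)) ^ k /\<^sub>R fact k)
        \<le> (\<Sum>k<n. (\<bar>t\<bar> * \<bar>x\<bar>) ^ k /\<^sub>R fact k)"
      by (rule order_trans[OF norm_sum])
        (simp add: norm_mult norm_power abs_mult power_mult_distrib)
    also have "\<dots> \<le> exp (\<bar>t\<bar> * \<bar>x\<bar>)"
      unfolding exp_def by (intro sum_le_suminf summable_exp_generic) auto
    finally show ?thesis unfolding s_def by (simp add: mult_left_mono mult.commute)
  qed
  have mono: "integrable lborel (\<lambda>x. x ^ k * F x)" for k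
  proof (rule Bochner_Integration.integrable_bound)
    show "integrable lborel (\<lambda>x. fact k * (exp (1 * \<bar>x\<bar>) * \<bar>F x\<bar>))"
      by (intro integrable_mult_right int)
    have "\<bar>x\<bar> ^ k \<le> fact k * exp \<bar>x\<bar>" for x :: real
    proof -
      have "\<bar>x\<bar> ^ k /\<^sub>R fact k \<le> (\<Sum>j<Suc k. \<bar>x\<bar> ^ j /\<^sub>R fact j)"
        by (rule member_le_sum) auto
      also have "\<dots> \<le> exp \<bar>x\<bar>"
        unfolding exp_def by (intro sum_le_suminf summable_exp_generic) auto
      finally show ?thesis by (simp add: field_simps)
    qed
    then show "AE x in lborel. norm (x ^ k * F x) \<le> norm (fact k * (exp (1 * \<bar>x\<bar>) * \<bar>F x\<bar>))"
      by (auto simp: abs_mult power_abs mult_right_mono simp flip: mult.assoc)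
  qed simp
  have "(\<lambda>n. integral\<^sup>L lborel (s n)) \<longlonglongrightarrow> (\<integral>x. F x *\<^sub>R iexp (t * x) \<partial>lborel)"
  proof (rule integral_dominated_convergence[where w="\<lambda>x. exp (\<bar>t\<bar> * \<bar>x\<bar>) * \<bar>F x\<bar>"])
    have "(\<lambda>n. s n x) \<longlonglongrightarrow> F x *\<^sub>R iexp (t * x)" for x
      unfolding s_def exp_def
      by (intro tendsto_scaleR tendsto_const summable_LIMSEQ summable_exp_generic)
    then show "AE x in lborel. (\<lambda>n. s n x) \<longlonglongrightarrow> F x *\<^sub>R iexp (t * x)" by simp
  qed (use int le in auto)
  moreover have "integral\<^sup>L lborel (s n) = 0" for n
  proof -
    have "s n = (\<lambda>x. \<Sum>k<n. ((\<i> * t) ^ k /\<^sub>R fact k) * complex_of_real (x ^ k * F x))"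
      unfolding s_def scaleR_conv_of_real sum_distrib_left
      by (intro ext sum.cong refl) (simp add: power_mult_distrib)
    then have "integral\<^sup>L lborel (s n) = (\<Sum>k<n. ((\<i> * t) ^ k /\<^sub>R fact k) * complex_of_real (\<integral>x. x ^ k * F x \<partial>lborel))"
      using mono
      by (simp only: integral_mult_right_zero integral_complex_of_real
          Bochner_Integration.integral_sum integrable_mult_right integrable_of_real)
    then show ?thesis by (simp add: moments)
  qed
  ultimately show ?thesis by (simp add: LIMSEQ_const_iff)
qed

text \<open>The zeroth moment gives the positive part \<open>P\<close> and the negative part
  \<open>M\<close> the same mass \<open>c\<close>. If \<open>c\<close> is positive, both can be
  normalised to probability densities; their characteristic functions agree by the preceding lemma,
  so Levy's uniqueness theorem identifies them and \<open>F = P - M\<close> vanishes.\<close>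

lemma moments_zero_imp_AE_zero:
  fixes F :: "real \<Rightarrow> real"
  assumes F [measurable]: "F \<in> borel_measurable borel"
    and int: "\<And>t. integrable lborel (\<lambda>x. exp (t * \<bar>x\<bar>) * \<bar>F x\<bar>)"
    and moments: "\<And>k. (\<integral>x. x ^ k * F x \<partial>lborel) = 0"
  shows "AE x in lborel. F x = 0"
proof -
  have iF: "integrable lborel F"
    using int[of 0] by (simp add: integrable_abs_iff)
  define P where "P x = max 0 (F x)" for x
  define M where "M x = max 0 (- F x)" for x
  have [measurable]: "P \<in> borel_measurable borel" "M \<in> borel_measurable borel"
    unfolding P_def M_def by measurable
  have iP: "integrable lborel P" and iM: "integrable lborel M"
    unfolding P_def M_def using iF by auto
  have PM: "F x = P x - M x" "P x \<ge> 0" "M x \<ge> 0" for x unfolding P_def M_def by auto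
  define c where "c = integral\<^sup>L lborel P"
  have "c - integral\<^sup>L lborel M = integral\<^sup>L lborel F"
    unfolding c_def PM(1)[abs_def] using iP iM by simp
  then have cM: "integral\<^sup>L lborel M = c" using moments[of 0] by simp
  show ?thesis
  proof (cases "c = 0")
    case True
    then have "AE x in lborel. P x = 0" "AE x in lborel. M x = 0"
      using integral_nonneg_eq_0_iff_AE[OF iP] integral_nonneg_eq_0_iff_AE[OF iM] PM cM
      unfolding c_def by auto
    then show ?thesis by eventually_elim (simp add: PM(1))
  next
    case False
    then have c: "c > 0" unfolding c_def using PM(2) by (simp add: less_le integral_nonneg_AE)
    have distr: "real_distribution (density lborel (\<lambda>x. ennreal (G x / c)))"
      if [measurable]: "G \<in> borel_measurable borel" and iG: "integrable lborel G"
        and nn: "\<And>x. G x \<ge> 0" and G: "integral\<^sup>L lborel G = c" for G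
    proof -
      have "emeasure (density lborel (\<lambda>x. ennreal (G x / c))) UNIV = (\<integral>\<^sup>+x. ennreal (G x / c) \<partial>lborel)"
        by (subst emeasure_density) auto
      also have "\<dots> = ennreal (\<integral>x. G x / c \<partial>lborel)"
        by (rule nn_integral_eq_integral) (use iG nn c in auto)
      also have "\<dots> = 1" using G c by simp
      finally show ?thesis
        by (intro real_distribution.intro real_distribution_axioms.intro prob_spaceI) simp_all
    qed
    have char: "char (density lborel (\<lambda>x. ennreal (G x / c))) t = (\<integral>x. G x *\<^sub>R iexp (t * x) \<partial>lborel) / c"
      if [measurable]: "G \<in> borel_measurable borel" and nn: "\<And>x. G x \<ge> 0" for G t
    proof -
      have "char (density lborel (\<lambda>x. ennreal (G x / c))) t = (\<integral>x. (G x / c) *\<^sub>R iexp (t * x) \<partial>lborel)"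
        unfolding char_def by (rule integral_density) (use nn c in auto)
      also have "\<dots> = (\<integral>x. (1 / c) *\<^sub>R (G x *\<^sub>R iexp (t * x)) \<partial>lborel)" by (simp add: mult.commute)
      finally show ?thesis by (simp add: scaleR_conv_of_real divide_inverse mult.commute)
    qed
    have iexp: "integrable lborel (\<lambda>x. G x *\<^sub>R iexp (t * x))"
      if [measurable]: "G \<in> borel_measurable borel" and "integrable lborel G" for G t
      by (rule Bochner_Integration.integrable_bound[OF that(2)]) auto
    have "char (density lborel (\<lambda>x. ennreal (P x / c))) = char (density lborel (\<lambda>x. ennreal (M x / c)))"
    proof
      fix t
      have "(\<integral>x. P x *\<^sub>R iexp (t * x) \<partial>lborel) - (\<integral>x. M x *\<^sub>R iexp (t * x) \<partial>lborel)
          = (\<integral>x. F x *\<^sub>R iexp (t * x) \<partial>lborel)"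
        unfolding PM(1) scaleR_diff_left using iexp iP iM by simp
      also have "\<dots> = 0" by (rule integral_char_eq_0[OF F int moments])
      finally show "char (density lborel (\<lambda>x. ennreal (P x / c))) t = char (density lborel (\<lambda>x. ennreal (M x / c))) t"
        using PM by (simp add: char)
    qed
    then have "density lborel (\<lambda>x. ennreal (P x / c)) = density lborel (\<lambda>x. ennreal (M x / c))"
      using iP iM cM PM by (intro Levy_uniqueness distr) (auto simp: c_def)
    then have "AE x in lborel. ennreal (P x / c) = ennreal (M x / c)"
      by (subst (asm) sigma_finite_measure.density_unique_iff[OF sigma_finite_lborel]) auto
    then show ?thesis
    proof eventually_elim
      case (elim x)
      then have "P x / c = M x / c" using PM c by (subst (asm) ennreal_inj) auto
      then show ?case using c by (simp add: PM(1))
    qed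
  qed
qed

lemma integrable_gauss_poly_scaleR:
  assumes "square_integrable f"
  shows "integrable lborel (\<lambda>x. gauss_poly p x *\<^sub>R f x)"
  using integrable_cnj_mult[OF square_integrable_gauss_poly[of p] assms]
  by (simp add: scaleR_conv_of_real)

text \<open>By the three-term recurrence, induction on \<open>n\<close> with \<open>k\<close>
  arbitrary shows that \<open>f\<close> is orthogonal to every \<open>x\<^sup>n h\<^sub>k\<close>.
  Since \<open>herm 0\<close> is a nonzero constant, the case \<open>k = 0\<close> covers all
  monomials, and no change of basis has to be inverted.\<close>

lemma integral_gauss_poly_eq_0:
  assumes f: "square_integrable f" and coeff: "\<And>k. herm_coeff k f = 0"
  shows "(\<integral>x. gauss_poly p x *\<^sub>R f x \<partial>lborel) = 0"
proof -
  define L where "L p = (\<integral>x. gauss_poly p x *\<^sub>R f x \<partial>lborel)" for p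
  have add: "L (p + q) = L p + L q" for p q
    using f by (simp add: L_def gauss_poly_add scaleR_add_left integrable_gauss_poly_scaleR)
  have smult: "L (smult c p) = c *\<^sub>R L p" for c p
    by (simp add: L_def gauss_poly_smult flip: scaleR_scaleR)
  have herm: "L (monom 1 n * herm k) = 0" for n k
  proof (induction n arbitrary: k)
    case 0
    show ?case using coeff[of k]
      by (simp add: L_def herm_coeff_def herm_fun_def[abs_def] l2_inner_gauss_poly monom_0)
  next
    case (Suc n)
    have "monom 1 (Suc n) * herm k = monom 1 n * pCons 0 (herm k)" by (simp add: monom_Suc)
    then have "L (monom 1 (Suc n) * herm k)
        = L (smult (sqrt (real (k + 1)) / 2) (monom 1 n * herm (Suc k)) + smult (sqrt (real k) / 2) (monom 1 n * herm (k - 1)))"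
      by (simp only: pCons_0_herm distrib_left mult_smult_right)
    then show ?case by (simp only: add smult Suc.IH scaleR_zero_right add_0_right)
  qed
  have monom: "L (monom c n) = 0" for c n
  proof -
    have "monom c n = smult (c / sqrt (sqrt (2 / pi))) (monom 1 n * herm 0)"
      by (simp add: smult_monom)
    then show ?thesis by (simp only: smult herm scaleR_zero_right)
  qed
  have "L (\<Sum>i\<in>I. monom (coeff p i) i) = 0" for I p
    by (induction I rule: infinite_finite_induct) (auto simp: monom add L_def[of 0])
  from this[of p "{..degree p}"] show ?thesis
    unfolding poly_as_sum_of_monoms L_def .
qed

text \<open>Completing the square bounds \<open>t \<bar>x\<bar> - x\<^sup>2\<close> by
  \<open>t\<^sup>2 / 2 - x\<^sup>2 / 2\<close>. The purpose is that
  \<open>f exp (- x\<^sup>2)\<close> has all exponential moments when \<open>f\<close> is square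
  integrable.\<close>

lemma square_integrable_exp_gaussian:
  "square_integrable (\<lambda>x. complex_of_real (exp (t * \<bar>x\<bar>) * exp (- x\<^sup>2)))"
proof (rule square_integrable_bound[where C="exp (t\<^sup>2 / 2)"])
  have "exp (- x\<^sup>2) = sqrt pi * normal_density 0 (1 / sqrt 2) x" for x
    by (simp add: normal_density_def power_divide)
  then show "square_integrable (\<lambda>x. complex_of_real (exp (- x\<^sup>2 / 2)))"
    by (simp add: square_integrable_def flip: exp_double)
  show "norm (complex_of_real (exp (t * \<bar>x\<bar>) * exp (- x\<^sup>2)))
      \<le> exp (t\<^sup>2 / 2) * norm (complex_of_real (exp (- x\<^sup>2 / 2)))" for x
  proof -
    have "0 \<le> (t - \<bar>x\<bar>)\<^sup>2 / 2" by simp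
    then have "t * \<bar>x\<bar> - x\<^sup>2 \<le> t\<^sup>2 / 2 - x\<^sup>2 / 2" by (simp add: power2_diff field_simps)
    then show ?thesis by (simp flip: exp_add)
  qed
qed simp

lemma herm_complete:
  assumes f: "square_integrable f" and coeff: "\<And>k. herm_coeff k f = 0"
  shows "AE x in lborel. f x = 0"
proof -
  have [measurable]: "f \<in> borel_measurable borel" using square_integrableD(1)[OF f] .
  \<comment> \<open>The moment criterion concerns real functions, so it is applied with
    \<open>h\<close> equal to \<open>Re\<close> and to \<open>Im\<close>; a moment of
    \<open>h (f x) * exp (- x\<^sup>2)\<close> is \<open>h\<close> of the pairing of
    \<open>f\<close> with a Gaussian monomial.\<close>
  have zero: "AE x in lborel. h (f x) * exp (- x\<^sup>2) = 0"
    if h: "bounded_linear h" and le: "\<And>z. \<bar>h z\<bar> \<le> norm z" for h :: "complex \<Rightarrow> real"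
  proof (rule moments_zero_imp_AE_zero)
    have [measurable]: "h \<in> borel_measurable borel"
      using h by (intro borel_measurable_continuous_onI linear_continuous_on)
    show "(\<lambda>x. h (f x) * exp (- x\<^sup>2)) \<in> borel_measurable borel" by measurable
    show "integrable lborel (\<lambda>x. exp (t * \<bar>x\<bar>) * \<bar>h (f x) * exp (- x\<^sup>2)\<bar>)" for t
    proof (rule Bochner_Integration.integrable_bound[OF integrable_norm_mult[OF square_integrable_exp_gaussian[of t] f]])
      show "AE x in lborel. norm (exp (t * \<bar>x\<bar>) * \<bar>h (f x) * exp (- x\<^sup>2)\<bar>)
          \<le> norm (norm (complex_of_real (exp (t * \<bar>x\<bar>) * exp (- x\<^sup>2))) * norm (f x))"
        using le by (simp add: abs_mult norm_mult mult_ac)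
    qed simp
    show "(\<integral>x. x ^ k * (h (f x) * exp (- x\<^sup>2)) \<partial>lborel) = 0" for k
    proof -
      have "(\<integral>x. x ^ k * (h (f x) * exp (- x\<^sup>2)) \<partial>lborel) = (\<integral>x. h (gauss_poly (monom 1 k) x *\<^sub>R f x) \<partial>lborel)"
        by (simp add: linear_simps(5)[OF h] gauss_poly_def poly_monom mult_ac)
      also have "\<dots> = h (\<integral>x. gauss_poly (monom 1 k) x *\<^sub>R f x \<partial>lborel)"
        by (rule integral_bounded_linear[OF h integrable_gauss_poly_scaleR[OF f]])
      finally show ?thesis
        using h by (simp add: integral_gauss_poly_eq_0[OF f coeff] linear_simps)
    qed
  qed
  have "AE x in lborel. Re (f x) * exp (- x\<^sup>2) = 0" "AE x in lborel. Im (f x) * exp (- x\<^sup>2) = 0"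
    by (intro zero bounded_linear_Re bounded_linear_Im abs_Re_le_cmod abs_Im_le_cmod)+
  then show ?thesis by eventually_elim (simp add: complex_eq_iff)
qed

section \<open>Norm convergence of the Hermite expansion\<close>

lemma AE_summable_herm_series:
  fixes c :: "nat \<Rightarrow> real"
  assumes c: "summable c" "\<And>k. c k \<ge> 0"
  defines "G \<equiv> (\<lambda>x. \<Sum>k. c k * norm (herm_fun k x))"
  shows "AE x in lborel. summable (\<lambda>k. c k * norm (herm_fun k x))" "integrable lborel (\<lambda>x. (G x)\<^sup>2)"
proof -
  define g where "g n x = (\<Sum>k<n. c k * norm (herm_fun k x))" for n x
  define u where "u n x = ennreal ((g n x)\<^sup>2)" for n x
  have [measurable]: "g n \<in> borel_measurable borel" for n unfolding g_def by measurable
  have [measurable]: "u n \<in> borel_measurable borel" for n unfolding u_def by measurable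
  have g0: "0 \<le> g n x" for n x unfolding g_def using c by (simp add: sum_nonneg)
  have "incseq u"
    unfolding incseq_def le_fun_def u_def
    by (intro allI impI ennreal_leI power_mono g0) (auto simp: g_def c intro!: sum_mono2)
  \<comment> \<open>As every \<open>herm_fun k\<close> has norm one, the triangle inequality bounds
    the norms of the partial sums by \<open>suminf c\<close>, uniformly in \<open>n\<close>.
    Monotone convergence then carries the bound over to the whole series.\<close>
  have bound: "integral\<^sup>N lborel (u n) \<le> ennreal ((suminf c)\<^sup>2)" for n
  proof -
    let ?f = "\<lambda>x. complex_of_real (g n x)"
    have sq: "square_integrable (\<lambda>x. complex_of_real (c k) * complex_of_real (norm (herm_fun k x)))" for k
      by (intro square_integrable_mult square_integrable_bound[OF square_integrable_herm_fun[of k], of _ 1]) auto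
    have f: "?f = (\<lambda>x. \<Sum>k<n. complex_of_real (c k) * complex_of_real (norm (herm_fun k x)))"
      by (simp add: g_def)
    have sqf: "square_integrable ?f" unfolding f by (intro square_integrable_sum sq)
    have "l2_norm (\<lambda>x. complex_of_real (norm (herm_fun k x))) = 1" for k
      using l2_norm_herm_fun[of k] unfolding l2_norm_def by simp
    then have "l2_norm ?f \<le> (\<Sum>k<n. c k)"
      unfolding f using l2_norm_triangle_sum[of "{..<n}", OF sq] c by (simp add: l2_norm_mult)
    also have "\<dots> \<le> suminf c" using c by (intro sum_le_suminf) auto
    finally have "(l2_norm ?f)\<^sup>2 \<le> (suminf c)\<^sup>2" by (intro power_mono) auto
    moreover have "integral\<^sup>N lborel (u n) = ennreal ((l2_norm ?f)\<^sup>2)"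
      unfolding u_def l2_norm_power2
      using square_integrableD(3)[OF sqf] by (subst nn_integral_eq_integral) auto
    ultimately show ?thesis by (simp add: ennreal_leI)
  qed
  have "(\<integral>\<^sup>+x. (SUP n. u n x) \<partial>lborel) = (SUP n. integral\<^sup>N lborel (u n))"
    by (rule nn_integral_monotone_convergence_SUP[OF \<open>incseq u\<close>]) simp
  also have "\<dots> \<le> ennreal ((suminf c)\<^sup>2)" by (rule SUP_least) (rule bound)
  finally have fin: "(\<integral>\<^sup>+x. (SUP n. u n x) \<partial>lborel) < \<infinity>"
    by (simp add: order_le_less_trans[OF _ ennreal_less_top])
  then have "AE x in lborel. (SUP n. u n x) \<noteq> \<infinity>"
    by (intro nn_integral_PInf_AE) auto
  then have ae: "AE x in lborel. summable (\<lambda>k. c k * norm (herm_fun k x)) \<and> ennreal ((G x)\<^sup>2) \<le> (SUP n. u n x)"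
  proof eventually_elim
    case (elim x)
    then obtain K where K: "(SUP n. u n x) = ennreal K" "K \<ge> 0" by (cases "SUP n. u n x") auto
    have "(g n x)\<^sup>2 \<le> K" for n
      using SUP_upper[of n UNIV "\<lambda>n. u n x"] K by (simp add: u_def)
    then have "g n x \<le> sqrt K" for n using g0 by (simp add: real_le_rsqrt)
    then have sm: "summable (\<lambda>k. c k * norm (herm_fun k x))"
      unfolding g_def using c by (intro summableI_nonneg_bounded) auto
    then have "(\<lambda>n. u n x) \<longlonglongrightarrow> ennreal ((G x)\<^sup>2)"
      unfolding u_def g_def G_def by (intro tendsto_ennrealI tendsto_power summable_LIMSEQ)
    then have "ennreal ((G x)\<^sup>2) \<le> (SUP n. u n x)"
      by (rule LIMSEQ_le_const2) (intro exI allI impI SUP_upper UNIV_I)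
    with sm show ?case by simp
  qed
  then show "AE x in lborel. summable (\<lambda>k. c k * norm (herm_fun k x))" by eventually_elim simp
  have [measurable]: "G \<in> borel_measurable borel" unfolding G_def by measurable
  show "integrable lborel (\<lambda>x. (G x)\<^sup>2)"
  proof (rule integrableI_bounded)
    have "(\<integral>\<^sup>+x. ennreal (norm ((G x)\<^sup>2)) \<partial>lborel) \<le> (\<integral>\<^sup>+x. (SUP n. u n x) \<partial>lborel)"
      by (rule nn_integral_mono_AE) (use ae in eventually_elim, simp)
    then show "(\<integral>\<^sup>+x. ennreal (norm ((G x)\<^sup>2)) \<partial>lborel) < \<infinity>" using fin by simp
  qed simp
qed

text \<open>Absolute summability provides a pointwise limit \<open>s\<close> together with a
  square-integrable majorant \<open>G\<close>, so dominated convergence gives convergence to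
  \<open>s\<close> in norm. The limit is \<open>f\<close> by completeness, since coefficients pass
  to norm limits and those of \<open>s\<close> and \<open>f\<close> therefore agree.\<close>

lemma herm_expansion:
  assumes f: "square_integrable f" and sm: "summable (\<lambda>k. norm (herm_coeff k f))"
  shows "(\<lambda>n. l2_norm (\<lambda>x. f x - (\<Sum>k<n. herm_coeff k f * herm_fun k x))) \<longlonglongrightarrow> 0"
proof -
  define G where "G x = (\<Sum>k. norm (herm_coeff k f) * norm (herm_fun k x))" for x
  define S where "S n x = (\<Sum>k<n. herm_coeff k f * herm_fun k x)" for n x
  define s where "s x = (\<Sum>k. herm_coeff k f * herm_fun k x)" for x
  note series = AE_summable_herm_series[OF sm norm_ge_zero, folded G_def]
  have [measurable]: "f \<in> borel_measurable borel" using square_integrableD(1)[OF f] .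
  have [measurable]: "G \<in> borel_measurable borel" "S n \<in> borel_measurable borel" "s \<in> borel_measurable borel" for n
    unfolding G_def S_def s_def by measurable
  have ae: "AE x in lborel. norm (s x) \<le> G x \<and> (\<forall>n. norm (s x - S n x) \<le> 2 * G x) \<and> (\<lambda>n. S n x) \<longlonglongrightarrow> s x"
    using series(1)
  proof eventually_elim
    case (elim x)
    then have sn: "summable (\<lambda>k. norm (herm_coeff k f * herm_fun k x))" by (simp add: norm_mult)
    have "norm (s x) \<le> G x" using summable_norm[OF sn] by (simp add: s_def G_def norm_mult)
    moreover have "norm (S n x) \<le> G x" for n
      unfolding S_def G_def
      by (rule order_trans[OF norm_sum]) (use elim in \<open>auto simp: norm_mult intro!: sum_le_suminf\<close>)
    then have "norm (s x - S n x) \<le> 2 * G x" for n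
      using \<open>norm (s x) \<le> G x\<close> norm_triangle_ineq4[of "s x" "S n x"] by (smt (verit))
    moreover have "(\<lambda>n. S n x) \<longlonglongrightarrow> s x"
      unfolding S_def s_def by (rule summable_LIMSEQ[OF summable_norm_cancel[OF sn]])
    ultimately show ?case by simp
  qed
  have s: "square_integrable s"
    unfolding square_integrable_def
  proof
    show "integrable lborel (\<lambda>x. (norm (s x))\<^sup>2)"
      by (rule Bochner_Integration.integrable_bound[OF series(2)])
        (measurable, use ae in eventually_elim, auto intro: power_mono)
  qed simp
  have lim: "(\<lambda>n. l2_norm (\<lambda>x. s x - S n x)) \<longlonglongrightarrow> 0"
  proof -
    have "(\<lambda>n. \<integral>x. (norm (s x - S n x))\<^sup>2 \<partial>lborel) \<longlonglongrightarrow> (\<integral>x. 0 \<partial>(lborel :: real measure))"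
    proof (rule integral_dominated_convergence[where w="\<lambda>x. 4 * (G x)\<^sup>2"])
      show "AE x in lborel. (\<lambda>n. (norm (s x - S n x))\<^sup>2) \<longlonglongrightarrow> 0"
        using ae
      proof eventually_elim
        case (elim x)
        then have "(\<lambda>n. (norm (s x - S n x))\<^sup>2) \<longlonglongrightarrow> (norm (s x - s x))\<^sup>2"
          by (intro tendsto_intros) auto
        then show ?case by simp
      qed
      show "AE x in lborel. norm ((norm (s x - S n x))\<^sup>2) \<le> 4 * (G x)\<^sup>2" for n
        using ae
      proof eventually_elim
        case (elim x)
        then have "(norm (s x - S n x))\<^sup>2 \<le> (2 * G x)\<^sup>2" by (intro power_mono) auto
        then show ?case by (simp add: power_mult_distrib)
      qed
    qed (use series(2) in auto)
    then have "(\<lambda>n. sqrt (\<integral>x. (norm (s x - S n x))\<^sup>2 \<partial>lborel)) \<longlonglongrightarrow> sqrt 0"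
      by (intro tendsto_real_sqrt) simp
    then show ?thesis by (simp add: l2_norm_def)
  qed
  have Sn: "square_integrable (S n)" for n unfolding S_def by simp
  have coeff: "herm_coeff j s = herm_coeff j f" for j
  proof -
    have "(\<lambda>n. l2_inner (herm_fun j) (S n)) \<longlonglongrightarrow> l2_inner (herm_fun j) s"
      by (rule tendsto_l2_inner[OF _ s Sn lim]) simp
    moreover have "\<forall>\<^sub>F n in sequentially. l2_inner (herm_fun j) (S n) = herm_coeff j f"
      using eventually_gt_at_top[of j]
      by eventually_elim
        (use herm_coeff_sum[of "{..<_}" j "\<lambda>k. herm_coeff k f"] in \<open>simp add: S_def[abs_def] herm_coeff_def\<close>)
    ultimately show ?thesis
      using tendsto_eventually tendsto_unique sequentially_bot unfolding herm_coeff_def by metis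
  qed
  have ae0: "AE x in lborel. f x - s x = 0"
    by (rule herm_complete) (use coeff f s in \<open>simp_all add: square_integrable_diff herm_coeff_def l2_inner_diff_right\<close>)
  have "l2_norm (\<lambda>x. f x - S n x) = l2_norm (\<lambda>x. s x - S n x)" for n
  proof (rule l2_norm_cong_AE)
    show "AE x in lborel. f x - S n x = s x - S n x"
      using ae0 by eventually_elim simp
  qed measurable
  then show ?thesis using lim by (simp add: S_def)
qed

section \<open>Multiplication by the variable in terms of Hermite coefficients\<close>

definition position_coeff :: "(nat \<Rightarrow> complex) \<Rightarrow> nat \<Rightarrow> complex" where
  "position_coeff c j =
     ((if j = 0 then 0 else complex_of_real (sqrt (real j)) * c (j - 1))
       + complex_of_real (sqrt (real (j + 1))) * c (j + 1)) / 2"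

lemma position_coeff_eq_0: "(\<And>k. k \<ge> n \<Longrightarrow> c k = 0) \<Longrightarrow> j \<ge> Suc n \<Longrightarrow> position_coeff c j = 0"
  by (simp add: position_coeff_def)

lemma position_herm_fun:
  "x * herm_fun k x =
    (complex_of_real (sqrt (real (k + 1))) * herm_fun (Suc k) x
      + complex_of_real (sqrt (real k)) * herm_fun (k - 1) x) / 2"
proof -
  have "x * gauss_poly (herm k) x = gauss_poly (pCons 0 (herm k)) x" by (simp add: gauss_poly_def)
  also have "\<dots> = (sqrt (real (k + 1)) * gauss_poly (herm (Suc k)) x + sqrt (real k) * gauss_poly (herm (k - 1)) x) / 2"
    unfolding pCons_0_herm gauss_poly_add gauss_poly_smult by (simp add: field_simps)
  finally have "complex_of_real (x * gauss_poly (herm k) x) = complex_of_real \<dots>" by (simp only:)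
  then show ?thesis by (simp add: herm_fun_def del: herm.simps)
qed

lemma position_herm_sum:
  assumes c: "\<And>k. k \<ge> n \<Longrightarrow> c k = 0"
  shows "x * (\<Sum>k<n. c k * herm_fun k x) = (\<Sum>j<Suc n. position_coeff c j * herm_fun j x)"
proof -
  have "x * (\<Sum>k<n. c k * herm_fun k x) = (\<Sum>k<n. c k * (x * herm_fun k x))"
    by (simp add: sum_distrib_left mult.left_commute)
  also have "\<dots> = (\<Sum>k<n. c k * (complex_of_real (sqrt (real (k + 1))) * herm_fun (Suc k) x) / 2)
      + (\<Sum>k<n. c k * (complex_of_real (sqrt (real k)) * herm_fun (k - 1) x) / 2)"
    unfolding position_herm_fun by (simp only: distrib_left times_divide_eq_right add_divide_distrib sum.distrib)
  also have "(\<Sum>k<n. c k * (complex_of_real (sqrt (real (k + 1))) * herm_fun (Suc k) x) / 2)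
      = (\<Sum>j<Suc n. (if j = 0 then 0 else complex_of_real (sqrt (real j)) * c (j - 1)) / 2 * herm_fun j x)"
    by (subst sum.lessThan_Suc_shift) (auto intro!: sum.cong)
  \<comment> \<open>Two zero terms are appended; dropping the term \<open>k = 0\<close>, which
    carries the factor \<open>sqrt 0\<close>, then leaves a sum of length
    \<open>Suc n\<close>.\<close>
  also have "(\<Sum>k<n. c k * (complex_of_real (sqrt (real k)) * herm_fun (k - 1) x) / 2)
      = (\<Sum>k<Suc (Suc n). c k * (complex_of_real (sqrt (real k)) * herm_fun (k - 1) x) / 2)"
    using c by simp
  also have "\<dots> = (\<Sum>j<Suc n. complex_of_real (sqrt (real (j + 1))) * c (j + 1) / 2 * herm_fun j x)"
    by (subst sum.lessThan_Suc_shift) (auto intro!: sum.cong simp: mult_ac)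
  finally show ?thesis
    by (simp only: position_coeff_def sum.distrib[symmetric] add_divide_distrib distrib_right)
qed

text \<open>Each coefficient \<open>c k\<close> feeds only its two neighbours, with squared factors
  of about \<open>k / 4\<close>. One multiplication by the variable therefore costs a factor
  \<open>k + 1\<close> and a shift of the weight by one, a form that can be iterated.\<close>

lemma position_coeff_weighted:
  fixes W :: "nat \<Rightarrow> real"
  assumes c: "\<And>k. k \<ge> n \<Longrightarrow> c k = 0" and W: "mono W" "\<And>k. W k \<ge> 0"
  shows "(\<Sum>j<Suc n. W j * (norm (position_coeff c j))\<^sup>2) \<le> (\<Sum>k<n. real (k + 1) * W (k + 1) * (norm (c k))\<^sup>2)"
proof -
  have pt: "(norm (position_coeff c j))\<^sup>2 \<le> (if j = 0 then 0 else j * (norm (c (j - 1)))\<^sup>2) / 2 + real (j + 1) * (norm (c (j + 1)))\<^sup>2 / 2" for j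
  proof -
    define a b where "a = (if j = 0 then 0 else sqrt (real j) * norm (c (j - 1)))"
      and "b = sqrt (real (j + 1)) * norm (c (j + 1))"
    have "norm (position_coeff c j) \<le> (a + b) / 2"
      unfolding position_coeff_def a_def b_def norm_divide
      by (auto simp: norm_mult intro!: divide_right_mono order_trans[OF norm_triangle_ineq])
    then have "(norm (position_coeff c j))\<^sup>2 \<le> ((a + b) / 2)\<^sup>2" by (rule power_mono) simp
    also have "\<dots> \<le> a\<^sup>2 / 2 + b\<^sup>2 / 2"
      using two_mult_le_weighted_squares[of 1 a b] by (simp add: power2_sum field_simps)
    finally show ?thesis unfolding a_def b_def
      by (cases "j = 0") (simp_all add: power_mult_distrib)
  qed
  have "(\<Sum>j<Suc n. W j * (norm (position_coeff c j))\<^sup>2)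
      \<le> (\<Sum>j<Suc n. W j * ((if j = 0 then 0 else j * (norm (c (j - 1)))\<^sup>2) / 2 + real (j + 1) * (norm (c (j + 1)))\<^sup>2 / 2))"
    by (intro sum_mono mult_left_mono pt W)
  also have "\<dots> = (\<Sum>j<Suc n. W j * (if j = 0 then 0 else j * (norm (c (j - 1)))\<^sup>2) / 2)
      + (\<Sum>j<Suc n. W j * (real (j + 1) * (norm (c (j + 1)))\<^sup>2) / 2)"
    by (simp only: distrib_left sum.distrib times_divide_eq_right)
  also have "(\<Sum>j<Suc n. W j * (if j = 0 then 0 else j * (norm (c (j - 1)))\<^sup>2) / 2)
      = (\<Sum>k<n. W (k + 1) * (real (k + 1) * (norm (c k))\<^sup>2) / 2)"
    by (subst sum.lessThan_Suc_shift) (auto intro!: sum.cong)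
  \<comment> \<open>The weight \<open>W j\<close> of the contribution of \<open>c (j + 1)\<close> is
    raised to \<open>W (j + 2)\<close>, so that both neighbours see the weight at their own index
    plus one.\<close>
  also have "(\<Sum>j<Suc n. W j * (real (j + 1) * (norm (c (j + 1)))\<^sup>2) / 2)
      \<le> (\<Sum>j<Suc n. W (j + 2) * (real (j + 1) * (norm (c (j + 1)))\<^sup>2) / 2)"
    by (intro sum_mono divide_right_mono mult_right_mono monoD[OF W(1)]) auto
  also have "\<dots> \<le> (\<Sum>k<Suc (Suc n). W (k + 1) * (real k * (norm (c k))\<^sup>2) / 2)"
    by (subst (2) sum.lessThan_Suc_shift) simp
  also have "\<dots> = (\<Sum>k<n. W (k + 1) * (real k * (norm (c k))\<^sup>2) / 2)"
    using c by simp
  also have "\<dots> \<le> (\<Sum>k<n. W (k + 1) * (real (k + 1) * (norm (c k))\<^sup>2) / 2)"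
    by (intro sum_mono divide_right_mono mult_left_mono mult_right_mono W) auto
  finally show ?thesis by (simp add: sum.distrib[symmetric] mult_ac)
qed

text \<open>Starting from the constant weight 1 for the cubed multiplication, the weighted bound is
  applied three times; the weights become \<open>k + 1\<close>, \<open>(k + 1) (k + 2)\<close> and
  \<open>(k + 1) (k + 2) (k + 3)\<close>, and the sum grows by one term per multiplication.\<close>

lemma l2_norm_cube_herm_sum:
  assumes c: "\<And>k. k \<ge> n \<Longrightarrow> c k = 0"
  shows "(l2_norm (\<lambda>x. complex_of_real x ^ 3 * (\<Sum>k<n. c k * herm_fun k x)))\<^sup>2
    \<le> (\<Sum>k<n. real ((k + 1) * (k + 2) * (k + 3)) * (norm (c k))\<^sup>2)"
    and "square_integrable (\<lambda>x. complex_of_real x ^ 3 * (\<Sum>k<n. c k * herm_fun k x))"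
proof -
  define c1 c2 c3 where "c1 = position_coeff c" and "c2 = position_coeff c1" and "c3 = position_coeff c2"
  have 1: "\<And>k. k \<ge> Suc n \<Longrightarrow> c1 k = 0" unfolding c1_def using position_coeff_eq_0[of n c] c by blast
  have 2: "\<And>k. k \<ge> Suc (Suc n) \<Longrightarrow> c2 k = 0" unfolding c2_def using position_coeff_eq_0[of "Suc n" c1] 1 by blast
  have eq: "complex_of_real x ^ 3 * (\<Sum>k<n. c k * herm_fun k x) = (\<Sum>k<Suc (Suc (Suc n)). c3 k * herm_fun k x)" for x
  proof -
    have "complex_of_real x ^ 3 * (\<Sum>k<n. c k * herm_fun k x) = x * (x * (x * (\<Sum>k<n. c k * herm_fun k x)))"
      by (simp add: power3_eq_cube mult.assoc)
    also have "x * (\<Sum>k<n. c k * herm_fun k x) = (\<Sum>k<Suc n. c1 k * herm_fun k x)"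
      unfolding c1_def by (rule position_herm_sum[OF c])
    also have "x * \<dots> = (\<Sum>k<Suc (Suc n). c2 k * herm_fun k x)"
      unfolding c2_def by (rule position_herm_sum[OF 1])
    also have "x * \<dots> = (\<Sum>k<Suc (Suc (Suc n)). c3 k * herm_fun k x)"
      unfolding c3_def by (rule position_herm_sum[OF 2])
    finally show ?thesis .
  qed
  show "square_integrable (\<lambda>x. complex_of_real x ^ 3 * (\<Sum>k<n. c k * herm_fun k x))" unfolding eq by (rule square_integrable_herm_sum)
  have "(l2_norm (\<lambda>x. complex_of_real x ^ 3 * (\<Sum>k<n. c k * herm_fun k x)))\<^sup>2 = (\<Sum>k<Suc (Suc (Suc n)). 1 * (norm (c3 k))\<^sup>2)"
    unfolding eq by (subst l2_norm_herm_sum) auto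
  also have "\<dots> \<le> (\<Sum>k<Suc (Suc n). real (k + 1) * 1 * (norm (c2 k))\<^sup>2)"
    unfolding c3_def by (rule position_coeff_weighted[OF 2]) (auto simp: mono_def)
  also have "\<dots> \<le> (\<Sum>k<Suc n. real (k + 1) * real ((k + 1) + 1) * (norm (c1 k))\<^sup>2)"
    using position_coeff_weighted[where c = c1 and n = "Suc n" and W = "\<lambda>k. real (k + 1)"] 1 unfolding c2_def mult_1_right
    by (simp add: mono_def)
  also have "\<dots> \<le> (\<Sum>k<n. real (k + 1) * (real (k + 1 + 1) * real ((k + 1 + 1) + 1)) * (norm (c k))\<^sup>2)"
    unfolding c1_def
    by (rule position_coeff_weighted[OF c]) (auto simp: mono_def intro!: mult_mono)
  also have "\<dots> = (\<Sum>k<n. real ((k + 1) * (k + 2) * (k + 3)) * (norm (c k))\<^sup>2)"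
    by (intro sum.cong refl arg_cong2[where f="(*)"]) (simp only: of_nat_mult mult.assoc, simp)
  finally show "(l2_norm (\<lambda>x. complex_of_real x ^ 3 * (\<Sum>k<n. c k * herm_fun k x)))\<^sup>2
    \<le> (\<Sum>k<n. real ((k + 1) * (k + 2) * (k + 3)) * (norm (c k))\<^sup>2)" .
qed

section \<open>Test functions\<close>

text \<open>Counting derivatives opens smoothness to induction: sums, products and compositions at
  level \<open>Suc n\<close> reduce to level \<open>n\<close> for the derivatives.\<close>

definition differentiable_upto :: "nat \<Rightarrow> (real \<Rightarrow> real) \<Rightarrow> bool" where
  "differentiable_upto n f \<longleftrightarrow> (\<forall>k\<le>n. \<forall>x. (deriv ^^ k) f differentiable (at x))"

definition smooth :: "(real \<Rightarrow> real) \<Rightarrow> bool" where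
  "smooth f \<longleftrightarrow> (\<forall>n. differentiable_upto n f)"

lemma smooth_iff: "smooth f \<longleftrightarrow> (\<forall>k x. (deriv ^^ k) f differentiable (at x))"
  unfolding smooth_def differentiable_upto_def by auto

lemma differentiable_upto_0: "differentiable_upto 0 f \<longleftrightarrow> (\<forall>x. f differentiable (at x))"
  by (simp add: differentiable_upto_def)

lemma differentiable_upto_Suc:
  "differentiable_upto (Suc n) f \<longleftrightarrow> (\<forall>x. f differentiable (at x)) \<and> differentiable_upto n (deriv f)"
proof -
  have "differentiable_upto (Suc n) f \<longleftrightarrow> (\<forall>x. (deriv ^^ 0) f differentiable (at x)) \<and>
      (\<forall>k\<le>n. \<forall>x. (deriv ^^ Suc k) f differentiable (at x))"
    unfolding differentiable_upto_def by (metis le0 not0_implies_Suc Suc_le_mono)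
  then show ?thesis
    by (simp add: differentiable_upto_def funpow_Suc_right del: funpow.simps(2))
qed

lemma differentiable_uptoD: "differentiable_upto n f \<Longrightarrow> f differentiable (at x)"
  by (cases n) (simp_all add: differentiable_upto_0 differentiable_upto_Suc)

lemma differentiable_upto_SucD: "differentiable_upto (Suc n) f \<Longrightarrow> differentiable_upto n f"
  by (simp add: differentiable_upto_def)

lemma smooth_deriv: "smooth f \<Longrightarrow> smooth (deriv f)"
  unfolding smooth_def using differentiable_upto_Suc by blast

lemma smooth_DERIV: "smooth f \<Longrightarrow> (f has_real_derivative deriv f x) (at x)"
  unfolding smooth_def DERIV_deriv_iff_real_differentiable using differentiable_uptoD by blast

lemma smooth_coinduct:
  assumes "f \<in> S" and S: "\<And>f x. f \<in> S \<Longrightarrow> f differentiable (at x)" "\<And>f. f \<in> S \<Longrightarrow> deriv f \<in> S"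
  shows "smooth f"
proof -
  have "differentiable_upto n f" if "f \<in> S" for n f
    using that
    by (induction n arbitrary: f) (auto simp: differentiable_upto_0 differentiable_upto_Suc S)
  then show ?thesis using assms(1) unfolding smooth_def by blast
qed

text \<open>Meant for families such as \<open>gauss_poly\<close> and \<open>flat\<close>, whose
  derivatives stay in the family: \<open>d\<close> gives the index of the derivative, so no formula
  for higher derivatives is required.\<close>

lemma smooth_coinduct_range:
  assumes S: "\<And>i x. (F i has_real_derivative F (d i) x) (at x)"
  shows "smooth (F i)"
proof (rule smooth_coinduct[of _ "range F"])
  show "f differentiable (at x)" if "f \<in> range F" for f x
    using that S real_differentiable_def by blast
  have "deriv (F i) = F (d i)" for i using S DERIV_imp_deriv by blast
  then show "deriv f \<in> range F" if "f \<in> range F" for f using that by auto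
qed simp

lemma smooth_affine: "smooth (\<lambda>x. a * x + b)"
proof -
  have "smooth (\<lambda>x. fst (a, b) * x + snd (a, b))"
    by (rule smooth_coinduct_range[where F="\<lambda>p x. fst p * x + snd p" and d="\<lambda>p. (0, fst p)"])
      (auto intro!: derivative_eq_intros)
  then show ?thesis by simp
qed

lemma smooth_const [simp]: "smooth (\<lambda>x. c)" and smooth_ident [simp]: "smooth (\<lambda>x. x)"
  using smooth_affine[of 0 c] smooth_affine[of 1 0] by simp_all

lemma smooth_gauss_poly [simp]: "smooth (gauss_poly p)"
  by (rule smooth_coinduct_range) (rule has_real_derivative_gauss_poly)

lemma differentiable_upto_add:
  "differentiable_upto n f \<Longrightarrow> differentiable_upto n g \<Longrightarrow> differentiable_upto n (\<lambda>x. f x + g x)"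
proof (induction n arbitrary: f g)
  case (Suc n)
  have "deriv (\<lambda>x. f x + g x) = (\<lambda>x. deriv f x + deriv g x)"
    using Suc.prems differentiable_uptoD
    by (intro ext DERIV_imp_deriv DERIV_add) (auto simp: DERIV_deriv_iff_real_differentiable)
  with Suc show ?case by (simp add: differentiable_upto_Suc)
qed (simp add: differentiable_upto_0)

lemma differentiable_upto_mult:
  "differentiable_upto n f \<Longrightarrow> differentiable_upto n g \<Longrightarrow> differentiable_upto n (\<lambda>x. f x * g x)"
proof (induction n arbitrary: f g)
  case (Suc n)
  have "deriv (\<lambda>x. f x * g x) = (\<lambda>x. deriv f x * g x + deriv g x * f x)"
    using Suc.prems differentiable_uptoD
    by (intro ext DERIV_imp_deriv DERIV_mult) (auto simp: DERIV_deriv_iff_real_differentiable)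
  moreover have "differentiable_upto n (\<lambda>x. deriv f x * g x + deriv g x * f x)"
    using Suc.prems by (intro differentiable_upto_add Suc.IH)
      (auto simp: differentiable_upto_Suc intro: differentiable_upto_SucD)
  ultimately show ?case using Suc.prems by (simp add: differentiable_upto_Suc)
qed (simp add: differentiable_upto_0)

lemma differentiable_upto_compose:
  "differentiable_upto n f \<Longrightarrow> differentiable_upto n g \<Longrightarrow> differentiable_upto n (\<lambda>x. f (g x))"
proof (induction n arbitrary: f)
  case 0
  then show ?case
    using differentiable_compose[of f _ _ UNIV] by (auto simp: differentiable_upto_0)
next
  case (Suc n)
  have *: "((\<lambda>x. f (g x)) has_real_derivative deriv f (g x) * deriv g x) (at x)" for x
    using Suc.prems differentiable_uptoD
    by (intro DERIV_chain2) (auto simp: DERIV_deriv_iff_real_differentiable)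
  then have "deriv (\<lambda>x. f (g x)) = (\<lambda>x. deriv f (g x) * deriv g x)"
    by (intro ext DERIV_imp_deriv)
  moreover have "differentiable_upto n (\<lambda>x. deriv f (g x))"
    using Suc.IH[of "deriv f"] Suc.prems differentiable_upto_SucD[of n g]
    by (simp add: differentiable_upto_Suc)
  then have "differentiable_upto n (\<lambda>x. deriv f (g x) * deriv g x)"
    by (rule differentiable_upto_mult) (use Suc.prems in \<open>simp add: differentiable_upto_Suc\<close>)
  ultimately show ?case using * by (auto simp: differentiable_upto_Suc real_differentiable_def)
qed

lemma smooth_add: "smooth f \<Longrightarrow> smooth g \<Longrightarrow> smooth (\<lambda>x. f x + g x)"
  and smooth_mult: "smooth f \<Longrightarrow> smooth g \<Longrightarrow> smooth (\<lambda>x. f x * g x)"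
  and smooth_compose: "smooth f \<Longrightarrow> smooth g \<Longrightarrow> smooth (\<lambda>x. f (g x))"
  unfolding smooth_def
  using differentiable_upto_add differentiable_upto_mult differentiable_upto_compose by blast+

text \<open>The classical function \<open>exp (- 1 / x)\<close>, continued by 0, with polynomial
  factors in \<open>1 / x\<close> added to make the family closed under differentiation.\<close>

definition flat :: "real poly \<Rightarrow> real \<Rightarrow> real" where
  "flat p x = (if x > 0 then poly p (1 / x) * exp (- (1 / x)) else 0)"

lemma poly_exp_minus_at_top: "((\<lambda>x::real. poly p x * exp (- x)) \<longlongrightarrow> 0) at_top"
proof -
  have "((\<lambda>x. \<Sum>i\<le>degree p. coeff p i * (x ^ i / exp x)) \<longlongrightarrow> (\<Sum>i\<le>degree p. coeff p i * 0)) at_top"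
    by (intro tendsto_sum tendsto_mult_left tendsto_power_div_exp_0)
  then show ?thesis by (simp add: poly_altdef sum_distrib_left exp_minus divide_inverse mult_ac)
qed

lemma has_real_derivative_flat:
  "(flat p has_real_derivative flat ([:0, 0, 1:] * (p - pderiv p)) x) (at x)"
proof -
  consider "x > 0" | "x < 0" | "x = 0" by linarith
  then show ?thesis
  proof cases
    case 1
    have "((\<lambda>x. poly p (1 / x) * exp (- (1 / x))) has_real_derivative
        poly ([:0, 0, 1:] * (p - pderiv p)) (1 / x) * exp (- (1 / x))) (at x)"
      using 1 by (auto intro!: derivative_eq_intros DERIV_chain2[OF poly_DERIV] simp: field_simps power2_eq_square)
    then have "(flat p has_real_derivative poly ([:0, 0, 1:] * (p - pderiv p)) (1 / x) * exp (- (1 / x))) (at x)"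
      by (rule has_field_derivative_transform_within_open[of _ _ _ "{0<..}"]) (use 1 in \<open>auto simp: flat_def\<close>)
    then show ?thesis using 1 by (simp add: flat_def)
  next
    case 2
    have "((\<lambda>x. 0) has_real_derivative 0) (at x)" by simp
    then have "(flat p has_real_derivative 0) (at x)"
      by (rule has_field_derivative_transform_within_open[of _ _ _ "{..<0}"]) (use 2 in \<open>auto simp: flat_def\<close>)
    then show ?thesis using 2 by (simp add: flat_def)
  next
    case 3
    \<comment> \<open>With \<open>y = 1 / h\<close> the difference quotient at 0 becomes
      \<open>y * poly p y * exp (- y)\<close> as \<open>y\<close> tends to infinity, which explains
      the factor \<open>pCons 0\<close>.\<close>
    have "((\<lambda>h. flat p h / h) \<longlongrightarrow> 0) (at_right 0)"
      unfolding filterlim_at_right_to_top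
    proof (rule Lim_transform_eventually)
      show "((\<lambda>x. poly (pCons 0 p) x * exp (- x)) \<longlongrightarrow> 0) at_top" by (rule poly_exp_minus_at_top)
      show "\<forall>\<^sub>F x in at_top. poly (pCons 0 p) x * exp (- x) = flat p (inverse x) / inverse x"
        using eventually_gt_at_top[of 0] by eventually_elim (simp add: flat_def field_simps)
    qed
    moreover have "((\<lambda>h. flat p h / h) \<longlongrightarrow> 0) (at_left 0)"
      by (rule Lim_transform_eventually[OF tendsto_const]) (auto simp: flat_def eventually_at_filter)
    ultimately have "((\<lambda>h. flat p h / h) \<longlongrightarrow> 0) (at 0)" by (simp add: filterlim_at_split)
    then show ?thesis unfolding 3 DERIV_def by (simp add: flat_def)
  qed
qed

lemma test_function_iff: "test_function \<psi> \<longleftrightarrow> smooth \<psi> \<and> (\<exists>R. \<forall>x. \<bar>x\<bar> > R \<longrightarrow> \<psi> x = 0)"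
  by (simp add: test_function_def smooth_iff)

text \<open>The bump function is \<open>e \<cdot> exp (- 1 / (1 - x\<^sup>2))\<close> on \<open>(-1,1)\<close>.\<close>

lemma test_function_exists: "\<exists>h. test_function h \<and> h 0 = 1"
proof (intro exI conjI)
  let ?h = "\<lambda>x::real. exp 1 * flat 1 (1 + (- 1) * (x * x))"
  have "smooth (flat 1)"
    by (rule smooth_coinduct_range[where d="\<lambda>p. [:0, 0, 1:] * (p - pderiv p)"]) (rule has_real_derivative_flat)
  moreover have "smooth (\<lambda>x::real. 1 + (- 1) * (x * x))"
    by (intro smooth_add smooth_mult smooth_const smooth_ident)
  ultimately have "smooth ?h"
    by (rule smooth_mult[OF smooth_const smooth_compose])
  moreover have "?h x = 0" if "\<bar>x\<bar> > 1" for x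
  proof -
    have "1 * 1 \<le> \<bar>x\<bar> * \<bar>x\<bar>" using that by (intro mult_mono) auto
    then show ?thesis by (simp add: flat_def)
  qed
  ultimately show "test_function ?h" unfolding test_function_iff by blast
  show "?h 0 = 1" by (simp add: flat_def flip: exp_add)
qed

lemma test_function_smooth: "test_function \<psi> \<Longrightarrow> smooth \<psi>"
  by (simp add: test_function_iff)

lemma test_function_deriv:
  assumes "test_function \<psi>" shows "test_function (deriv \<psi>)"
proof -
  obtain R where R: "\<And>x. \<bar>x\<bar> > R \<Longrightarrow> \<psi> x = 0" using assms unfolding test_function_iff by auto
  have "deriv \<psi> x = 0" if "\<bar>x\<bar> > R" for x
  proof -
    have "open {x::real. R < \<bar>x\<bar>}" by (intro open_Collect_less continuous_intros)
    have "((\<lambda>x. 0) has_real_derivative 0) (at x)" by simp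
    then have "(\<psi> has_real_derivative 0) (at x)"
      by (rule has_field_derivative_transform_within_open[OF _ \<open>open {x. R < \<bar>x\<bar>}\<close>]) (use R that in auto)
    then show ?thesis by (rule DERIV_imp_deriv)
  qed
  then show ?thesis using assms smooth_deriv unfolding test_function_iff by blast
qed

lemma test_function_mult_left: "smooth g \<Longrightarrow> test_function \<psi> \<Longrightarrow> test_function (\<lambda>x. g x * \<psi> x)"
  unfolding test_function_iff using smooth_mult[of g \<psi>] by fastforce

lemma test_function_mult_right: "smooth g \<Longrightarrow> test_function \<psi> \<Longrightarrow> test_function (\<lambda>x. \<psi> x * g x)"
  using test_function_mult_left[of g \<psi>] by (simp add: mult.commute)

lemma test_function_add:
  assumes "test_function \<phi>" "test_function \<psi>"
  shows "test_function (\<lambda>x. \<phi> x + \<psi> x)"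
proof -
  obtain R S where R: "\<And>x. \<bar>x\<bar> > R \<Longrightarrow> \<phi> x = 0" and S: "\<And>x. \<bar>x\<bar> > S \<Longrightarrow> \<psi> x = 0"
    using assms unfolding test_function_iff by auto
  have "\<phi> x + \<psi> x = 0" if "\<bar>x\<bar> > max R S" for x using R[of x] S[of x] that by auto
  then show ?thesis using assms smooth_add unfolding test_function_iff by blast
qed

lemma test_function_scale:
  assumes "test_function \<psi>" "R > 0"
  shows "test_function (\<lambda>x. \<psi> (x / R))"
proof -
  obtain S where S: "\<And>x. \<bar>x\<bar> > S \<Longrightarrow> \<psi> x = 0" using assms unfolding test_function_iff by auto
  have "\<psi> (x / R) = 0" if "\<bar>x\<bar> > S * R" for x
    using assms(2) that by (intro S) (simp add: field_simps)
  moreover have "smooth (\<lambda>x. \<psi> (x / R))"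
    using smooth_compose[OF test_function_smooth[OF assms(1)] smooth_affine[of "1 / R" 0]] by simp
  ultimately show ?thesis unfolding test_function_iff by blast
qed

lemma continuous_on_smooth: "smooth f \<Longrightarrow> continuous_on S f"
  by (meson DERIV_isCont smooth_DERIV continuous_at_imp_continuous_on)

lemma borel_measurable_smooth: "smooth f \<Longrightarrow> f \<in> borel_measurable borel"
  by (intro borel_measurable_continuous_onI continuous_on_smooth)

lemma test_function_bounded:
  assumes "test_function \<psi>"
  obtains M where "\<And>x. \<bar>\<psi> x\<bar> \<le> M"
proof -
  obtain R where R: "\<And>x. \<bar>x\<bar> > R \<Longrightarrow> \<psi> x = 0" using assms unfolding test_function_iff by auto
  have "compact (\<psi> ` {-R..R})"
    by (intro compact_continuous_image continuous_on_smooth test_function_smooth assms) auto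
  then obtain M where M: "\<And>x. x \<in> {-R..R} \<Longrightarrow> \<bar>\<psi> x\<bar> \<le> M"
    by (meson bounded_real compact_imp_bounded imageI)
  \<comment> \<open>The maximum with 0 covers negative \<open>R\<close>, for which the interval is
    empty and \<open>M\<close> is unconstrained.\<close>
  have "\<bar>\<psi> x\<bar> \<le> max M 0" for x
    using M[of x] R[of x] by (cases "\<bar>x\<bar> \<le> R") (auto simp: abs_le_iff)
  then show ?thesis using that by blast
qed

lemma integrable_test_function_scaleR:
  assumes \<psi>: "test_function \<psi>" and f: "locally_integrable f"
  shows "integrable lborel (\<lambda>x. \<psi> x *\<^sub>R f x)"
proof -
  obtain R where R: "\<And>x. \<bar>x\<bar> > R \<Longrightarrow> \<psi> x = 0" using \<psi> unfolding test_function_iff by auto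
  obtain M where M: "\<And>x. \<bar>\<psi> x\<bar> \<le> M" using test_function_bounded[OF \<psi>] by blast
  have [measurable]: "\<psi> \<in> borel_measurable borel" "f \<in> borel_measurable borel"
    using borel_measurable_smooth[OF test_function_smooth[OF \<psi>]] f by (auto simp: locally_integrable_def)
  have "integrable lborel (\<lambda>x. M *\<^sub>R (indicator {-R..R} x *\<^sub>R f x))"
    using f by (intro integrable_scaleR_right) (auto simp: locally_integrable_def set_integrable_def)
  moreover have "AE x in lborel. norm (\<psi> x *\<^sub>R f x) \<le> norm (M *\<^sub>R (indicator {-R..R} x *\<^sub>R f x))"
  proof (rule AE_I2)
    fix x
    show "norm (\<psi> x *\<^sub>R f x) \<le> norm (M *\<^sub>R (indicator {-R..R} x *\<^sub>R f x))"
    proof (cases "\<bar>x\<bar> \<le> R")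
      case True
      then have "x \<in> {-R..R}" by auto
      then show ?thesis using M[of x] by (simp add: mult_right_mono)
    qed (simp add: R)
  qed
  moreover have "(\<lambda>x. \<psi> x *\<^sub>R f x) \<in> borel_measurable lborel" by measurable
  ultimately show ?thesis using Bochner_Integration.integrable_bound by blast
qed

section \<open>Hermite coefficients of weakly defined operators\<close>

text \<open>The operator behind \<open>gauss_op\<close>, now on arbitrary test functions. One
  definition serves two purposes: \<open>test_op 1 (- (1 / 2))\<close> is the transpose of the
  lowering operator up to its phase, and the square of \<open>test_op 0 1\<close> is the second
  derivative.\<close>

definition test_op :: "real \<Rightarrow> real \<Rightarrow> (real \<Rightarrow> real) \<Rightarrow> real \<Rightarrow> real" where
  "test_op a b \<psi> x = a * x * \<psi> x + b * deriv \<psi> x"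

lemma test_op_0_1: "test_op 0 1 = deriv"
  by (intro ext) (simp add: test_op_def)

lemma test_function_test_op: "test_function \<psi> \<Longrightarrow> test_function (test_op a b \<psi>)"
  unfolding test_op_def
  using smooth_affine[of a 0]
  by (intro test_function_add test_function_mult_left test_function_deriv) auto

lemma test_function_test_op_power: "test_function \<psi> \<Longrightarrow> test_function ((test_op a b ^^ m) \<psi>)"
  by (induction m) (auto intro: test_function_test_op)

lemma test_op_lincomb:
  assumes "test_function \<phi>" "test_function \<psi>"
  shows "test_op a b (\<lambda>x. \<phi> x + c * \<psi> x) = (\<lambda>x. test_op a b \<phi> x + c * test_op a b \<psi> x)"
proof -
  have "deriv (\<lambda>x. \<phi> x + c * \<psi> x) x = deriv \<phi> x + c * deriv \<psi> x" for x
    using assms[THEN test_function_smooth, THEN smooth_DERIV]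
    by (intro DERIV_imp_deriv DERIV_add DERIV_cmult) auto
  then show ?thesis by (simp add: test_op_def fun_eq_iff algebra_simps)
qed

lemma test_op_power_lincomb:
  assumes "test_function \<phi>" "test_function \<psi>"
  shows "(test_op a b ^^ m) (\<lambda>x. \<phi> x + c * \<psi> x) = (\<lambda>x. (test_op a b ^^ m) \<phi> x + c * (test_op a b ^^ m) \<psi> x)"
  using assms by (induction m) (simp_all add: test_op_lincomb test_function_test_op_power)

text \<open>Leibniz rule: when the derivative falls on the cutoff, it gains a factor
  \<open>1 / R\<close> and replaces \<open>h\<close> by \<open>deriv h\<close>, again a test
  function. The error thus has the same shape as the main term, which makes an induction
  possible.\<close>

lemma test_op_cutoff:
  assumes h: "test_function h" and R: "R > 0"
  shows "test_op a b (\<lambda>x. h (x / R) * gauss_poly p x) =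
    (\<lambda>x. h (x / R) * gauss_poly (gauss_op a b p) x + b / R * (deriv h (x / R) * gauss_poly p x))"
proof -
  have "deriv (\<lambda>x. h (x / R) * gauss_poly p x) x
      = deriv h (x / R) * (1 / R) * gauss_poly p x + gauss_poly (gauss_op 0 1 p) x * h (x / R)" for x
    using R
    by (intro DERIV_imp_deriv DERIV_mult DERIV_chain2[OF smooth_DERIV[OF test_function_smooth[OF h]]]
        has_real_derivative_gauss_poly) (auto intro!: derivative_eq_intros)
  then show ?thesis
    by (simp add: test_op_def gauss_poly_gauss_op[of a b] fun_eq_iff algebra_simps)
qed

lemma test_function_cutoff: "test_function h \<Longrightarrow> R > 0 \<Longrightarrow> test_function (\<lambda>x. h (x / R) * gauss_poly p x)"
  by (intro test_function_mult_right test_function_scale) auto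

text \<open>
  The intermediate functions \<open>\<A>\<^sup>j w\<close> with \<open>0 < j < m\<close> are not assumed square integrable, so the operators are
  moved to the test function all at once, before the cutoff is removed.
\<close>

lemma tendsto_cutoff_integral:
  fixes f :: "real \<Rightarrow> complex"
  assumes h: "test_function h" and loc: "locally_integrable f"
    and int: "\<And>p. integrable lborel (\<lambda>x. gauss_poly p x *\<^sub>R f x)"
  shows "(\<lambda>n. \<integral>x. (test_op a b ^^ m) (\<lambda>x. h (x / real (Suc n)) * gauss_poly p x) x *\<^sub>R f x \<partial>lborel)
    \<longlonglongrightarrow> h 0 *\<^sub>R (\<integral>x. gauss_poly ((gauss_op a b ^^ m) p) x *\<^sub>R f x \<partial>lborel)"
  using h
proof (induction m arbitrary: h p)
  case (0 h p)
  have [measurable]: "h \<in> borel_measurable borel" "f \<in> borel_measurable borel"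
    using borel_measurable_smooth[OF test_function_smooth[OF 0]] loc by (auto simp: locally_integrable_def)
  obtain M where M: "\<And>x. \<bar>h x\<bar> \<le> M" using test_function_bounded[OF 0] by blast
  have "(\<lambda>n. \<integral>x. (h (x / real (Suc n)) * gauss_poly p x) *\<^sub>R f x \<partial>lborel)
      \<longlonglongrightarrow> (\<integral>x. (h 0 * gauss_poly p x) *\<^sub>R f x \<partial>lborel)"
  proof (rule integral_dominated_convergence[where w="\<lambda>x. M * norm (gauss_poly p x *\<^sub>R f x)"])
    show "integrable lborel (\<lambda>x. M * norm (gauss_poly p x *\<^sub>R f x))"
      by (intro integrable_mult_right integrable_norm int)
    have lim: "(\<lambda>n. h (x / real (Suc n))) \<longlonglongrightarrow> h 0" for x
    proof -
      have "(\<lambda>n. x * inverse (real (Suc n))) \<longlonglongrightarrow> x * 0"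
        by (intro tendsto_mult_left LIMSEQ_inverse_real_of_nat)
      then have "(\<lambda>n. x / real (Suc n)) \<longlonglongrightarrow> 0" by (simp add: divide_inverse)
      moreover have "isCont h 0" using smooth_DERIV[OF test_function_smooth[OF 0]] DERIV_isCont by blast
      ultimately show ?thesis using isCont_tendsto_compose by blast
    qed
    have "(\<lambda>n. (h (x / real (Suc n)) * gauss_poly p x) *\<^sub>R f x) \<longlonglongrightarrow> (h 0 * gauss_poly p x) *\<^sub>R f x" for x
      by (intro tendsto_scaleR tendsto_mult tendsto_const lim)
    then show "AE x in lborel. (\<lambda>n. (h (x / real (Suc n)) * gauss_poly p x) *\<^sub>R f x) \<longlonglongrightarrow> (h 0 * gauss_poly p x) *\<^sub>R f x"
      by simp
    show "AE x in lborel. norm ((h (x / real (Suc n)) * gauss_poly p x) *\<^sub>R f x) \<le> M * norm (gauss_poly p x *\<^sub>R f x)" for n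
      using M by (simp add: abs_mult mult_right_mono mult.assoc)
  qed measurable
  then show ?case by (simp flip: scaleR_scaleR)
next
  case (Suc m h p)
  \<comment> \<open>\<open>A\<close> is the part in which the operator reaches the Gaussian
    polynomial, \<open>B\<close> the part in which it differentiates the cutoff. The induction
    hypothesis, being general in the cutoff, applies to both; since \<open>B\<close> converges, its
    factor \<open>b / real (Suc n)\<close> makes it disappear in the limit.\<close>
  define A where "A n = (\<integral>x. (test_op a b ^^ m) (\<lambda>x. h (x / real (Suc n)) * gauss_poly (gauss_op a b p) x) x *\<^sub>R f x \<partial>lborel)" for n
  define B where "B n = (\<integral>x. (test_op a b ^^ m) (\<lambda>x. deriv h (x / real (Suc n)) * gauss_poly p x) x *\<^sub>R f x \<partial>lborel)" for n
  have eq: "(\<integral>x. (test_op a b ^^ Suc m) (\<lambda>x. h (x / real (Suc n)) * gauss_poly p x) x *\<^sub>R f x \<partial>lborel)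
      = A n + (b / real (Suc n)) *\<^sub>R B n" for n
  proof -
    let ?F = "\<lambda>x. h (x / real (Suc n)) * gauss_poly (gauss_op a b p) x"
    let ?G = "\<lambda>x. deriv h (x / real (Suc n)) * gauss_poly p x"
    have F: "test_function ?F" and G: "test_function ?G"
      using Suc.prems test_function_deriv by (auto intro!: test_function_cutoff)
    have "(test_op a b ^^ Suc m) (\<lambda>x. h (x / real (Suc n)) * gauss_poly p x)
        = (test_op a b ^^ m) (\<lambda>x. ?F x + b / real (Suc n) * ?G x)"
      using Suc.prems by (simp only: funpow_Suc_right o_apply test_op_cutoff of_nat_0_less_iff zero_less_Suc)
    also have "\<dots> = (\<lambda>x. (test_op a b ^^ m) ?F x + b / real (Suc n) * (test_op a b ^^ m) ?G x)"
      by (rule test_op_power_lincomb[OF F G])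
    finally have "(\<integral>x. (test_op a b ^^ Suc m) (\<lambda>x. h (x / real (Suc n)) * gauss_poly p x) x *\<^sub>R f x \<partial>lborel)
      = (\<integral>x. (test_op a b ^^ m) ?F x *\<^sub>R f x + (b / real (Suc n)) *\<^sub>R ((test_op a b ^^ m) ?G x *\<^sub>R f x) \<partial>lborel)"
      by (simp only: scaleR_add_left scaleR_scaleR)
    also have "\<dots> = A n + (b / real (Suc n)) *\<^sub>R B n"
      unfolding A_def B_def
      by (subst Bochner_Integration.integral_add)
        (intro integrable_scaleR_right integrable_test_function_scaleR test_function_test_op_power F G loc
          | simp only: integral_scaleR_right)+
    finally show ?thesis .
  qed
  have "A \<longlonglongrightarrow> h 0 *\<^sub>R (\<integral>x. gauss_poly ((gauss_op a b ^^ m) (gauss_op a b p)) x *\<^sub>R f x \<partial>lborel)"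
    unfolding A_def by (rule Suc.IH[OF Suc.prems])
  moreover have "B \<longlonglongrightarrow> deriv h 0 *\<^sub>R (\<integral>x. gauss_poly ((gauss_op a b ^^ m) p) x *\<^sub>R f x \<partial>lborel)"
    unfolding B_def by (rule Suc.IH[OF test_function_deriv[OF Suc.prems]])
  moreover have "(\<lambda>n. b / real (Suc n)) \<longlonglongrightarrow> 0"
    using tendsto_mult_left[OF LIMSEQ_inverse_real_of_nat, of b] by (simp add: divide_inverse)
  ultimately have "(\<lambda>n. A n + (b / real (Suc n)) *\<^sub>R B n) \<longlonglongrightarrow>
      h 0 *\<^sub>R (\<integral>x. gauss_poly ((gauss_op a b ^^ m) (gauss_op a b p)) x *\<^sub>R f x \<partial>lborel)
      + 0 *\<^sub>R (deriv h 0 *\<^sub>R (\<integral>x. gauss_poly ((gauss_op a b ^^ m) p) x *\<^sub>R f x \<partial>lborel))"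
    by (intro tendsto_add tendsto_scaleR)
  then show ?case unfolding eq by (simp add: funpow_swap1)
qed

lemma square_integrable_imp_locally_integrable:
  assumes f: "square_integrable f"
  shows "locally_integrable f"
  unfolding locally_integrable_def
proof (intro conjI allI)
  show [measurable]: "f \<in> borel_measurable lborel" by (rule square_integrableD[OF f])
  fix a b :: real
  have "integrable lborel (\<lambda>x. indicator {a..b} x + (norm (f x))\<^sup>2)"
    using square_integrableD(3)[OF f] by (intro Bochner_Integration.integrable_add integrable_real_indicator)
      (auto simp: emeasure_lborel_Icc_eq)
  moreover have "AE x in lborel. norm (indicator {a..b} x *\<^sub>R f x) \<le> norm (indicator {a..b} x + (norm (f x))\<^sup>2)"
  proof (rule AE_I2)
    fix x
    have "2 * (1 * norm (f x)) \<le> 1 + (norm (f x))\<^sup>2"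
      using two_mult_le_weighted_squares[of 1 1 "norm (f x)"] by simp
    then have "norm (f x) \<le> 1 + (norm (f x))\<^sup>2" using norm_ge_zero[of "f x"] by linarith
    then show "norm (indicator {a..b} x *\<^sub>R f x) \<le> norm (indicator {a..b} x + (norm (f x))\<^sup>2)"
      by (simp add: indicator_def)
  qed
  moreover have "(\<lambda>x. indicator {a..b} x *\<^sub>R f x) \<in> borel_measurable lborel" by measurable
  ultimately show "set_integrable lborel {a..b} f"
    unfolding set_integrable_def using Bochner_Integration.integrable_bound by blast
qed

text \<open>With these values of \<open>Q\<close> and \<open>P\<close> the lowering operator is
  \<open>z\<close> times \<open>\<eta> + \<partial> / 2\<close>. The definition of the weak
  derivative moves it to the test function as \<open>\<eta> - \<partial> / 2\<close>; the pairing is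
  bilinear, so \<open>z\<close> is not conjugated.\<close>

lemma lowering_test_function:
  assumes z: "Q = z / complex_of_real (sqrt 2)" "P = complex_of_real (sqrt 2) * \<i> * z"
    and low: "lowering Q P f g" and g: "g \<in> borel_measurable lborel" and \<psi>: "test_function \<psi>"
  shows "(\<integral>x. \<psi> x *\<^sub>R g x \<partial>lborel) = z * (\<integral>x. test_op 1 (- (1 / 2)) \<psi> x *\<^sub>R f x \<partial>lborel)"
proof -
  obtain f1 where f1: "weak_deriv 1 f f1"
    and geq: "AE x in lborel. g x = of_real (1 / sqrt 2) * (\<i> * Q * (- \<i> * f1 x) - \<i> * P * of_real x * f x)"
    using low unfolding lowering_def by blast
  have loc: "locally_integrable f" "locally_integrable f1" using f1 by (auto simp: weak_deriv_def)
  have [measurable]: "\<psi> \<in> borel_measurable borel" "g \<in> borel_measurable borel"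
    "f \<in> borel_measurable borel" "f1 \<in> borel_measurable borel"
    using borel_measurable_smooth[OF test_function_smooth[OF \<psi>]] loc g by (auto simp: locally_integrable_def)
  have s: "complex_of_real (sqrt 2) * complex_of_real (sqrt 2) = 2"
    by (simp flip: of_real_mult)
  have alg: "of_real (1 / sqrt 2) * (\<i> * Q * (- \<i> * f1 x) - \<i> * P * of_real x * f x)
      = z * (x *\<^sub>R f x + (1 / 2) *\<^sub>R f1 x)" for x
    using s by (simp add: z scaleR_conv_of_real field_simps)
  have i1: "integrable lborel (\<lambda>x. (x * \<psi> x) *\<^sub>R f x)" and i2: "integrable lborel (\<lambda>x. \<psi> x *\<^sub>R f1 x)"
    and i3: "integrable lborel (\<lambda>x. deriv \<psi> x *\<^sub>R f x)"
    using loc \<psi> by (auto intro!: integrable_test_function_scaleR test_function_mult_left test_function_deriv)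
  have "(\<integral>x. \<psi> x *\<^sub>R g x \<partial>lborel) = (\<integral>x. z * ((x * \<psi> x) *\<^sub>R f x + (1 / 2) *\<^sub>R (\<psi> x *\<^sub>R f1 x)) \<partial>lborel)"
  proof (rule integral_cong_AE)
    show "AE x in lborel. \<psi> x *\<^sub>R g x = z * ((x * \<psi> x) *\<^sub>R f x + (1 / 2) *\<^sub>R (\<psi> x *\<^sub>R f1 x))"
      using geq unfolding alg by eventually_elim (simp add: scaleR_conv_of_real algebra_simps)
  qed measurable
  also have "\<dots> = z * ((\<integral>x. (x * \<psi> x) *\<^sub>R f x \<partial>lborel) + (1 / 2) *\<^sub>R (\<integral>x. \<psi> x *\<^sub>R f1 x \<partial>lborel))"
    using i1 i2 by (simp del: scaleR_scaleR)
  also have "(\<integral>x. \<psi> x *\<^sub>R f1 x \<partial>lborel) = - (\<integral>x. deriv \<psi> x *\<^sub>R f x \<partial>lborel)"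
    using f1 \<psi> by (simp add: weak_deriv_def)
  also have "(\<integral>x. (x * \<psi> x) *\<^sub>R f x \<partial>lborel) + (1 / 2) *\<^sub>R (- (\<integral>x. deriv \<psi> x *\<^sub>R f x \<partial>lborel))
      = (\<integral>x. (x * \<psi> x) *\<^sub>R f x + (- (1 / 2)) *\<^sub>R (deriv \<psi> x *\<^sub>R f x) \<partial>lborel)"
    using i1 i3 by (simp del: scaleR_scaleR)
  also have "\<dots> = (\<integral>x. test_op 1 (- (1 / 2)) \<psi> x *\<^sub>R f x \<partial>lborel)"
    by (simp add: test_op_def scaleR_diff_left)
  finally show ?thesis .
qed

text \<open>The intermediate functions only have to be measurable, and this they inherit from being
  weakly differentiable.\<close>

lemma lowering_power_test_function:
  assumes z: "Q = z / complex_of_real (sqrt 2)" "P = complex_of_real (sqrt 2) * \<i> * z"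
  shows "(lowering Q P ^^ m) f g \<Longrightarrow> g \<in> borel_measurable lborel \<Longrightarrow> test_function \<psi> \<Longrightarrow>
    (\<integral>x. \<psi> x *\<^sub>R g x \<partial>lborel) = z ^ m * (\<integral>x. (test_op 1 (- (1 / 2)) ^^ m) \<psi> x *\<^sub>R f x \<partial>lborel)"
proof (induction m arbitrary: g \<psi>)
  case (Suc m)
  obtain u where u: "(lowering Q P ^^ m) f u" "lowering Q P u g"
    using Suc.prems(1) by (auto elim: relpowp_Suc_E)
  have "u \<in> borel_measurable lborel"
    using u(2) by (auto simp: lowering_def weak_deriv_def locally_integrable_def)
  note IH = Suc.IH[OF u(1) this test_function_test_op[OF Suc.prems(3)]]
  show ?case
    unfolding lowering_test_function[OF z u(2) Suc.prems(2,3)] IH by (simp add: funpow_swap1)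
qed simp

lemma up_power_herm: "(up ^^ m) (herm k) = smult (sqrt (fact (k + m) / fact k)) (herm (k + m))"
proof (induction m)
  case (Suc m)
  have "(up ^^ Suc m) (herm k) = smult (sqrt (fact (k + m) / fact k)) (up (herm (k + m)))"
    by (simp add: Suc gauss_op_smult)
  also have "\<dots> = smult (sqrt (fact (k + m) / fact k) * sqrt (real (k + m + 1))) (herm (k + Suc m))"
    unfolding up_herm by simp
  also have "sqrt (fact (k + m) / fact k) * sqrt (real (k + m + 1)) = sqrt (fact (k + Suc m) / fact k)"
    unfolding real_sqrt_mult[symmetric] by (simp add: algebra_simps)
  finally show ?case .
qed simp

lemma herm_coeff_eq: "herm_coeff k f = (\<integral>x. gauss_poly (herm k) x *\<^sub>R f x \<partial>lborel)"
  unfolding herm_coeff_def herm_fun_def[abs_def] by (rule l2_inner_gauss_poly)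

text \<open>The powers are transposed on cut-off Hermite functions, where all integrals exist; then
  the cutoff, normalised by \<open>h 0 = 1\<close>, is removed on both sides, leaving
  \<open>up ^^ m\<close> on \<open>herm k\<close>, a multiple of
  \<open>herm (k + m)\<close>.\<close>

lemma herm_coeff_lowering_power:
  assumes z: "Q = z / complex_of_real (sqrt 2)" "P = complex_of_real (sqrt 2) * \<i> * z"
    and f: "square_integrable f" and g: "square_integrable g" and low: "(lowering Q P ^^ m) f g"
  shows "herm_coeff k g = z ^ m * of_real (sqrt (fact (k + m) / fact k)) * herm_coeff (k + m) f"
proof -
  obtain h where h: "test_function h" "h 0 = 1" using test_function_exists by blast
  let ?\<psi> = "\<lambda>n x. h (x / real (Suc n)) * gauss_poly (herm k) x"
  have "(\<lambda>n. \<integral>x. ?\<psi> n x *\<^sub>R g x \<partial>lborel) \<longlonglongrightarrow> herm_coeff k g"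
    using tendsto_cutoff_integral[OF h(1) square_integrable_imp_locally_integrable[OF g]
        integrable_gauss_poly_scaleR[OF g], where m=0 and p="herm k"]
    by (simp add: h(2) herm_coeff_eq)
  moreover have "(\<lambda>n. \<integral>x. ?\<psi> n x *\<^sub>R g x \<partial>lborel) \<longlonglongrightarrow>
      z ^ m * (h 0 *\<^sub>R (\<integral>x. gauss_poly ((up ^^ m) (herm k)) x *\<^sub>R f x \<partial>lborel))"
    unfolding lowering_power_test_function[OF z low square_integrableD(2)[OF g] test_function_cutoff[OF h(1) of_nat_0_less_iff[THEN iffD2, OF zero_less_Suc]]]
    by (intro tendsto_mult_left tendsto_cutoff_integral[OF h(1)]
        square_integrable_imp_locally_integrable[OF f] integrable_gauss_poly_scaleR[OF f])
  ultimately have "herm_coeff k g = z ^ m * (h 0 *\<^sub>R (\<integral>x. gauss_poly ((up ^^ m) (herm k)) x *\<^sub>R f x \<partial>lborel))"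
    by (rule LIMSEQ_unique)
  also have "\<dots> = z ^ m * of_real (sqrt (fact (k + m) / fact k)) * herm_coeff (k + m) f"
    unfolding up_power_herm gauss_poly_smult scaleR_scaleR[symmetric] integral_scaleR_right herm_coeff_eq[symmetric]
    by (simp add: h(2) scaleR_conv_of_real)
  finally show ?thesis .
qed

text \<open>The quadratic part of the Hamiltonian is \<open>a\<close> times
  \<open>2 up down + 1\<close>, and \<open>up down\<close> is the number operator.\<close>

lemma oscillator_herm:
  "smult (- (a / 2)) (gauss_op 0 1 (gauss_op 0 1 (herm k))) + smult (2 * a) ([:0, 0, 1:] * herm k)
    = smult (a * (2 * real k + 1)) (herm k)"
proof -
  have "poly (smult (- (a / 2)) (gauss_op 0 1 (gauss_op 0 1 p)) + smult (2 * a) ([:0, 0, 1:] * p)) x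
      = poly (smult a (smult 2 (up (down p)) + p)) x" for p x
    by (simp add: gauss_op_def pderiv_add pderiv_diff pderiv_minus pderiv_smult pderiv_mult pderiv_pCons algebra_simps)
  then have *: "smult (- (a / 2)) (gauss_op 0 1 (gauss_op 0 1 p)) + smult (2 * a) ([:0, 0, 1:] * p)
      = smult a (smult 2 (up (down p)) + p)" for p
    by (simp add: poly_eq_poly_eq_iff[symmetric] fun_eq_iff)
  show ?thesis
    unfolding * up_down_herm by (simp add: smult_add_right smult_add_left algebra_simps)
qed

lemma
  fixes u :: "real \<Rightarrow> real"
  assumes u: "u \<in> borel_measurable borel" "\<And>x. \<bar>u x\<bar> \<le> C * \<bar>x\<bar> ^ 3"
  shows cubic_mult_gauss_poly: "square_integrable (\<lambda>x. of_real (u x) * of_real (gauss_poly p x))"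
    and cubic_mult_locally_integrable: "locally_integrable f \<Longrightarrow> locally_integrable (\<lambda>x. of_real (u x) * f x)"
proof -
  note [measurable] = u(1)
  have C: "0 \<le> C" using u(2)[of 1] by simp
  show "square_integrable (\<lambda>x. of_real (u x) * of_real (gauss_poly p x))"
  proof (rule square_integrable_bound[OF square_integrable_gauss_poly[of "[:0, 0, 0, 1:] * p"], where C=C])
    show "norm (complex_of_real (u x) * complex_of_real (gauss_poly p x))
        \<le> C * norm (complex_of_real (gauss_poly ([:0, 0, 0, 1:] * p) x))" for x
    proof -
      have "gauss_poly ([:0, 0, 0, 1:] * p) x = x ^ 3 * gauss_poly p x"
        by (simp add: gauss_poly_def power3_eq_cube)
      then show ?thesis
        using mult_right_mono[OF u(2)[of x], of "\<bar>gauss_poly p x\<bar>"]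
        by (simp only: norm_mult norm_of_real abs_mult power_abs mult.assoc abs_ge_zero simp_thms)
    qed
  qed measurable
  show "locally_integrable (\<lambda>x. of_real (u x) * f x)" if loc: "locally_integrable f"
    unfolding locally_integrable_def
  proof (intro conjI allI)
    have [measurable]: "f \<in> borel_measurable borel" using loc by (simp add: locally_integrable_def)
    show "(\<lambda>x. of_real (u x) * f x) \<in> borel_measurable lborel" by measurable
    fix a b :: real
    define M where "M = max \<bar>a\<bar> \<bar>b\<bar>"
    have "integrable lborel (\<lambda>x. (C * M ^ 3) *\<^sub>R (indicator {a..b} x *\<^sub>R f x))"
      using loc by (intro integrable_scaleR_right) (auto simp: locally_integrable_def set_integrable_def)
    moreover have "AE x in lborel. norm (indicator {a..b} x *\<^sub>R (of_real (u x) * f x))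
        \<le> norm ((C * M ^ 3) *\<^sub>R (indicator {a..b} x *\<^sub>R f x))"
    proof (rule AE_I2)
      fix x
      have "\<bar>u x\<bar> \<le> \<bar>C * M ^ 3\<bar>" if "x \<in> {a..b}"
      proof -
        have "\<bar>x\<bar> \<le> M" using that by (auto simp: M_def)
        then have "C * \<bar>x\<bar> ^ 3 \<le> C * M ^ 3" using C by (intro mult_left_mono power_mono) auto
        then show ?thesis using u(2)[of x] by linarith
      qed
      then show "norm (indicator {a..b} x *\<^sub>R (of_real (u x) * f x))
          \<le> norm ((C * M ^ 3) *\<^sub>R (indicator {a..b} x *\<^sub>R f x))"
        by (auto simp: indicator_def norm_mult abs_mult intro!: mult_right_mono)
    qed
    moreover have "(\<lambda>x. indicator {a..b} x *\<^sub>R (of_real (u x) * f x)) \<in> borel_measurable lborel" by measurable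
    ultimately show "set_integrable lborel {a..b} (\<lambda>x. of_real (u x) * f x)"
      unfolding set_integrable_def using Bochner_Integration.integrable_bound by blast
  qed
qed

text \<open>Only the sum \<open>g\<close> is assumed square integrable, not its three terms. Each
  term is therefore tested on a cut-off Hermite function and passed to the limit separately; in the
  limit all derivatives and multiplications sit on \<open>herm k\<close>, where the quadratic part
  acts by its eigenvalue.\<close>

lemma herm_coeff_oscillator:
  fixes u :: "real \<Rightarrow> real"
  assumes f: "square_integrable f" and g: "square_integrable g" and f2: "weak_deriv 2 f f2"
    and u: "u \<in> borel_measurable borel" "\<And>x. \<bar>u x\<bar> \<le> C * \<bar>x\<bar> ^ 3"
    and eq: "AE x in lborel. g x = - of_real (1/2 * a) * f2 x + of_real (2 * a * x\<^sup>2) * f x + of_real (u x) * f x"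
  shows "herm_coeff k g = of_real (a * (2 * real k + 1)) * herm_coeff k f
      + l2_inner (\<lambda>x. of_real (u x) * herm_fun k x) f"
proof -
  obtain h where h: "test_function h" "h 0 = 1" using test_function_exists by blast
  define \<psi> where "\<psi> n x = h (x / real (Suc n)) * gauss_poly (herm k) x" for n x
  have \<psi>: "test_function (\<psi> n)" for n unfolding \<psi>_def by (intro test_function_cutoff h) simp
  have x2\<psi>: "x\<^sup>2 * \<psi> n x = h (x / real (Suc n)) * gauss_poly ([:0, 0, 1:] * herm k) x" for n x
    by (simp add: \<psi>_def gauss_poly_def power2_eq_square)
  have loc: "locally_integrable f" "locally_integrable f2" "locally_integrable g"
    using f2 square_integrable_imp_locally_integrable[OF g] by (auto simp: weak_deriv_def)
  have locu: "locally_integrable (\<lambda>x. of_real (u x) * f x)"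
    by (rule cubic_mult_locally_integrable[OF u loc(1)])
  note [measurable] = u(1)
  have [measurable]: "\<psi> n \<in> borel_measurable borel" "f \<in> borel_measurable borel"
    "f2 \<in> borel_measurable borel" "g \<in> borel_measurable borel" for n
    using borel_measurable_smooth[OF test_function_smooth[OF \<psi>]] loc by (auto simp: locally_integrable_def)
  have intu: "integrable lborel (\<lambda>x. gauss_poly p x *\<^sub>R (of_real (u x) * f x))" for p
    using integrable_cnj_mult[OF cubic_mult_gauss_poly[OF u, of p] f]
    by (simp add: scaleR_conv_of_real mult_ac)
  have "(\<integral>x. \<psi> n x *\<^sub>R g x \<partial>lborel) = (- (a / 2)) *\<^sub>R (\<integral>x. (test_op 0 1 ^^ 2) (\<psi> n) x *\<^sub>R f x \<partial>lborel)
      + (2 * a) *\<^sub>R (\<integral>x. (x\<^sup>2 * \<psi> n x) *\<^sub>R f x \<partial>lborel) + (\<integral>x. \<psi> n x *\<^sub>R (of_real (u x) * f x) \<partial>lborel)" for n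
  proof -
    have "smooth (\<lambda>x. x\<^sup>2)" unfolding power2_eq_square by (intro smooth_mult smooth_ident)
    then have i: "integrable lborel (\<lambda>x. \<psi> n x *\<^sub>R f2 x)" "integrable lborel (\<lambda>x. (x\<^sup>2 * \<psi> n x) *\<^sub>R f x)"
      "integrable lborel (\<lambda>x. \<psi> n x *\<^sub>R (of_real (u x) * f x))"
      using loc locu \<psi> by (auto intro!: integrable_test_function_scaleR test_function_mult_left)
    have "(\<integral>x. \<psi> n x *\<^sub>R g x \<partial>lborel) = (\<integral>x. (- (a / 2)) *\<^sub>R (\<psi> n x *\<^sub>R f2 x)
        + (2 * a) *\<^sub>R ((x\<^sup>2 * \<psi> n x) *\<^sub>R f x) + \<psi> n x *\<^sub>R (of_real (u x) * f x) \<partial>lborel)"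
    proof (rule integral_cong_AE)
      show "AE x in lborel. \<psi> n x *\<^sub>R g x = (- (a / 2)) *\<^sub>R (\<psi> n x *\<^sub>R f2 x)
        + (2 * a) *\<^sub>R ((x\<^sup>2 * \<psi> n x) *\<^sub>R f x) + \<psi> n x *\<^sub>R (of_real (u x) * f x)"
        using eq by eventually_elim (simp only: scaleR_conv_of_real, simp add: algebra_simps)
    qed measurable
    also have "\<dots> = (- (a / 2)) *\<^sub>R (\<integral>x. \<psi> n x *\<^sub>R f2 x \<partial>lborel)
      + (2 * a) *\<^sub>R (\<integral>x. (x\<^sup>2 * \<psi> n x) *\<^sub>R f x \<partial>lborel) + (\<integral>x. \<psi> n x *\<^sub>R (of_real (u x) * f x) \<partial>lborel)"
      using i by (simp del: scaleR_scaleR)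
    also have "(\<integral>x. \<psi> n x *\<^sub>R f2 x \<partial>lborel) = (\<integral>x. (test_op 0 1 ^^ 2) (\<psi> n) x *\<^sub>R f x \<partial>lborel)"
      using f2 \<psi>[of n] unfolding test_op_0_1 by (simp add: weak_deriv_def)
    finally show ?thesis .
  qed
  moreover have "(\<lambda>n. (- (a / 2)) *\<^sub>R (\<integral>x. (test_op 0 1 ^^ 2) (\<psi> n) x *\<^sub>R f x \<partial>lborel)
      + (2 * a) *\<^sub>R (\<integral>x. (x\<^sup>2 * \<psi> n x) *\<^sub>R f x \<partial>lborel) + (\<integral>x. \<psi> n x *\<^sub>R (of_real (u x) * f x) \<partial>lborel))
    \<longlonglongrightarrow> (- (a / 2)) *\<^sub>R (h 0 *\<^sub>R (\<integral>x. gauss_poly ((gauss_op 0 1 ^^ 2) (herm k)) x *\<^sub>R f x \<partial>lborel))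
      + (2 * a) *\<^sub>R (h 0 *\<^sub>R (\<integral>x. gauss_poly ([:0, 0, 1:] * herm k) x *\<^sub>R f x \<partial>lborel))
      + h 0 *\<^sub>R (\<integral>x. gauss_poly (herm k) x *\<^sub>R (of_real (u x) * f x) \<partial>lborel)"
    unfolding x2\<psi>
    using tendsto_cutoff_integral[OF h(1) loc(1) integrable_gauss_poly_scaleR[OF f], where m=2 and a=0 and b=1 and p="herm k"]
      tendsto_cutoff_integral[OF h(1) loc(1) integrable_gauss_poly_scaleR[OF f], where m=0 and p="[:0, 0, 1:] * herm k"]
      tendsto_cutoff_integral[OF h(1) locu intu, where m=0 and p="herm k"]
    by (intro tendsto_intros) (simp_all add: \<psi>_def[abs_def] funpow_0)
  moreover have "(\<lambda>n. \<integral>x. \<psi> n x *\<^sub>R g x \<partial>lborel) \<longlonglongrightarrow> herm_coeff k g"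
    using tendsto_cutoff_integral[OF h(1) loc(3)
        integrable_gauss_poly_scaleR[OF g], where m=0 and p="herm k"]
    by (simp add: h(2) herm_coeff_eq \<psi>_def)
  ultimately have "herm_coeff k g = (- (a / 2)) *\<^sub>R (h 0 *\<^sub>R (\<integral>x. gauss_poly ((gauss_op 0 1 ^^ 2) (herm k)) x *\<^sub>R f x \<partial>lborel))
      + (2 * a) *\<^sub>R (h 0 *\<^sub>R (\<integral>x. gauss_poly ([:0, 0, 1:] * herm k) x *\<^sub>R f x \<partial>lborel))
      + h 0 *\<^sub>R (\<integral>x. gauss_poly (herm k) x *\<^sub>R (of_real (u x) * f x) \<partial>lborel)"
    using LIMSEQ_unique by (simp only:)
  also have "\<dots> = (\<integral>x. gauss_poly (smult (- (a / 2)) (gauss_op 0 1 (gauss_op 0 1 (herm k))) + smult (2 * a) ([:0, 0, 1:] * herm k)) x *\<^sub>R f x \<partial>lborel)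
      + (\<integral>x. gauss_poly (herm k) x *\<^sub>R (of_real (u x) * f x) \<partial>lborel)"
    unfolding gauss_poly_add gauss_poly_smult scaleR_add_left scaleR_scaleR[symmetric]
    using integrable_gauss_poly_scaleR[OF f]
    by (subst Bochner_Integration.integral_add) (simp_all add: h(2) numeral_2_eq_2 del: scaleR_scaleR)
  also have "\<dots> = of_real (a * (2 * real k + 1)) * herm_coeff k f + (\<integral>x. gauss_poly (herm k) x *\<^sub>R (of_real (u x) * f x) \<partial>lborel)"
    unfolding oscillator_herm gauss_poly_smult herm_coeff_eq scaleR_scaleR[symmetric] integral_scaleR_right
    by (simp add: scaleR_conv_of_real)
  also have "(\<integral>x. gauss_poly (herm k) x *\<^sub>R (of_real (u x) * f x) \<partial>lborel) = l2_inner (\<lambda>x. of_real (u x) * herm_fun k x) f"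
    unfolding l2_inner_def herm_fun_def by (intro Bochner_Integration.integral_cong) (auto simp: scaleR_conv_of_real mult_ac)
  finally show ?thesis .
qed

section \<open>Wave packets and parameters\<close>

definition phase :: "(real \<Rightarrow> complex) \<Rightarrow> real \<Rightarrow> complex" where
  "phase \<alpha> t = exp (2 * \<i> * of_real (integral {0..t} (\<lambda>s. Im (\<alpha> s))))"

lemma norm_phase [simp]: "norm (phase \<alpha> t) = 1"
  by (simp add: phase_def norm_exp_eq_Re)

lemma Qh_phase: "Qh \<alpha> t = phase \<alpha> t / complex_of_real (sqrt 2)"
  and Ph_phase: "Ph \<alpha> t = complex_of_real (sqrt 2) * \<i> * phase \<alpha> t"
  by (simp_all add: Qh_def Ph_def phase_def)

text \<open>The raising operator is \<open>cnj z\<close> times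
  \<open>\<eta> - \<partial> / 2\<close>, which acts on Gaussian polynomials as
  \<open>up\<close>.\<close>

lemma raising_herm_fun:
  assumes z: "Q = z / complex_of_real (sqrt 2)" "P = complex_of_real (sqrt 2) * \<i> * z"
  shows "raising Q P (\<lambda>x. c * herm_fun k x) x
    = cnj z * c * of_real (sqrt (real (k + 1))) * herm_fun (Suc k) x"
proof -
  let ?G = "gauss_poly (herm k)" and ?G' = "gauss_poly (gauss_op 0 1 (herm k))"
  have "((\<lambda>x. c * complex_of_real (?G x)) has_vector_derivative c * complex_of_real (?G' x)) (at x)"
    using has_real_derivative_gauss_poly[of "herm k" x]
    by (intro has_vector_derivative_mult_right has_vector_derivative_of_real)
       (simp add: has_real_derivative_iff_has_vector_derivative)
  then have d: "vector_derivative (\<lambda>x. c * herm_fun k x) (at x) = c * complex_of_real (?G' x)"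
    unfolding herm_fun_def by (rule vector_derivative_at)
  define w where "w = complex_of_real (sqrt 2)"
  have w: "w \<noteq> 0" "w * w = 2" "cnj w = w" "complex_of_real (1 / sqrt 2) = 1 / w"
    by (simp_all add: w_def flip: of_real_mult)
  have "raising Q P (\<lambda>x. c * herm_fun k x) x
      = 1 / w * (- \<i> * cnj (z / w) * (- \<i> * (c * ?G' x)) + \<i> * cnj (w * \<i> * z) * x * (c * ?G x))"
    unfolding raising_def d w(4) z w_def[symmetric] by (simp add: herm_fun_def)
  also have "\<dots> = cnj z * c * complex_of_real (x * ?G x - ?G' x / 2)"
    using w by (simp add: field_simps)
  also have "x * ?G x - ?G' x / 2 = gauss_poly (up (herm k)) x"
    by (simp add: gauss_poly_gauss_op[of 1])
  also have "\<dots> = sqrt (real (k + 1)) * gauss_poly (herm (Suc k)) x"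
    unfolding up_herm gauss_poly_smult ..
  finally show ?thesis by (simp add: herm_fun_def del: herm.simps)
qed

text \<open>Since \<open>Q\<close> has modulus \<open>1 / sqrt 2\<close>, the root \<open>r\<close>
  has modulus equal to the fourth root of 2, and dividing by it gives the unimodular
  \<open>\<rho>\<close>. In the exponent \<open>z\<close> cancels, leaving
  \<open>exp (- x\<^sup>2)\<close>, and each raising step contributes one factor
  \<open>cnj z\<close>.\<close>

lemma hagedorn_herm_fun:
  assumes z: "Q = z / complex_of_real (sqrt 2)" "P = complex_of_real (sqrt 2) * \<i> * z" "norm z = 1"
    and r: "r\<^sup>2 = inverse Q"
  obtains \<rho> where "norm \<rho> = 1" "\<And>k x. hagedorn Q P r k x = \<rho> * cnj z ^ k * herm_fun k x"
proof -
  define \<rho> where "\<rho> = r / complex_of_real (sqrt (sqrt 2))"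
  have z0: "z \<noteq> 0" using z(3) by auto
  have "(norm r)\<^sup>2 = sqrt 2" using z unfolding norm_power[symmetric] r by (simp add: norm_inverse norm_divide)
  then have "norm r = sqrt (sqrt 2)" using real_sqrt_unique by fastforce
  then have "norm \<rho> = 1" by (simp add: \<rho>_def norm_divide)
  moreover have "hagedorn Q P r k = (\<lambda>x. \<rho> * cnj z ^ k * herm_fun k x)" for k
  proof (induction k)
    case 0
    have s: "complex_of_real (sqrt 2) * complex_of_real (sqrt 2) = 2"
      by (simp flip: of_real_mult)
    have PQ: "\<i> / 2 * P * inverse Q = - 1" using z0 s by (simp add: z(1,2) field_simps)
    have "pi powr (- 1 / 4) * sqrt (sqrt 2) = sqrt (sqrt (2 / pi))"
    proof -
      have "pi powr (- 1 / 4) = inverse (sqrt (sqrt pi))"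
        by (simp add: powr_half_sqrt[symmetric] powr_powr powr_minus[symmetric])
      moreover have "sqrt (sqrt (2 / pi)) = sqrt (sqrt 2) / sqrt (sqrt pi)"
        by (simp only: real_sqrt_divide)
      ultimately show ?thesis by (simp only: divide_inverse mult.commute)
    qed
    moreover have "r = \<rho> * complex_of_real (sqrt (sqrt 2))" by (simp add: \<rho>_def)
    ultimately have pr: "complex_of_real (pi powr (- 1 / 4)) * r = \<rho> * complex_of_real (sqrt (sqrt (2 / pi)))"
      by (simp only: mult_ac flip: of_real_mult)
    have "exp (\<i> / 2 * P * inverse Q * complex_of_real (x\<^sup>2)) = complex_of_real (exp (- x\<^sup>2))" for x
      unfolding PQ by (simp flip: exp_of_real)
    then show ?case
      unfolding hagedorn.simps pr by (simp add: fun_eq_iff herm_fun_def gauss_poly_def)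
  next
    case (Suc k)
    show ?case
      unfolding hagedorn.simps Suc.IH raising_herm_fun[OF z(1,2)]
      by (simp add: fun_eq_iff field_simps flip: of_real_mult)
  qed
  ultimately show ?thesis using that[of \<rho>] by simp
qed

lemma hagedorn_span_eq:
  assumes r: "inv_sqrt_branch (Qh \<alpha>) T r" and t: "t \<in> {0..T}"
  shows "hagedorn_span \<alpha> r N t = {(\<lambda>x. \<Sum>k\<le>N. c k * herm_fun k x) | c. True}"
proof -
  have "(r t)\<^sup>2 = inverse (Qh \<alpha> t)" using r t by (simp add: inv_sqrt_branch_def)
  then obtain \<rho> where \<rho>: "norm \<rho> = 1"
      "\<And>k x. hagedorn (Qh \<alpha> t) (Ph \<alpha> t) (r t) k x = \<rho> * cnj (phase \<alpha> t) ^ k * herm_fun k x"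
    using hagedorn_herm_fun[OF Qh_phase Ph_phase norm_phase] by blast
  define e where "e k = \<rho> * cnj (phase \<alpha> t) ^ k" for k
  have e: "e k \<noteq> 0" for k using \<rho>(1) norm_phase[of \<alpha> t]
    by (metis complex_cnj_zero_iff e_def mult_eq_0_iff norm_zero power_not_zero zero_neq_one)
  have "\<exists>c'. (\<lambda>x. \<Sum>k\<le>N. c k * herm_fun k x) = (\<lambda>x. \<Sum>k\<le>N. c' k * (e k * herm_fun k x))" for c
    by (rule exI[of _ "\<lambda>k. c k / e k"]) (simp add: e)
  moreover have "\<exists>c'. (\<lambda>x. \<Sum>k\<le>N. c k * (e k * herm_fun k x)) = (\<lambda>x. \<Sum>k\<le>N. c' k * herm_fun k x)" for c
    by (rule exI[of _ "\<lambda>k. c k * e k"]) (simp add: mult.assoc)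
  ultimately show ?thesis
    unfolding hagedorn_span_def \<rho>(2) e_def[symmetric] by auto
qed

text \<open>The projection is a definite description, so existence and uniqueness both enter:
  orthogonality of the remainder to each \<open>herm_fun k\<close> with \<open>k \<le> N\<close>
  forces the coefficients.\<close>

lemma Proj_eq:
  assumes r: "inv_sqrt_branch (Qh \<alpha>) T r" and t: "t \<in> {0..T}" and f: "square_integrable f"
  shows "Proj \<alpha> r N t f = (\<lambda>x. \<Sum>k\<le>N. herm_coeff k f * herm_fun k x)"
  unfolding Proj_def orth_proj_def hagedorn_span_eq[OF r t]
proof (rule the_equality, intro conjI ballI)
  let ?g = "\<lambda>x. \<Sum>k\<le>N. herm_coeff k f * herm_fun k x"
  show "?g \<in> {\<lambda>x. \<Sum>k\<le>N. c k * herm_fun k x |c. True}"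
    by (rule CollectI, rule exI[of _ "\<lambda>k. herm_coeff k f"]) simp
  have coeff: "herm_coeff k (\<lambda>x. f x - (\<Sum>k\<le>N. c k * herm_fun k x)) = herm_coeff k f - c k" if "k \<le> N" for k c
    using that f herm_coeff_sum[of "{..N}" k c] by (simp add: herm_coeff_def l2_inner_diff_right)
  show "l2_inner h (\<lambda>x. f x - ?g x) = 0" if "h \<in> {\<lambda>x. \<Sum>k\<le>N. c k * herm_fun k x |c. True}" for h
    using that f by (auto simp: l2_inner_herm_sum_left square_integrable_diff coeff)
  fix g assume g: "g \<in> {\<lambda>x. \<Sum>k\<le>N. c k * herm_fun k x |c. True} \<and>
      (\<forall>h\<in>{\<lambda>x. \<Sum>k\<le>N. c k * herm_fun k x |c. True}. l2_inner h (\<lambda>x. f x - g x) = 0)"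
  then obtain c where c: "g = (\<lambda>x. \<Sum>k\<le>N. c k * herm_fun k x)" by auto
  have "c k = herm_coeff k f" if "k \<le> N" for k
  proof -
    have "herm_fun k = (\<lambda>x. \<Sum>j\<le>N. (if j = k then 1 else 0) * herm_fun j x)"
      using that by (simp add: fun_eq_iff if_distrib[of "\<lambda>c. c * _"] cong: if_cong)
    then have ex: "\<exists>c. herm_fun k = (\<lambda>x. \<Sum>j\<le>N. c j * herm_fun j x) \<and> True"
      by (intro exI[of _ "\<lambda>j. if j = k then 1 else 0"] conjI TrueI)
    have "herm_fun k \<in> {\<lambda>x. \<Sum>k\<le>N. c k * herm_fun k x |c. True}"
      by (rule CollectI, rule ex)
    then have "l2_inner (herm_fun k) (\<lambda>x. f x - g x) = 0" using g by blast
    then show ?thesis using coeff[OF that, of c] by (simp add: c herm_coeff_def)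
  qed
  then show "g = ?g" unfolding c by (intro ext sum.cong) auto
qed

text \<open>Integrating factors: with \<open>A\<close> the integral of \<open>Re \<alpha>\<close>,
  both \<open>B exp (2 A)\<close> and \<open>Im \<alpha> exp (4 A)\<close> are constant. The real
  potential term drops out of the equation for \<open>Im \<alpha>\<close>, and the initial values
  make the second constant the square of the first.\<close>

lemma parameter_flow_width:
  assumes flow: "parameter_flow V T q p \<alpha> B" and t: "t \<in> {0..T}"
  shows "B t > 0" "Im (\<alpha> t) = (B t)\<^sup>2"
proof -
  have T: "0 \<in> {0..T}" using t by auto
  have dB: "(B has_vector_derivative - 2 * B s * Re (\<alpha> s)) (at s within {0..T})"
    and d\<alpha>: "(\<alpha> has_vector_derivative - 2 * (\<alpha> s)\<^sup>2 - of_real (1/2 * (deriv ^^ 2) V (q s))) (at s within {0..T})"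
    if "s \<in> {0..T}" for s using flow that unfolding parameter_flow_def by auto
  have "continuous_on {0..T} \<alpha>"
    unfolding continuous_on_eq_continuous_within
    by (intro ballI has_vector_derivative_continuous[OF d\<alpha>])
  then have cont: "continuous_on {0..T} (\<lambda>s. Re (\<alpha> s))" by (intro continuous_intros)
  define A where "A s = integral {0..s} (\<lambda>s. Re (\<alpha> s))" for s
  have dA: "(A has_real_derivative Re (\<alpha> s)) (at s within {0..T})" if "s \<in> {0..T}" for s
    unfolding A_def using integral_has_real_derivative[OF cont that] .
  define I where "I s = Im (\<alpha> s)" for s
  have dI: "(I has_real_derivative - (4 * (I s * Re (\<alpha> s)))) (at s within {0..T})" if "s \<in> {0..T}" for s
    using bounded_linear.has_vector_derivative[OF bounded_linear_Im d\<alpha>[OF that]]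
    by (simp add: has_real_derivative_iff_has_vector_derivative power2_eq_square I_def[abs_def])
  have dB': "(B has_real_derivative - 2 * B s * Re (\<alpha> s)) (at s within {0..T})" if "s \<in> {0..T}" for s
    using dB[OF that] by (simp add: has_real_derivative_iff_has_vector_derivative)
  have "\<exists>K. \<forall>s\<in>{0..T}. B s * exp (2 * A s) = K"
    by (rule has_field_derivative_zero_constant)
      (auto intro!: derivative_eq_intros dB' dA)
  then obtain K where K: "\<And>s. s \<in> {0..T} \<Longrightarrow> B s * exp (2 * A s) = K" by blast
  have "\<exists>K. \<forall>s\<in>{0..T}. I s * exp (4 * A s) = K"
    by (rule has_field_derivative_zero_constant)
      (auto intro!: derivative_eq_intros dI dA)
  then obtain L where L: "\<And>s. s \<in> {0..T} \<Longrightarrow> Im (\<alpha> s) * exp (4 * A s) = L"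
    unfolding I_def by blast
  have A0: "A 0 = 0" by (simp add: A_def)
  have init: "Im (\<alpha> 0) > 0" "B 0 = sqrt (Im (\<alpha> 0))" using flow by (auto simp: parameter_flow_def)
  have "K = sqrt (Im (\<alpha> 0))" using K[OF T] A0 init(2) by simp
  moreover have "L = Im (\<alpha> 0)" using L[OF T] A0 by simp
  ultimately have KL: "K > 0" "L = K\<^sup>2" using init(1) by simp_all
  show "B t > 0" using K[OF t] KL(1) by (metis exp_gt_zero zero_less_mult_pos2)
  have "Im (\<alpha> t) * exp (4 * A t) = (B t * exp (2 * A t))\<^sup>2" using L[OF t] K[OF t] KL by simp
  also have "\<dots> = (B t)\<^sup>2 * exp (4 * A t)" by (simp add: power_mult_distrib flip: exp_double)
  finally show "Im (\<alpha> t) = (B t)\<^sup>2" by simp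
qed

text \<open>By continuity on a compact interval the infimum is attained, so it inherits positivity
  from the pointwise statement.\<close>

lemma parameter_flow_Inf_width:
  assumes flow: "parameter_flow V T q p \<alpha> B" and t: "t \<in> {0..T}"
  shows "0 < (INF s\<in>{0..T}. Im (\<alpha> s))" "(INF s\<in>{0..T}. Im (\<alpha> s)) \<le> Im (\<alpha> t)"
proof -
  have "continuous (at s within {0..T}) \<alpha>" if "s \<in> {0..T}" for s
    using flow that unfolding parameter_flow_def by (meson has_vector_derivative_continuous)
  then have "continuous_on {0..T} (\<lambda>s. Im (\<alpha> s))"
    by (intro continuous_intros) (auto simp: continuous_on_eq_continuous_within)
  then obtain u where u: "u \<in> {0..T}" "\<And>s. s \<in> {0..T} \<Longrightarrow> Im (\<alpha> u) \<le> Im (\<alpha> s)"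
    using continuous_attains_inf[of "{0..T}" "\<lambda>s. Im (\<alpha> s)"] t by auto
  then have eq: "(INF s\<in>{0..T}. Im (\<alpha> s)) = Im (\<alpha> u)"
    by (intro cInf_eq_minimum) auto
  show "(INF s\<in>{0..T}. Im (\<alpha> s)) \<le> Im (\<alpha> t)" unfolding eq by (rule u(2)[OF t])
  show "0 < (INF s\<in>{0..T}. Im (\<alpha> s))"
    unfolding eq parameter_flow_width(2)[OF flow u(1)] using parameter_flow_width(1)[OF flow u(1)] by simp
qed

text \<open>By continuity the set where the bound holds is closed; having full measure, it is the
  whole line.\<close>

lemma essentially_bounded_continuous:
  assumes "essentially_bounded f" "continuous_on UNIV f"
  obtains M where "M \<ge> 0" "\<And>x. \<bar>f x\<bar> \<le> M"
proof -
  obtain C where C: "AE x in lborel. \<bar>f x\<bar> \<le> C" using assms(1) unfolding essentially_bounded_def by blast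
  have "closed {x. \<bar>f x\<bar> \<le> C}"
    by (intro closed_Collect_le continuous_intros assms(2))
  moreover have "AE x in lebesgue. x \<in> {x. \<bar>f x\<bar> \<le> C}"
    using C by (simp add: AE_completion)
  ultimately have "\<bar>f x\<bar> \<le> C" for x using mem_closed_if_AE_lebesgue by blast
  then have "\<bar>f x\<bar> \<le> max C 0" for x by (simp add: max.coboundedI1)
  then show ?thesis using that by (metis max.cobounded2)
qed

lemma C3_potential_DERIV:
  assumes "C3_potential V" "k < 3"
  shows "((deriv ^^ k) V has_real_derivative (deriv ^^ Suc k) V x) (at x)"
  using assms unfolding C3_potential_def by (simp add: DERIV_deriv_iff_real_differentiable)

text \<open>\<open>U_pot\<close> is exactly the third-order Taylor remainder of \<open>V\<close> at
  \<open>q\<close> with increment \<open>h\<close>, and the power of \<open>\<epsilon>\<close> in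
  front cancels the one in \<open>h ^ 3\<close>. Hence the bound is uniform in
  \<open>\<epsilon>\<close> and \<open>q\<close>.\<close>

lemma U_pot_bound:
  assumes V: "C3_potential V" and M: "\<And>x. \<bar>(deriv ^^ 3) V x\<bar> \<le> M" and \<epsilon>: "\<epsilon> > 0" and b: "b > 0"
  shows "\<bar>U_pot \<epsilon> V q b \<eta>\<bar> \<le> M / 6 / b ^ 3 * \<bar>\<eta>\<bar> ^ 3"
proof -
  define h where "h = sqrt \<epsilon> * inverse b * \<eta>"
  obtain y where y: "V (q + h) = (\<Sum>m<3. (deriv ^^ m) V (q + 0) / fact m * h ^ m) + (deriv ^^ 3) V (q + y) / fact 3 * h ^ 3"
  proof -
    have "\<forall>m t. m < 3 \<and> \<bar>t\<bar> \<le> \<bar>h\<bar> \<longrightarrow> ((\<lambda>t. (deriv ^^ m) V (q + t)) has_real_derivative (deriv ^^ Suc m) V (q + t)) (at t)"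
    proof (intro allI impI)
      fix m :: nat and t :: real
      assume m: "m < 3 \<and> \<bar>t\<bar> \<le> \<bar>h\<bar>"
      have "((\<lambda>t. (deriv ^^ m) V (q + t)) has_real_derivative (deriv ^^ Suc m) V (q + t) * 1) (at t)"
        by (rule DERIV_chain2[OF C3_potential_DERIV[OF V]]) (use m in \<open>auto intro!: derivative_eq_intros\<close>)
      then show "((\<lambda>t. (deriv ^^ m) V (q + t)) has_real_derivative (deriv ^^ Suc m) V (q + t)) (at t)"
        by (simp only: mult_1_right)
    qed
    from Maclaurin_bi_le[of "\<lambda>m t. (deriv ^^ m) V (q + t)" "\<lambda>t. V (q + t)" 3 h, OF _ this]
    show ?thesis using that by auto
  qed
  have h2: "h\<^sup>2 = \<epsilon> * (inverse b)\<^sup>2 * \<eta>\<^sup>2" using \<epsilon> by (simp add: h_def power_mult_distrib)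
  have U: "U_pot \<epsilon> V q b \<eta> = \<epsilon> powr (-3/2) * ((deriv ^^ 3) V (q + y) / 6 * h ^ 3)"
  proof -
    have "V (q + sqrt \<epsilon> * inverse b * \<eta>) - V q - sqrt \<epsilon> * deriv V q * inverse b * \<eta>
        - \<epsilon> / 2 * (deriv ^^ 2) V q * (inverse b)\<^sup>2 * \<eta>\<^sup>2 = V (q + h) - V q - deriv V q * h - (deriv ^^ 2) V q / 2 * h\<^sup>2"
      unfolding h2 by (simp add: h_def mult_ac)
    also have "\<dots> = (deriv ^^ 3) V (q + y) / 6 * h ^ 3"
      unfolding y by (simp add: numeral_3_eq_3 numeral_2_eq_2)
    finally show ?thesis unfolding U_pot_def by simp
  qed
  have "\<epsilon> powr (-3/2) * \<bar>h\<bar> ^ 3 = \<bar>\<eta>\<bar> ^ 3 / b ^ 3"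
  proof -
    have "(sqrt \<epsilon>) ^ 3 = \<epsilon> powr (3/2)"
      using \<epsilon> by (simp add: powr_half_sqrt[symmetric] powr_power)
    then show ?thesis using \<epsilon> b
      by (simp add: h_def abs_mult power_mult_distrib powr_minus field_simps)
  qed
  moreover have "\<bar>U_pot \<epsilon> V q b \<eta>\<bar> = \<bar>(deriv ^^ 3) V (q + y)\<bar> / 6 * (\<epsilon> powr (-3/2) * \<bar>h\<bar> ^ 3)"
    unfolding U by (simp add: abs_mult power_abs)
  ultimately have "\<bar>U_pot \<epsilon> V q b \<eta>\<bar> = \<bar>(deriv ^^ 3) V (q + y)\<bar> / 6 * (\<bar>\<eta>\<bar> ^ 3 / b ^ 3)"
    by simp
  also have "\<dots> \<le> M / 6 * (\<bar>\<eta>\<bar> ^ 3 / b ^ 3)"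
    using b M by (intro mult_right_mono divide_right_mono) auto
  finally show ?thesis by simp
qed

lemma borel_measurable_U_pot:
  assumes "C3_potential V"
  shows "U_pot \<epsilon> V q b \<in> borel_measurable borel"
proof -
  have "isCont V x" for x using C3_potential_DERIV[OF assms, of 0 x] DERIV_isCont by force
  then have [measurable]: "V \<in> borel_measurable borel"
    by (intro borel_measurable_continuous_onI continuous_at_imp_continuous_on) auto
  show ?thesis unfolding U_pot_def by measurable
qed

section \<open>The tail of the Hermite expansion\<close>

text \<open>Raising \<open>k\<close> by one multiplies the ratio by
  \<open>(k + 1 - m) / (k + 1 - d)\<close>, at most 1. The case \<open>d = 0\<close> serves the norm
  of the tail, \<open>d = 3\<close> the tail with cubic weight.\<close>

lemma fact_ratio_mono:
  assumes "d \<le> m" "m \<le> n" "n \<le> k"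
  shows "fact (k - m) / fact (k - d) \<le> (fact (n - m) / fact (n - d) :: real)"
  using assms(3)
proof (induction k rule: dec_induct)
  case (step k)
  have "fact (Suc k - m) / fact (Suc k - d) = (fact (k - m) / fact (k - d) :: real) * (real (Suc k - m) / real (Suc k - d))"
    using step assms by (simp add: Suc_diff_le mult.commute)
  also have "\<dots> \<le> (fact (k - m) / fact (k - d)) * 1"
    using step assms by (intro mult_left_mono) (auto simp: divide_le_eq_1)
  finally show ?case using step by simp
qed simp

text \<open>The factor 20 is attained at \<open>k = 3\<close>, where
  \<open>4 * 5 * 6 = 20 * (3 * 2 * 1)\<close>.\<close>

lemma cubic_fact_bound:
  assumes "3 \<le> m" "m \<le> k"
  shows "real ((k + 1) * (k + 2) * (k + 3)) * (fact (k - m) / fact k) \<le> 20 * (fact (k - m) / fact (k - 3))"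
proof -
  obtain j where j: "k = j + 3" using assms by (metis le_add_diff_inverse2 le_trans)
  define P where "P = real ((j + 3) * (j + 2) * (j + 1))"
  have P: "P \<noteq> 0" by (simp add: P_def del: of_nat_mult)
  have "(k + 1) * (k + 2) * (k + 3) \<le> 20 * ((j + 3) * (j + 2) * (j + 1))"
    unfolding j by (simp add: algebra_simps)
  then have "real ((k + 1) * (k + 2) * (k + 3)) \<le> real (20 * ((j + 3) * (j + 2) * (j + 1)))"
    by (simp only: of_nat_le_iff)
  also have "\<dots> = 20 * P" unfolding P_def by (simp only: of_nat_mult of_nat_numeral)
  finally have "real ((k + 1) * (k + 2) * (k + 3)) * (fact (k - m) / fact k) \<le> 20 * P * (fact (k - m) / fact k)"
    by (intro mult_right_mono) auto
  also have "20 * P * (fact (k - m) / fact k) = 20 * (fact (k - m) / fact j)"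
  proof -
    have "fact k = P * fact j"
      unfolding j P_def by (simp add: numeral_3_eq_3 algebra_simps)
    then show ?thesis using P by simp
  qed
  finally show ?thesis by (simp add: j)
qed

text \<open>The situation at one fixed time: \<open>f\<close> is the solution, \<open>g\<close> its
  image under the \<open>m\<close>-th power of the lowering operator, and \<open>z\<close> the phase
  carrying the time dependence of that operator.\<close>

locale lowered =
  fixes z :: complex and m :: nat and f g :: "real \<Rightarrow> complex"
  assumes norm_z: "norm z = 1" and m: "3 \<le> m"
    and f: "square_integrable f" and g: "square_integrable g"
    and low: "(lowering (z / complex_of_real (sqrt 2)) (complex_of_real (sqrt 2) * \<i> * z) ^^ m) f g"
begin

lemma norm_herm_coeff:
  assumes "m \<le> k"
  shows "(norm (herm_coeff k f))\<^sup>2 = fact (k - m) / fact k * (norm (herm_coeff (k - m) g))\<^sup>2"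
proof -
  have "(norm (herm_coeff (k - m) g))\<^sup>2 = fact k / fact (k - m) * (norm (herm_coeff k f))\<^sup>2"
    using herm_coeff_lowering_power[OF refl refl f g low, of "k - m"] assms norm_z
    by (simp add: norm_mult norm_power power_mult_distrib)
  then show ?thesis by simp
qed

text \<open>The coefficient at \<open>k + m\<close> is \<open>sqrt (fact k / fact (k + m))\<close>
  times a coefficient of \<open>g\<close>, up to modulus. The product is bounded by the sum of the
  squares: one is at most \<open>1 / (k + 1)\<^sup>2\<close> because \<open>k + m\<close> exceeds
  \<open>k + 1\<close>, the other is summable by Bessel's inequality.\<close>

lemma summable_herm_coeff: "summable (\<lambda>k. norm (herm_coeff k f))"
proof (rule summable_iff_shift[THEN iffD1])
  show "summable (\<lambda>k. norm (herm_coeff (k + m) f))"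
  proof (rule summable_comparison_test')
    have "(\<Sum>k<n. (norm (herm_coeff k g))\<^sup>2) \<le> (l2_norm g)\<^sup>2" for n
      by (rule herm_bessel[OF g]) simp
    then have "summable (\<lambda>k. (norm (herm_coeff k g))\<^sup>2)" by (intro summableI_nonneg_bounded) auto
    moreover have "summable (\<lambda>k. inverse (real (Suc k) ^ 2))"
      using inverse_power_summable[of 2, where 'a=real] summable_Suc_iff[of "\<lambda>k. inverse (real k ^ 2)"] by simp
    ultimately show "summable (\<lambda>k. inverse (real (Suc k) ^ 2) + (norm (herm_coeff k g))\<^sup>2)"
      by (rule summable_add[rotated])
    fix k :: nat
    have "(fact (Suc (Suc k)) :: real) \<le> fact (k + m)" using m by (intro fact_mono) simp
    moreover have "real (Suc k) * (real (Suc k) * fact k) \<le> real (Suc (Suc k)) * (real (Suc k) * fact k)"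
      by (intro mult_right_mono) auto
    ultimately have "real (Suc k) ^ 2 * fact k \<le> fact (k + m)"
      by (simp only: power2_eq_square mult.assoc fact_Suc)
    then have "fact k / fact (k + m) \<le> inverse (real (Suc k) ^ 2)"
      by (simp add: field_simps del: of_nat_Suc)
    moreover have "norm (herm_coeff (k + m) f) = sqrt (fact k / fact (k + m)) * norm (herm_coeff k g)"
      by (rule power2_eq_imp_eq) (simp_all add: power_mult_distrib norm_herm_coeff)
    moreover have "2 * (sqrt (fact k / fact (k + m)) * norm (herm_coeff k g)) \<le> fact k / fact (k + m) + (norm (herm_coeff k g))\<^sup>2"
      using two_mult_le_weighted_squares[of 1 "sqrt (fact k / fact (k + m))" "norm (herm_coeff k g)"] by simp
    ultimately show "norm (norm (herm_coeff (k + m) f)) \<le> inverse (real (Suc k) ^ 2) + (norm (herm_coeff k g))\<^sup>2"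
      using norm_ge_zero[of "herm_coeff (k + m) f"] unfolding real_norm_def abs_norm_cancel by linarith
  qed
qed

text \<open>A weight on the coefficients of \<open>f\<close> becomes, after the index shift by
  \<open>m\<close>, a weight on those of \<open>g\<close>, where only its maximum \<open>K\<close>
  matters for Bessel's inequality.\<close>

lemma weighted_herm_coeff_sum:
  assumes I: "finite I" "\<And>k. k \<in> I \<Longrightarrow> m \<le> k"
    and W: "\<And>k. k \<in> I \<Longrightarrow> W k * (fact (k - m) / fact k) \<le> K" and K: "0 \<le> K"
  shows "(\<Sum>k\<in>I. W k * (norm (herm_coeff k f))\<^sup>2) \<le> K * (l2_norm g)\<^sup>2"
proof -
  have inj: "inj_on (\<lambda>k. k - m) I"
    by (intro inj_onI) (metis I(2) eq_diff_iff)
  have "(\<Sum>k\<in>I. W k * (norm (herm_coeff k f))\<^sup>2) \<le> (\<Sum>k\<in>I. K * (norm (herm_coeff (k - m) g))\<^sup>2)"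
  proof (rule sum_mono)
    fix k assume "k \<in> I"
    then show "W k * (norm (herm_coeff k f))\<^sup>2 \<le> K * (norm (herm_coeff (k - m) g))\<^sup>2"
      unfolding norm_herm_coeff[OF I(2)[OF \<open>k \<in> I\<close>]] mult.assoc[symmetric]
      by (intro mult_right_mono W) auto
  qed
  also have "\<dots> = K * (\<Sum>k\<in>(\<lambda>k. k - m) ` I. (norm (herm_coeff k g))\<^sup>2)"
    unfolding sum.reindex[OF inj] by (simp add: sum_distrib_left)
  also have "\<dots> \<le> K * (l2_norm g)\<^sup>2"
    using K I(1) by (intro mult_left_mono herm_bessel g) auto
  finally show ?thesis .
qed

text \<open>Both weights decrease in \<open>k\<close> beyond \<open>N\<close>, so the first index
  \<open>N + 1\<close> of the tail determines the constants, and the bounds do not depend on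
  \<open>n\<close>.\<close>

lemma tail_partial_sum:
  fixes N n
  defines "I \<equiv> {N<..<n}"
  assumes mN: "m \<le> N + 1"
  shows "l2_norm (\<lambda>x. \<Sum>k\<in>I. herm_coeff k f * herm_fun k x)
      \<le> sqrt (fact (N + 1 - m) / fact (N + 1)) * l2_norm g"
    and "square_integrable (\<lambda>x. complex_of_real x ^ 3 * (\<Sum>k\<in>I. herm_coeff k f * herm_fun k x))"
    and "l2_norm (\<lambda>x. complex_of_real x ^ 3 * (\<Sum>k\<in>I. herm_coeff k f * herm_fun k x))
      \<le> sqrt (20 * (fact (N + 1 - m) / fact (N - 2))) * l2_norm g"
proof -
  have I: "finite I" "\<And>k. k \<in> I \<Longrightarrow> N + 1 \<le> k" "\<And>k. k \<in> I \<Longrightarrow> m \<le> k"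
    using mN by (auto simp: I_def)
  have "(l2_norm (\<lambda>x. \<Sum>k\<in>I. herm_coeff k f * herm_fun k x))\<^sup>2 = (\<Sum>k\<in>I. 1 * (norm (herm_coeff k f))\<^sup>2)"
    using I(1) by (simp add: l2_norm_herm_sum)
  also have "\<dots> \<le> fact (N + 1 - m) / fact (N + 1) * (l2_norm g)\<^sup>2"
  proof (rule weighted_herm_coeff_sum[OF I(1,3)])
    fix k assume "k \<in> I"
    then show "1 * (fact (k - m) / fact k) \<le> (fact (N + 1 - m) / fact (N + 1) :: real)"
      using fact_ratio_mono[of 0 m "N + 1" k] mN I(2) by (simp del: fact_Suc)
  qed simp_all
  finally have "(l2_norm (\<lambda>x. \<Sum>k\<in>I. herm_coeff k f * herm_fun k x))\<^sup>2
      \<le> (sqrt (fact (N + 1 - m) / fact (N + 1)) * l2_norm g)\<^sup>2"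
    by (simp add: power_mult_distrib del: fact_Suc)
  then show "l2_norm (\<lambda>x. \<Sum>k\<in>I. herm_coeff k f * herm_fun k x)
      \<le> sqrt (fact (N + 1 - m) / fact (N + 1)) * l2_norm g"
    by (rule power2_le_imp_le) simp
  \<comment> \<open>Extension by zero turns the sum over the gap into an initial segment, the form
    in which the cubic bound is available.\<close>
  define c where "c k = (if k \<in> I then herm_coeff k f else 0)" for k
  have c0: "c k = 0" if "k \<ge> n" for k using that by (auto simp: c_def I_def)
  have sum_c: "(\<Sum>k\<in>I. herm_coeff k f * herm_fun k x) = (\<Sum>k<n. c k * herm_fun k x)" for x
    by (rule sum.mono_neutral_cong_left) (auto simp: c_def I_def)
  show "square_integrable (\<lambda>x. complex_of_real x ^ 3 * (\<Sum>k\<in>I. herm_coeff k f * herm_fun k x))"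
    unfolding sum_c by (rule l2_norm_cube_herm_sum(2)) (rule c0)
  have "(l2_norm (\<lambda>x. complex_of_real x ^ 3 * (\<Sum>k\<in>I. herm_coeff k f * herm_fun k x)))\<^sup>2
      \<le> (\<Sum>k<n. real ((k + 1) * (k + 2) * (k + 3)) * (norm (c k))\<^sup>2)"
    unfolding sum_c by (rule l2_norm_cube_herm_sum(1)) (rule c0)
  also have "\<dots> = (\<Sum>k\<in>I. real ((k + 1) * (k + 2) * (k + 3)) * (norm (herm_coeff k f))\<^sup>2)"
    by (rule sum.mono_neutral_cong_right) (auto simp: c_def I_def)
  also have "\<dots> \<le> 20 * (fact (N + 1 - m) / fact (N - 2)) * (l2_norm g)\<^sup>2"
  proof (rule weighted_herm_coeff_sum[OF I(1,3)])
    fix k assume k: "k \<in> I"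
    have "real ((k + 1) * (k + 2) * (k + 3)) * (fact (k - m) / fact k) \<le> 20 * (fact (k - m) / fact (k - 3))"
      by (rule cubic_fact_bound[OF m I(3)[OF k]])
    also have "fact (k - m) / fact (k - 3) \<le> (fact (N + 1 - m) / fact (N + 1 - 3) :: real)"
      using fact_ratio_mono[OF m mN I(2)[OF k]] .
    also have "N + 1 - 3 = N - 2" by simp
    finally show "real ((k + 1) * (k + 2) * (k + 3)) * (fact (k - m) / fact k)
        \<le> 20 * (fact (N + 1 - m) / fact (N - 2))" by simp
  qed simp_all
  finally have "(l2_norm (\<lambda>x. complex_of_real x ^ 3 * (\<Sum>k\<in>I. herm_coeff k f * herm_fun k x)))\<^sup>2
      \<le> (sqrt (20 * (fact (N + 1 - m) / fact (N - 2))) * l2_norm g)\<^sup>2"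
    by (simp add: power_mult_distrib)
  then show "l2_norm (\<lambda>x. complex_of_real x ^ 3 * (\<Sum>k\<in>I. herm_coeff k f * herm_fun k x))
      \<le> sqrt (20 * (fact (N + 1 - m) / fact (N - 2))) * l2_norm g"
    by (rule power2_le_imp_le) simp
qed

lemma tendsto_tail:
  "(\<lambda>n. l2_norm (\<lambda>x. (f x - (\<Sum>k\<le>N. herm_coeff k f * herm_fun k x))
      - (\<Sum>k\<in>{N<..<n}. herm_coeff k f * herm_fun k x))) \<longlonglongrightarrow> 0"
proof (rule Lim_transform_eventually[OF herm_expansion[OF f summable_herm_coeff]])
  show "\<forall>\<^sub>F n in sequentially. l2_norm (\<lambda>x. f x - (\<Sum>k<n. herm_coeff k f * herm_fun k x)) =
      l2_norm (\<lambda>x. (f x - (\<Sum>k\<le>N. herm_coeff k f * herm_fun k x)) - (\<Sum>k\<in>{N<..<n}. herm_coeff k f * herm_fun k x))"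
    using eventually_gt_at_top[of N]
  proof eventually_elim
    case (elim n)
    then have *: "{..<n} = {..N} \<union> {N<..<n}" by auto
    have "(\<Sum>k<n. herm_coeff k f * herm_fun k x)
        = (\<Sum>k\<le>N. herm_coeff k f * herm_fun k x) + (\<Sum>k\<in>{N<..<n}. herm_coeff k f * herm_fun k x)" for x
      unfolding * by (rule sum.union_disjoint) auto
    then show ?case by (simp add: diff_diff_eq)
  qed
qed

lemma l2_norm_tail:
  assumes mN: "m \<le> N + 1"
  shows "l2_norm (\<lambda>x. f x - (\<Sum>k\<le>N. herm_coeff k f * herm_fun k x))
    \<le> sqrt (fact (N + 1 - m) / fact (N + 1)) * l2_norm g"
proof -
  let ?v = "\<lambda>x. f x - (\<Sum>k\<le>N. herm_coeff k f * herm_fun k x)"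
  let ?T = "\<lambda>n x. \<Sum>k\<in>{N<..<n}. herm_coeff k f * herm_fun k x"
  let ?K = "sqrt (fact (N + 1 - m) / fact (N + 1)) * l2_norm g"
  have v: "square_integrable ?v" using f by (intro square_integrable_diff) auto
  have "l2_norm ?v \<le> l2_norm (\<lambda>x. ?v x - ?T n x) + ?K" for n
    using l2_norm_triangle[of "\<lambda>x. ?v x - ?T n x" "?T n"] tail_partial_sum(1)[OF mN, of n] v
    by (simp add: square_integrable_diff del: fact_Suc)
  moreover have "(\<lambda>n. l2_norm (\<lambda>x. ?v x - ?T n x) + ?K) \<longlonglongrightarrow> 0 + ?K"
    by (intro tendsto_add tendsto_tail tendsto_const)
  ultimately show ?thesis
    using LIMSEQ_le_const[of _ "0 + ?K" "l2_norm ?v"] by (simp del: fact_Suc)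
qed

text \<open>
  The cubic weight is moved to the partial sums of the tail, so that the tail multiplied by \<open>x\<^sup>3\<close>
  never has to be shown square integrable.
\<close>

lemma norm_l2_inner_tail:
  fixes u :: "real \<Rightarrow> real"
  assumes mN: "m \<le> N + 1" and h: "square_integrable h" and uh: "square_integrable (\<lambda>x. of_real (u x) * h x)"
    and u: "u \<in> borel_measurable borel" "\<And>x. \<bar>u x\<bar> \<le> C * \<bar>x\<bar> ^ 3"
  shows "norm (l2_inner (\<lambda>x. of_real (u x) * h x) (\<lambda>x. f x - (\<Sum>k\<le>N. herm_coeff k f * herm_fun k x)))
    \<le> l2_norm h * (C * (sqrt (20 * (fact (N + 1 - m) / fact (N - 2))) * l2_norm g))"
proof -
  let ?v = "\<lambda>x. f x - (\<Sum>k\<le>N. herm_coeff k f * herm_fun k x)"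
  let ?T = "\<lambda>n x. \<Sum>k\<in>{N<..<n}. herm_coeff k f * herm_fun k x"
  let ?K = "sqrt (20 * (fact (N + 1 - m) / fact (N - 2))) * l2_norm g"
  note [measurable] = u(1)
  have C: "0 \<le> C" using u(2)[of 1] by simp
  have v: "square_integrable ?v" using f by (intro square_integrable_diff) auto
  have "norm (l2_inner (\<lambda>x. of_real (u x) * h x) (?T n)) \<le> l2_norm h * (C * ?K)" for n
  proof -
    let ?uT = "\<lambda>x. of_real (u x) * ?T n x" and ?xT = "\<lambda>x. of_real C * (complex_of_real x ^ 3 * ?T n x)"
    have xT: "square_integrable ?xT"
      using tail_partial_sum(2)[OF mN] by (rule square_integrable_mult)
    have le: "norm (?uT x) \<le> norm (?xT x)" for x
      using mult_right_mono[OF u(2)[of x], of "norm (?T n x)"] C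
      by (simp add: norm_mult norm_power mult.assoc)
    have meas: "?uT \<in> borel_measurable lborel" by measurable
    have uT: "square_integrable ?uT"
      by (rule square_integrable_bound[OF xT meas, of 1]) (use le in simp)
    have "l2_norm ?uT \<le> l2_norm ?xT" by (rule l2_norm_mono[OF xT meas le])
    also have "\<dots> \<le> C * ?K"
      unfolding l2_norm_mult using C tail_partial_sum(3)[OF mN] by (simp add: mult_left_mono)
    finally have le': "l2_norm ?uT \<le> C * ?K" .
    have "l2_inner (\<lambda>x. of_real (u x) * h x) (?T n) = l2_inner h ?uT"
      unfolding l2_inner_def by (simp add: mult_ac)
    then have "norm (l2_inner (\<lambda>x. of_real (u x) * h x) (?T n)) \<le> l2_norm h * l2_norm ?uT"
      using norm_l2_inner_le[OF h uT] by simp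
    also have "\<dots> \<le> l2_norm h * (C * ?K)" using le' by (rule mult_left_mono) simp
    finally show ?thesis .
  qed
  moreover have "(\<lambda>n. norm (l2_inner (\<lambda>x. of_real (u x) * h x) (?T n))) \<longlonglongrightarrow> norm (l2_inner (\<lambda>x. of_real (u x) * h x) ?v)"
    by (intro tendsto_norm tendsto_l2_inner[OF uh v] tendsto_tail) simp
  ultimately show ?thesis using LIMSEQ_le_const2 by blast
qed

end

section \<open>The energy estimate\<close>

text \<open>Cauchy-Schwarz bounds the error of the scalar difference quotient by the norm of the
  vector-valued one.\<close>

lemma has_vector_derivative_l2_inner:
  assumes deriv: "has_l2_derivative w d t S" and \<phi>: "square_integrable \<phi>"
    and w: "\<And>s. s \<in> S \<Longrightarrow> square_integrable (w s)" and t: "t \<in> S" and d: "square_integrable d"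
  shows "((\<lambda>s. l2_inner \<phi> (w s)) has_vector_derivative l2_inner \<phi> d) (at t within S)"
  unfolding has_vector_derivative_def has_derivative_iff_norm
proof (intro conjI bounded_linear_scaleR_left)
  let ?R = "\<lambda>s \<eta>. (w s \<eta> - w t \<eta>) /\<^sub>R (s - t) - d \<eta>"
  show "((\<lambda>s. norm (l2_inner \<phi> (w s) - l2_inner \<phi> (w t) - (s - t) *\<^sub>R l2_inner \<phi> d) / norm (s - t)) \<longlongrightarrow> 0) (at t within S)"
  proof (rule Lim_null_comparison)
    show "((\<lambda>s. l2_norm \<phi> * l2_norm (?R s)) \<longlongrightarrow> 0) (at t within S)"
      using deriv unfolding has_l2_derivative_def by (rule tendsto_mult_right_zero)
    show "\<forall>\<^sub>F s in at t within S. norm (norm (l2_inner \<phi> (w s) - l2_inner \<phi> (w t) - (s - t) *\<^sub>R l2_inner \<phi> d) / norm (s - t))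
        \<le> l2_norm \<phi> * l2_norm (?R s)"
      unfolding eventually_at_filter
    proof (intro always_eventually allI impI)
      fix s assume s: "s \<noteq> t" "s \<in> S"
      have wst: "square_integrable (\<lambda>\<eta>. w s \<eta> - w t \<eta>)" using w[OF s(2)] w[OF t] by (rule square_integrable_diff)
      have eq: "?R s = (\<lambda>\<eta>. of_real (inverse (s - t)) * (w s \<eta> - w t \<eta>) - d \<eta>)"
        by (simp add: scaleR_conv_of_real)
      have R: "square_integrable (?R s)"
        unfolding eq by (rule square_integrable_diff[OF square_integrable_mult[OF wst] d])
      have "l2_inner \<phi> (?R s) = of_real (inverse (s - t)) * (l2_inner \<phi> (w s) - l2_inner \<phi> (w t)) - l2_inner \<phi> d"
        unfolding eq using wst d \<phi> w[OF s(2)] w[OF t]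
        by (simp add: l2_inner_diff_right l2_inner_mult_right square_integrable_mult del: of_real_inverse)
      also have "\<dots> = of_real (inverse (s - t)) * (l2_inner \<phi> (w s) - l2_inner \<phi> (w t) - (s - t) *\<^sub>R l2_inner \<phi> d)"
        using s by (simp add: scaleR_conv_of_real field_simps)
      finally have "norm (l2_inner \<phi> (?R s)) = norm (l2_inner \<phi> (w s) - l2_inner \<phi> (w t) - (s - t) *\<^sub>R l2_inner \<phi> d) / norm (s - t)"
        by (simp add: norm_mult norm_inverse divide_inverse mult.commute flip: of_real_diff)
      then show "norm (norm (l2_inner \<phi> (w s) - l2_inner \<phi> (w t) - (s - t) *\<^sub>R l2_inner \<phi> d) / norm (s - t))
          \<le> l2_norm \<phi> * l2_norm (?R s)"
        using norm_l2_inner_le[OF \<phi> R] by simp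
    qed
  qed
qed

text \<open>The real diagonal entries \<open>\<mu> k\<close> only rotate the coefficients and leave
  their moduli unchanged, so only the forcing \<open>p\<close> contributes.\<close>

lemma has_real_derivative_sum_norm_power2:
  assumes "\<And>k. k \<in> I \<Longrightarrow>
      (c k has_vector_derivative - \<i> * (of_real (\<mu> k) * c k t + p k)) (at t within S)"
  shows "((\<lambda>s. \<Sum>k\<in>I. (norm (c k s))\<^sup>2) has_real_derivative 2 * Im (\<Sum>k\<in>I. cnj (c k t) * p k)) (at t within S)"
proof -
  have "((\<lambda>s. (norm (c k s))\<^sup>2) has_real_derivative 2 * Im (cnj (c k t) * p k)) (at t within S)" if "k \<in> I" for k
  proof -
    let ?d = "- \<i> * (of_real (\<mu> k) * c k t + p k)"
    have Re: "((\<lambda>s. Re (c k s)) has_real_derivative Re ?d) (at t within S)"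
      and Im: "((\<lambda>s. Im (c k s)) has_real_derivative Im ?d) (at t within S)"
      unfolding has_real_derivative_iff_has_vector_derivative
      by (intro bounded_linear.has_vector_derivative[OF bounded_linear_Re] assms that
          bounded_linear.has_vector_derivative[OF bounded_linear_Im])+
    have "((\<lambda>s. (Re (c k s))\<^sup>2 + (Im (c k s))\<^sup>2) has_real_derivative
        2 * Re (c k t) * Re ?d + 2 * Im (c k t) * Im ?d) (at t within S)"
      by (rule derivative_eq_intros Re Im refl)+ simp
    then show ?thesis by (simp add: cmod_power2 algebra_simps)
  qed
  then have "((\<lambda>s. \<Sum>k\<in>I. (norm (c k s))\<^sup>2) has_real_derivative (\<Sum>k\<in>I. 2 * Im (cnj (c k t) * p k))) (at t within S)"
    by (rule DERIV_sum)
  then show ?thesis by (simp only: Im_sum sum_distrib_left)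
qed

text \<open>Formally, dividing the inequality by \<open>2 sqrt E\<close> gives a derivative of
  \<open>sqrt E\<close> of at most \<open>K\<close>. Keeping \<open>sqrt E\<close> on the right-hand
  side is what yields linear growth instead of an exponential.\<close>

lemma sqrt_energy_bound:
  fixes E E' :: "real \<Rightarrow> real"
  assumes deriv: "\<And>s. s \<in> {0..T} \<Longrightarrow> (E has_real_derivative E' s) (at s within {0..T})"
    and E: "\<And>s. s \<in> {0..T} \<Longrightarrow> 0 \<le> E s" "E 0 = 0"
    and le: "\<And>s. s \<in> {0..T} \<Longrightarrow> E' s \<le> 2 * sqrt (E s) * K" and K: "0 \<le> K" and t: "t \<in> {0..T}"
  shows "sqrt (E t) \<le> K * t"
proof -
  \<comment> \<open>\<open>sqrt E\<close> need not be differentiable where \<open>E\<close> vanishes, hence the regularisation by \<open>d\<close>.\<close>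
  have "sqrt (E t) \<le> sqrt d + K * t" if d: "d > 0" for d
  proof -
    define F where "F s = sqrt (E s + d) - K * s" for s
    define F' where "F' s = E' s / (2 * sqrt (E s + d)) - K" for s
    have "(F has_derivative (\<lambda>h. h * F' s)) (at s within {0..t})" if s: "0 \<le> s" "s \<le> t" for s
    proof -
      have sT: "s \<in> {0..T}" using s t by auto
      have "E s + d > 0" using E(1)[OF sT] d by simp
      from DERIV_chain2[OF DERIV_real_sqrt[OF this] DERIV_add[OF deriv[OF sT] DERIV_const]]
      have "((\<lambda>s. sqrt (E s + d)) has_real_derivative E' s / (2 * sqrt (E s + d))) (at s within {0..T})"
        by (rule DERIV_cong) (simp add: field_simps)
      from DERIV_diff[OF this DERIV_cmult[OF DERIV_ident, of K]]
      have "(F has_real_derivative F' s) (at s within {0..T})"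
        by (simp add: F_def[abs_def] F'_def)
      then have "(F has_real_derivative F' s) (at s within {0..t})"
        by (rule DERIV_subset) (use t in auto)
      then show ?thesis by (simp add: has_field_derivative_def mult.commute[of _ "F' s"])
    qed
    then obtain x where x: "x \<in> {0..t}" "F t - F 0 = (t - 0) * F' x"
      using mvt_very_simple[of 0 t F "\<lambda>s h. h * F' s"] t by auto
    have xT: "x \<in> {0..T}" using x t by auto
    have "E' x \<le> 2 * sqrt (E x) * K" by (rule le[OF xT])
    also have "\<dots> \<le> 2 * sqrt (E x + d) * K" using d K by (intro mult_right_mono mult_left_mono) auto
    finally have "F' x \<le> 0" unfolding F'_def using E(1)[OF xT] d by (simp add: field_simps)
    then have "F t - F 0 \<le> 0" using x t by (simp add: mult_nonneg_nonpos)
    then have "sqrt (E t + d) \<le> sqrt d + K * t" by (simp add: F_def E(2))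
    moreover have "sqrt (E t) \<le> sqrt (E t + d)" using d by simp
    ultimately show ?thesis by linarith
  qed
  then have "\<forall>\<^sub>F d in at_right 0. sqrt (E t) \<le> sqrt d + K * t" by (auto simp: eventually_at_filter)
  moreover have "((\<lambda>d. sqrt d + K * t) \<longlongrightarrow> sqrt 0 + K * t) (at_right 0)" by (intro tendsto_intros)
  ultimately show ?thesis using tendsto_lowerbound[of _ "sqrt 0 + K * t" "at_right (0::real)" "sqrt (E t)"] by simp
qed

lemma herm_coeff_hamiltonian:
  assumes V: "C3_potential V" and M: "\<And>x. \<bar>(deriv ^^ 3) V x\<bar> \<le> M" and \<epsilon>: "\<epsilon> > 0" and b: "b > 0"
    and f: "square_integrable f" and g: "square_integrable g" and H: "hamiltonian \<epsilon> V a q b f g"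
  shows "herm_coeff k g = of_real (a * (2 * real k + 1)) * herm_coeff k f
      + l2_inner (\<lambda>x. of_real (sqrt \<epsilon> * U_pot \<epsilon> V q b x) * herm_fun k x) f"
proof -
  obtain f2 where f2: "weak_deriv 2 f f2"
    and eq: "AE x in lborel. g x = - of_real (1/2 * a) * f2 x + of_real (2 * a * x\<^sup>2) * f x
      + of_real (sqrt \<epsilon> * U_pot \<epsilon> V q b x) * f x"
    using H unfolding hamiltonian_def by blast
  note [measurable] = borel_measurable_U_pot[OF V]
  have bound: "\<bar>sqrt \<epsilon> * U_pot \<epsilon> V q b x\<bar> \<le> (sqrt \<epsilon> * (M / 6 / b ^ 3)) * \<bar>x\<bar> ^ 3" for x
    using mult_left_mono[OF U_pot_bound[OF V M \<epsilon> b], of "sqrt \<epsilon>" q x] \<epsilon>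
    by (simp add: abs_mult)
  show ?thesis
    by (rule herm_coeff_oscillator[OF f g f2 _ bound eq]) measurable
qed

theorem theorem3p5:
  fixes V :: "real \<Rightarrow> real" and T BmT :: real and m :: nat
  assumes "C3_potential V"
    and "essentially_bounded ((deriv ^^ 3) V)"
    and "T > 0"
    and "3 \<le> m"
  shows "\<exists>B1 B2 :: real. \<forall>(N :: nat) (\<epsilon> :: real) (q :: real \<Rightarrow> real) (p :: real \<Rightarrow> real)
      (\<alpha> :: real \<Rightarrow> complex) (B :: real \<Rightarrow> real) (r :: real \<Rightarrow> complex)
      (w0 :: real \<Rightarrow> complex) (w :: real \<Rightarrow> real \<Rightarrow> complex) (wN :: real \<Rightarrow> real \<Rightarrow> complex)
      (Amw :: real \<Rightarrow> real \<Rightarrow> complex).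
      m \<le> N + 1 \<longrightarrow>
      0 < \<epsilon> \<longrightarrow> \<epsilon> < 1 \<longrightarrow>
      parameter_flow V T q p \<alpha> B \<longrightarrow>
      inv_sqrt_branch (Qh \<alpha>) T r \<longrightarrow>
      w_solution \<epsilon> V T q \<alpha> B w \<longrightarrow>
      w 0 = w0 \<longrightarrow>
      truncated_solution \<epsilon> V T q \<alpha> B r N w0 wN \<longrightarrow>
      (\<forall>t\<in>{0..T}. sobolev 3 (\<lambda>\<eta>. Proj \<alpha> r N t (w t) \<eta> - w t \<eta>)) \<longrightarrow>
      (\<forall>t\<in>{0..T}. (lowering (Qh \<alpha> t) (Ph \<alpha> t) ^^ m) (w t) (Amw t) \<and> square_integrable (Amw t)) \<longrightarrow>
      (\<forall>t\<in>{0..T}. l2_norm (Amw t) \<le> BmT * l2_norm (Amw 0)) \<longrightarrow>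
      (\<forall>t\<in>{0..T}.
         l2_norm (\<lambda>\<eta>. w t \<eta> - wN t \<eta>)
           \<le> B1 * sqrt (fact (N + 1 - m) / fact (N + 1)) * l2_norm (Amw 0)
             + B2 * T * (\<epsilon> powr (1/2) / (INF s\<in>{0..T}. Im (\<alpha> s)) powr (3/2))
                 * sqrt (fact (N + 1 - m) / fact (N - 2)) * l2_norm (Amw 0))"
proof -
  note V = assms(1)
  have cont: "continuous_on UNIV ((deriv ^^ 3) V)" using V by (simp add: C3_potential_def)
  obtain M where M: "M \<ge> 0" "\<And>x. \<bar>(deriv ^^ 3) V x\<bar> \<le> M"
    using essentially_bounded_continuous[OF assms(2) cont] by blast
  show ?thesis
  \<comment> \<open>The first constant is that of the stability condition. In the second,
    \<open>M\<close> bounds the third derivative of the potential, \<open>1 / 6\<close> belongs to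
    the Taylor remainder, and \<open>sqrt 20\<close> to the comparison of cubic weights.\<close>
  proof (rule exI[of _ BmT], rule exI[of _ "M / 6 * sqrt 20 * BmT"], intro allI impI ballI)
    fix N \<epsilon> q p \<alpha> B r w0 w wN Amw t
    assume mN: "m \<le> N + 1" and \<epsilon>: "0 < \<epsilon>" and flow: "parameter_flow V T q p \<alpha> B"
      and r: "inv_sqrt_branch (Qh \<alpha>) T r" and sol: "w_solution \<epsilon> V T q \<alpha> B w" and w0: "w 0 = w0"
      and solN: "truncated_solution \<epsilon> V T q \<alpha> B r N w0 wN"
      and A: "\<forall>t\<in>{0..T}. (lowering (Qh \<alpha> t) (Ph \<alpha> t) ^^ m) (w t) (Amw t) \<and> square_integrable (Amw t)"
      and stab: "\<forall>t\<in>{0..T}. l2_norm (Amw t) \<le> BmT * l2_norm (Amw 0)" and t: "t \<in> {0..T}"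
    have w: "square_integrable (w s)" if "s \<in> {0..T}" for s using sol that by (simp add: w_solution_def)
    have wN: "square_integrable (wN s)" if "s \<in> {0..T}" for s using solN that by (simp add: truncated_solution_def)
    have lowered: "lowered (phase \<alpha> s) m (w s) (Amw s)" if "s \<in> {0..T}" for s
      using A w assms(4) that unfolding lowered_def Qh_phase Ph_phase by simp
    define a where "a = (INF s\<in>{0..T}. Im (\<alpha> s))"
    define L where "L = BmT * l2_norm (Amw 0)"
    define \<kappa> where "\<kappa> = sqrt (20 * (fact (N + 1 - m) / fact (N - 2)))"
    define K where "K = sqrt \<epsilon> * (M / 6 / a powr (3/2)) * (\<kappa> * L)"
    define u where "u s x = sqrt \<epsilon> * U_pot \<epsilon> V (q s) (B s) x" for s x
    define C where "C s = sqrt \<epsilon> * (M / 6 / B s ^ 3)" for s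
    \<comment> \<open>For \<open>k \<le> N\<close> these are the coefficients of
      \<open>w\<^sub>N - \<Pi>\<^sub>N w\<close>, since the projection does not alter them.
      \<open>G\<close> is the function they represent, \<open>v\<close> the tail of
      \<open>w\<close>, and \<open>E\<close> the squared norm of \<open>G\<close>.\<close>
    define e where "e s k = herm_coeff k (wN s) - herm_coeff k (w s)" for s k
    define G where "G s x = (\<Sum>k\<le>N. e s k * herm_fun k x)" for s x
    define v where "v s x = w s x - (\<Sum>k\<le>N. herm_coeff k (w s) * herm_fun k x)" for s x
    define E where "E s = (\<Sum>k\<le>N. (norm (e s k))\<^sup>2)" for s
    note [measurable] = borel_measurable_U_pot[OF V]
    have [measurable]: "u s \<in> borel_measurable borel" for s unfolding u_def by measurable
    have a: "a > 0" unfolding a_def by (rule parameter_flow_Inf_width(1)[OF flow t])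
    \<comment> \<open>The sign of \<open>BmT\<close> is not prescribed; \<open>L\<close> is
      nonnegative because it dominates a norm.\<close>
    have L0: "0 \<le> L" using stab t l2_norm_nonneg order_trans unfolding L_def by blast
    have \<kappa>0: "0 \<le> \<kappa>" by (simp add: \<kappa>_def)
    have K0: "0 \<le> K" unfolding K_def using \<epsilon> M(1) L0 \<kappa>0 by (intro mult_nonneg_nonneg divide_nonneg_nonneg) auto
    have B: "B s > 0" if "s \<in> {0..T}" for s by (rule parameter_flow_width(1)[OF flow that])
    have u: "\<bar>u s x\<bar> \<le> C s * \<bar>x\<bar> ^ 3" if "s \<in> {0..T}" for s x
      unfolding u_def C_def using mult_left_mono[OF U_pot_bound[OF V M(2) \<epsilon> B[OF that]], of "sqrt \<epsilon>" "q s" x] \<epsilon>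
      by (simp add: abs_mult)
    \<comment> \<open>As \<open>Im \<alpha>\<close> is the square of \<open>B\<close>, the cube of
      \<open>B\<close> is its power 3/2, which is bounded below through the infimum
      \<open>a\<close>.\<close>
    have C: "C s \<le> sqrt \<epsilon> * (M / 6 / a powr (3/2))" if s: "s \<in> {0..T}" for s
    proof -
      have "a powr (3/2) \<le> ((B s)\<^sup>2) powr (3/2)"
        using parameter_flow_Inf_width(2)[OF flow s] parameter_flow_width(2)[OF flow s] a
        by (intro powr_mono2) (simp_all add: a_def)
      also have "\<dots> = B s ^ 3" using B[OF s] by (simp add: powr_powr flip: powr_numeral)
      finally show ?thesis unfolding C_def using \<epsilon> M(1) a B[OF s]
        by (intro mult_left_mono divide_left_mono mult_pos_pos) auto
    qed
    have v: "square_integrable (v s)" if "s \<in> {0..T}" for s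
      unfolding v_def using w[OF that] by (intro square_integrable_diff) auto
    have G: "square_integrable (G s)" for s unfolding G_def by simp
    have uh: "square_integrable (\<lambda>x. of_real (u s x) * herm_fun k x)" if "s \<in> {0..T}" for s k
      unfolding herm_fun_def by (rule cubic_mult_gauss_poly[OF _ u[OF that]]) measurable
    have uG_eq: "(\<lambda>x. of_real (u s x) * G s x) = (\<lambda>x. \<Sum>k\<le>N. e s k * (of_real (u s x) * herm_fun k x))" for s
      by (simp add: G_def sum_distrib_left mult.left_commute)
    have uG: "square_integrable (\<lambda>x. of_real (u s x) * G s x)" if "s \<in> {0..T}" for s
      unfolding uG_eq by (intro square_integrable_sum square_integrable_mult uh that)
    \<comment> \<open>A function with values in the span equals its own finite expansion, but only
      almost everywhere, as the solution is a representative of a class.\<close>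
    have diff: "AE x in lborel. wN s x - w s x = G s x - v s x" if s: "s \<in> {0..T}" for s
    proof -
      obtain h where h: "h \<in> hagedorn_span \<alpha> r N s" and wNh: "AE x in lborel. wN s x = h x"
        using solN s unfolding truncated_solution_def by blast
      then obtain c where c: "h = (\<lambda>x. \<Sum>k\<le>N. c k * herm_fun k x)"
        unfolding hagedorn_span_eq[OF r s] by auto
      have "herm_coeff k (wN s) = c k" if "k \<le> N" for k
      proof -
        have "herm_coeff k (wN s) = herm_coeff k h"
          unfolding herm_coeff_def
          by (rule l2_inner_cong_AE)
            (use wNh square_integrableD(2)[OF wN[OF s]] square_integrableD(2)[OF square_integrable_herm_sum[of c "{..N}"]] in \<open>simp_all add: c\<close>)
        then show ?thesis using that by (simp add: c herm_coeff_sum)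
      qed
      then have "h x = (\<Sum>k\<le>N. herm_coeff k (wN s) * herm_fun k x)" for x unfolding c by (intro sum.cong) auto
      then have "h x - w s x = G s x - v s x" for x
        by (simp add: G_def v_def e_def left_diff_distrib sum_subtractf)
      then show ?thesis using wNh by auto
    qed
    \<comment> \<open>For \<open>k \<le> N\<close> the projection is invisible to the coefficient,
      so both equations have the same form and can be subtracted. The coupling involves the full
      difference \<open>w\<^sub>N - w\<close>, through which the tail enters.\<close>
    have de: "((\<lambda>s. e s k) has_vector_derivative - \<i> * (of_real (Im (\<alpha> s) * (2 * real k + 1)) * e s k
        + l2_inner (\<lambda>x. of_real (u s x) * herm_fun k x) (\<lambda>x. wN s x - w s x))) (at s within {0..T})"
      if s: "s \<in> {0..T}" and k: "k \<le> N" for s k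
    proof -
      obtain g where g: "hamiltonian \<epsilon> V (Im (\<alpha> s)) (q s) (B s) (w s) g" "square_integrable g"
        "has_l2_derivative w (\<lambda>\<eta>. - \<i> * g \<eta>) s {0..T}"
        using sol s unfolding w_solution_def by blast
      obtain gN where gN: "hamiltonian \<epsilon> V (Im (\<alpha> s)) (q s) (B s) (wN s) gN" "square_integrable gN"
        "has_l2_derivative wN (\<lambda>\<eta>. - \<i> * Proj \<alpha> r N s gN \<eta>) s {0..T}"
        using solN s unfolding truncated_solution_def by blast
      have P: "square_integrable (Proj \<alpha> r N s gN)" "herm_coeff k (Proj \<alpha> r N s gN) = herm_coeff k gN"
        unfolding Proj_eq[OF r s gN(2)] using k by (simp_all add: herm_coeff_sum)
      have "((\<lambda>s. herm_coeff k (wN s) - herm_coeff k (w s)) has_vector_derivative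
          herm_coeff k (\<lambda>\<eta>. - \<i> * Proj \<alpha> r N s gN \<eta>) - herm_coeff k (\<lambda>\<eta>. - \<i> * g \<eta>)) (at s within {0..T})"
        unfolding herm_coeff_def
        by (intro has_vector_derivative_diff has_vector_derivative_l2_inner[OF gN(3)] has_vector_derivative_l2_inner[OF g(3)]
            square_integrable_herm_fun square_integrable_mult wN w s P g)
      also have "herm_coeff k (\<lambda>\<eta>. - \<i> * Proj \<alpha> r N s gN \<eta>) - herm_coeff k (\<lambda>\<eta>. - \<i> * g \<eta>)
          = - \<i> * (herm_coeff k gN - herm_coeff k g)"
        using P(2) unfolding herm_coeff_def l2_inner_mult_right by (simp add: algebra_simps)
      also have "herm_coeff k gN - herm_coeff k g = of_real (Im (\<alpha> s) * (2 * real k + 1)) * e s k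
        + l2_inner (\<lambda>x. of_real (u s x) * herm_fun k x) (\<lambda>x. wN s x - w s x)"
        unfolding herm_coeff_hamiltonian[OF V M(2) \<epsilon> B[OF s] w[OF s] g(2,1)]
          herm_coeff_hamiltonian[OF V M(2) \<epsilon> B[OF s] wN[OF s] gN(2,1)] u_def[symmetric]
          l2_inner_diff_right[OF uh[OF s] wN[OF s] w[OF s]] e_def
        by (simp add: algebra_simps)
      finally show ?thesis unfolding e_def .
    qed
    have dE: "(E has_real_derivative 2 * Im (l2_inner (\<lambda>x. of_real (u s x) * G s x) (\<lambda>x. wN s x - w s x))) (at s within {0..T})"
      if s: "s \<in> {0..T}" for s
    proof -
      have "l2_inner (\<lambda>x. of_real (u s x) * G s x) (\<lambda>x. wN s x - w s x)
          = (\<Sum>k\<le>N. cnj (e s k) * l2_inner (\<lambda>x. of_real (u s x) * herm_fun k x) (\<lambda>x. wN s x - w s x))"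
        unfolding uG_eq by (rule l2_inner_sum_left[OF square_integrable_diff[OF wN[OF s] w[OF s]] uh[OF s]])
      then show ?thesis
        unfolding E_def[abs_def]
        using has_real_derivative_sum_norm_power2[where I="{..N}" and c="\<lambda>k s. e s k", OF de[OF s]] by simp
    qed
    \<comment> \<open>Split \<open>w\<^sub>N - w\<close> into \<open>G - v\<close>. Since
      \<open>u\<close> is real, the pairing of \<open>u G\<close> with \<open>G\<close> is real and
      disappears from the imaginary part; only the pairing with the tail remains.\<close>
    have slope: "2 * Im (l2_inner (\<lambda>x. of_real (u s x) * G s x) (\<lambda>x. wN s x - w s x)) \<le> 2 * sqrt (E s) * K"
      if s: "s \<in> {0..T}" for s
    proof -
      interpret lowered "phase \<alpha> s" m "w s" "Amw s" by (rule lowered[OF s])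
      let ?uG = "\<lambda>x. of_real (u s x) * G s x"
      have "l2_inner ?uG (\<lambda>x. wN s x - w s x) = l2_inner ?uG (\<lambda>x. G s x - v s x)"
        by (rule l2_inner_cong_AE[OF _ _ _ diff[OF s]])
          (use uG[OF s] w[OF s] wN[OF s] v[OF s] G[of s] in \<open>auto simp: square_integrable_def\<close>)
      then have *: "l2_inner ?uG (\<lambda>x. wN s x - w s x) = l2_inner ?uG (G s) - l2_inner ?uG (v s)"
        using uG[OF s] G v[OF s] by (simp add: l2_inner_diff_right)
      have "l2_inner (G s) ?uG = l2_inner ?uG (G s)" unfolding l2_inner_def by (simp add: mult_ac)
      then have "cnj (l2_inner ?uG (G s)) = l2_inner ?uG (G s)" by (simp only: cnj_l2_inner)
      from arg_cong[OF this, of Im] have "Im (l2_inner ?uG (G s)) = 0" by simp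
      then have "Im (l2_inner ?uG (\<lambda>x. wN s x - w s x)) \<le> norm (l2_inner ?uG (v s))"
        unfolding * using abs_Im_le_cmod[of "l2_inner ?uG (v s)"] by simp
      also have "\<dots> \<le> l2_norm (G s) * (C s * (\<kappa> * l2_norm (Amw s)))"
        unfolding v_def[abs_def] \<kappa>_def
        by (rule norm_l2_inner_tail[OF mN G uG[OF s] _ u[OF s]]) measurable
      also have "l2_norm (G s) = sqrt (E s)"
        unfolding G_def[abs_def] E_def l2_norm_herm_sum[OF finite_atMost, symmetric] by simp
      also have "sqrt (E s) * (C s * (\<kappa> * l2_norm (Amw s))) \<le> sqrt (E s) * K"
        unfolding K_def using C[OF s] \<kappa>0 stab s \<epsilon> M(1)
        by (intro mult_left_mono mult_mono) (auto simp: E_def L_def sum_nonneg)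
      finally show ?thesis by simp
    qed
    have E0: "E 0 = 0"
    proof -
      have T0: "0 \<in> {0..T}" using t by simp
      have init: "AE x in lborel. wN 0 x = Proj \<alpha> r N 0 (w 0) x"
        using solN w0 by (simp add: truncated_solution_def)
      have "herm_coeff k (wN 0) = herm_coeff k (Proj \<alpha> r N 0 (w 0))" for k
        unfolding herm_coeff_def
        by (rule l2_inner_cong_AE)
          (use init square_integrableD(2)[OF wN[OF T0]] square_integrableD(2)[OF square_integrable_herm_sum] in
            \<open>simp_all add: Proj_eq[OF r T0 w[OF T0]]\<close>)
      then have "e 0 k = 0" if "k \<le> N" for k
        using that by (simp add: e_def Proj_eq[OF r T0 w[OF T0]] herm_coeff_sum)
      then show ?thesis by (simp add: E_def)
    qed
    have "sqrt (E t) \<le> K * t"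
      by (rule sqrt_energy_bound[OF dE _ E0 slope K0 t]) (auto simp: E_def sum_nonneg)
    also have "\<dots> \<le> K * T" using K0 t by (intro mult_left_mono) auto
    finally have Gt: "l2_norm (G t) \<le> K * T"
      unfolding G_def[abs_def] E_def l2_norm_herm_sum[OF finite_atMost, symmetric] by simp
    interpret lowered "phase \<alpha> t" m "w t" "Amw t" by (rule lowered[OF t])
    have "l2_norm (v t) \<le> sqrt (fact (N + 1 - m) / fact (N + 1)) * l2_norm (Amw t)"
      unfolding v_def[abs_def] by (rule l2_norm_tail[OF mN])
    also have "\<dots> \<le> sqrt (fact (N + 1 - m) / fact (N + 1)) * L"
      using stab t by (intro mult_left_mono) (auto simp: L_def simp del: fact_Suc)
    finally have vt: "l2_norm (v t) \<le> sqrt (fact (N + 1 - m) / fact (N + 1)) * L" .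
    \<comment> \<open>The total error is tail minus \<open>G\<close>: the tail gives the first term
      of the estimate, \<open>G\<close> the second.\<close>
    have "l2_norm (\<lambda>\<eta>. w t \<eta> - wN t \<eta>) = l2_norm (\<lambda>\<eta>. v t \<eta> + - 1 * G t \<eta>)"
    proof (rule l2_norm_cong_AE)
      show "AE x in lborel. w t x - wN t x = v t x + - 1 * G t x"
        using diff[OF t] by eventually_elim (simp add: algebra_simps)
    qed (use w[OF t] wN[OF t] v[OF t] G[of t] in \<open>auto simp: square_integrable_def\<close>)
    also have "\<dots> \<le> l2_norm (v t) + l2_norm (\<lambda>\<eta>. - 1 * G t \<eta>)"
      by (intro l2_norm_triangle v t square_integrable_mult G)
    also have "\<dots> \<le> sqrt (fact (N + 1 - m) / fact (N + 1)) * L + K * T"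
      unfolding l2_norm_mult using vt Gt by simp
    also have "\<dots> = BmT * sqrt (fact (N + 1 - m) / fact (N + 1)) * l2_norm (Amw 0)
        + M / 6 * sqrt 20 * BmT * T * (\<epsilon> powr (1/2) / a powr (3/2))
          * sqrt (fact (N + 1 - m) / fact (N - 2)) * l2_norm (Amw 0)"
      using \<epsilon> unfolding K_def L_def \<kappa>_def real_sqrt_mult
      by (simp add: powr_half_sqrt mult_ac del: fact_Suc)
    finally show "l2_norm (\<lambda>\<eta>. w t \<eta> - wN t \<eta>)
        \<le> BmT * sqrt (fact (N + 1 - m) / fact (N + 1)) * l2_norm (Amw 0)
        + M / 6 * sqrt 20 * BmT * T * (\<epsilon> powr (1/2) / (INF s\<in>{0..T}. Im (\<alpha> s)) powr (3/2))
          * sqrt (fact (N + 1 - m) / fact (N - 2)) * l2_norm (Amw 0)"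
      unfolding a_def .
  qed
qed

end
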